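(* Let $\Omega\subset\mathbb{R}^d$ ($d\ge2$) be a bounded, simply connected Lipschitz domain. There is a constant $C>0$, independent of the mesh $\mathcal{T}$, such that the following holds for every mesh $\mathcal{T}$ of $\Omega$ and every $\boldsymbol{f}\in\boldsymbol{L}_2(\Omega)$, with $\mathfrak{U}$, $\mathfrak{V}(\mathcal{T})$, $b$, $L$ and $\mathfrak{T}$ as defined in the context. Let $\mathfrak{u}\in\mathfrak{U}$ be the unique solution of $b(\mathfrak{u},\mathfrak{v})=L(\mathfrak{v})$ for all $\mathfrak{v}\in\mathfrak{V}(\mathcal{T})$. For any finite-dimensional subspace $\mathfrak{U}_h\subset\mathfrak{U}$ there exists a unique $\mathfrak{u}_h\in\mathfrak{U}_h$ with $$b(\mathfrak{u}_h,\mathfrak{T}\delta\mathfrak{u})=L(\mathfrak{T}\delta\mathfrak{u})\qquad\forall\,\delta\mathfrak{u}\in\mathfrak{U}_h,$$ and it satisfies $$\|\mathfrak{u}-\mathfrak{u}_h\|_{\mathfrak{U}}\le C\,\|\mathfrak{u}-\mathfrak{w}\|_{\mathfrak{U}}\qquad\forall\,\mathfrak{w}\in\mathfrak{U}_h.$$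
   Context: $\Omega\subset\mathbb{R}^d$, $d\ge2$, is a bounded, simply connected Lipschitz domain with boundary $\Gamma$; $\boldsymbol{n}$ denotes the exterior unit normal vector. A mesh $\mathcal{T}=\{T\}$ is a finite collection of pairwise disjoint (open) Lipschitz domains $T\subset\Omega$ with $\bar\Omega=\bigcup_{T}\bar T$; its skeleton is $\mathcal{S}=\{\partial T: T\in\mathcal{T}\}$. $\boldsymbol{L}_2=(L_2)^d$; $\|\cdot\|$ is the $L_2(\Omega)$-norm (scalar or vector), $(\cdot,\cdot)$ the $L_2(\Omega)$ inner product, $(\cdot,\cdot)_{\mathcal{T}}=\sum_{T}(\cdot,\cdot)_T$ with differential operators taken piecewise. Spaces: $H^1$, $H^1_0$ are standard, $\|v\|_1^2=\|v\|^2+\|\nabla v\|^2$. $\boldsymbol{H}(\mathrm{div},\Omega)=\{\boldsymbol{v}\in\boldsymbol{L}_2(\Omega):\operatorname{div}\boldsymbol{v}\in L_2(\Omega)\}$ with $\|\boldsymbol{v}\|_{\mathrm{div}}^2=\|\boldsymbol{v}\|^2+\|\operatorname{div}\boldsymbol{v}\|^2$, and $\boldsymbol{H}_0(\mathrm{div},\Omega)$ is its subspace with $\boldsymbol{v}\cdot\boldsymbol{n}=0$ on $\Gamma$. $H^1(\mathcal{T})=\prod_T H^1(T)$ and $\boldsymbol{H}(\mathrm{div},\mathcal{T})=\prod_T\boldsymbol{H}(\mathrm{div},T)$ carry the product norms $\|\cdot\|_{1,\mathcal{T}}$, $\|\cdot\|_{\mathrm{div},\mathcal{T}}$. Traces: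 $\mathrm{tr}^{\mathrm{grad}}:H^1(\mathcal{T})\to\boldsymbol{H}(\mathrm{div},\mathcal{T})'$ and $\mathrm{tr}^{\mathrm{div}}:\boldsymbol{H}(\mathrm{div},\mathcal{T})\to H^1(\mathcal{T})'$ are defined by $\langle\mathrm{tr}^{\mathrm{grad}}(v),\boldsymbol{\tau}\rangle^{\nabla}_{\mathcal{S}}:=\langle\mathrm{tr}^{\mathrm{div}}(\boldsymbol{\tau}),v\rangle^{\mathrm{div}}_{\mathcal{S}}:=(v,\operatorname{div}\boldsymbol{\tau})_{\mathcal{T}}+(\nabla v,\boldsymbol{\tau})_{\mathcal{T}}$. Set $H^{1/2}(\mathcal{S})=\mathrm{tr}^{\mathrm{grad}}(H^1(\Omega))$, $H^{1/2}_0(\mathcal{S})=\mathrm{tr}^{\mathrm{grad}}(H^1_0(\Omega))$, $H^{-1/2}(\mathcal{S})=\mathrm{tr}^{\mathrm{div}}(\boldsymbol{H}(\mathrm{div},\Omega))$, $H^{-1/2}_0(\mathcal{S})=\mathrm{tr}^{\mathrm{div}}(\boldsymbol{H}_0(\mathrm{div},\Omega))$, with norms $\|\hat v\|_{1/2,\mathcal{S}}=\inf\{\|v\|_1: v\in H^1(\Omega),\ \mathrm{tr}^{\mathrm{grad}}(v)=\hat v\}$ and $\|\hat\tau\|_{-1/2,\mathcal{S}}=\inf\{\|\boldsymbol{\tau}\|_{\mathrm{div}}:\boldsymbol{\tau}\in\boldsymbol{H}(\mathrm{div},\Omega),\ \mathrm{tr}^{\mathrm{div}}(\boldsymbol{\tau})=\hat\tau\}$.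 The pairings $\langle\hat v,\boldsymbol{\tau}\rangle^{\nabla}_{\mathcal{S}}$ and $\langle\hat\tau,v\rangle^{\mathrm{div}}_{\mathcal{S}}$ are the evaluations of these functionals on $\boldsymbol{\tau}\in\boldsymbol{H}(\mathrm{div},\mathcal{T})$ and $v\in H^1(\mathcal{T})$. Formulation: $\mathfrak{U}=\mathfrak{U}_0\times\widehat{\mathfrak{U}}$ with $\mathfrak{U}_0=\boldsymbol{L}_2(\Omega)\times L_2(\Omega)\times\boldsymbol{L}_2(\Omega)\times L_2(\Omega)$, $\widehat{\mathfrak{U}}=H^{-1/2}_0(\mathcal{S})\times H^{1/2}_0(\mathcal{S})\times H^{-1/2}(\mathcal{S})\times H^{1/2}(\mathcal{S})$; for $\mathfrak{u}=(\boldsymbol{u}_1,u_2,\boldsymbol{u}_3,u_4,\hat u_1,\hat u_2,\hat u_3,\hat u_4)$, $\|\mathfrak{u}\|_{\mathfrak{U}}^2=\|\boldsymbol{u}_1\|^2+\|u_2\|^2+\|\boldsymbol{u}_3\|^2+\|u_4\|^2+\|\hat u_1\|_{-1/2,\mathcal{S}}^2+\|\hat u_2\|_{1/2,\mathcal{S}}^2+\|\hat u_3\|_{-1/2,\mathcal{S}}^2+\|\hat u_4\|_{1/2,\mathcal{S}}^2$. Test space $\mathfrak{V}(\mathcal{T})=\boldsymbol{H}(\mathrm{div},\mathcal{T})\times H^1(\mathcal{T})\times\boldsymbol{H}(\mathrm{div},\mathcal{T})\times H^1(\mathcal{T})$ with the product norm and the inner product $\langle\!\langle\cdot,\cdot\rangle\!\rangle_{\mathfrak{V}(\mathcal{T})}$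 inducing it. For $\mathfrak{v}=(\boldsymbol{v}_1,v_2,\boldsymbol{v}_3,v_4)$, $$b(\mathfrak{u},\mathfrak{v})=(\boldsymbol{u}_1,\boldsymbol{v}_1-\nabla v_4)_{\mathcal{T}}-(u_2,v_4+\operatorname{div}\boldsymbol{v}_3)_{\mathcal{T}}-(\boldsymbol{u}_3,\boldsymbol{v}_3+\nabla v_2)_{\mathcal{T}}-(u_4,v_2+\operatorname{div}\boldsymbol{v}_1)_{\mathcal{T}}+\langle\hat u_1,v_4\rangle^{\mathrm{div}}_{\mathcal{S}}+\langle\hat u_2,\boldsymbol{v}_3\rangle^{\nabla}_{\mathcal{S}}+\langle\hat u_3,v_2\rangle^{\mathrm{div}}_{\mathcal{S}}+\langle\hat u_4,\boldsymbol{v}_1\rangle^{\nabla}_{\mathcal{S}},$$ $L(\mathfrak{v})=(\boldsymbol{f},\boldsymbol{v}_1)$. The trial-to-test operator $\mathfrak{T}:\mathfrak{U}\to\mathfrak{V}(\mathcal{T})$ is defined by $\langle\!\langle\mathfrak{T}\mathfrak{u},\mathfrak{v}\rangle\!\rangle_{\mathfrak{V}(\mathcal{T})}=b(\mathfrak{u},\mathfrak{v})$ for all $\mathfrak{v}\in\mathfrak{V}(\mathcal{T})$. The problem $b(\mathfrak{u},\cdot)=L$ on $\mathfrak{V}(\mathcal{T})$ has a unique solution $\mathfrak{u}\in\mathfrak{U}$. *)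

theory Defs
  imports "HOL-Analysis.Analysis" "HOL-Library.Function_Algebras"
begin

section \<open>Function spaces as real vector spaces\<close>

instantiation "fun" :: (type, real_vector) real_vector
begin

definition "c *\<^sub>R f = (\<lambda>x. c *\<^sub>R f x)"

instance
  by standard (simp_all add: scaleR_fun_def fun_eq_iff scaleR_add_right scaleR_add_left)

end

lemma scaleR_fun_apply [simp]: "(c *\<^sub>R f) x = c *\<^sub>R f x"
  by (simp add: scaleR_fun_def)


section \<open>Square-integrable functions modulo equality almost everywhere\<close>

definition square_integrable :: "('a::euclidean_space \<Rightarrow> 'b::euclidean_space) \<Rightarrow> bool" where
  "square_integrable f \<longleftrightarrow>
     f \<in> borel_measurable lborel \<and> integrable lborel (\<lambda>x. (norm (f x))\<^sup>2)"

lemma square_integrable_measurable: "square_integrable f \<Longrightarrow> f \<in> borel_measurable borel"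
  by (simp add: square_integrable_def)

lemma square_integrable_zero: "square_integrable (\<lambda>x. 0)"
  by (simp add: square_integrable_def)

lemma square_integrable_scaleR:
  assumes "square_integrable f"
  shows "square_integrable (\<lambda>x. c *\<^sub>R f x)"
  using assms by (auto simp: square_integrable_def power_mult_distrib)

lemma square_integrable_add:
  assumes "square_integrable f" "square_integrable g"
  shows "square_integrable (\<lambda>x. f x + g x)"
proof -
  have [measurable]: "f \<in> borel_measurable borel" "g \<in> borel_measurable borel"
    using assms by (simp_all add: square_integrable_def)
  have "(norm (f x + g x))\<^sup>2 \<le> 2 * (norm (f x))\<^sup>2 + 2 * (norm (g x))\<^sup>2" for x
  proof -
    have "(norm (f x + g x))\<^sup>2 \<le> (norm (f x) + norm (g x))\<^sup>2"
      by (simp add: norm_triangle_ineq power_mono)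
    also have "\<dots> \<le> 2 * (norm (f x))\<^sup>2 + 2 * (norm (g x))\<^sup>2"
      using sum_squares_bound[of "norm (f x)" "norm (g x)"] by (simp add: power2_sum)
    finally show ?thesis .
  qed
  then have *: "norm ((norm (f x + g x))\<^sup>2) \<le> norm (2 * (norm (f x))\<^sup>2 + 2 * (norm (g x))\<^sup>2)" for x
    by simp
  have "integrable lborel (\<lambda>x. 2 * (norm (f x))\<^sup>2 + 2 * (norm (g x))\<^sup>2)"
    using assms by (simp add: square_integrable_def)
  moreover have "(\<lambda>x. (norm (f x + g x))\<^sup>2) \<in> borel_measurable lborel"
    by measurable
  ultimately have "integrable lborel (\<lambda>x. (norm (f x + g x))\<^sup>2)"
    by (rule Bochner_Integration.integrable_bound) (simp add: * del: real_norm_def)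
  then show ?thesis
    by (simp add: square_integrable_def)
qed

lemma square_integrable_uminus: "square_integrable f \<Longrightarrow> square_integrable (\<lambda>x. - f x)"
  by (auto simp: square_integrable_def)

lemma square_integrable_diff:
  "square_integrable f \<Longrightarrow> square_integrable g \<Longrightarrow> square_integrable (\<lambda>x. f x - g x)"
  using square_integrable_add[of f "\<lambda>x. - g x"] square_integrable_uminus[of g] by simp

lemma square_integrable_indicator:
  assumes f: "square_integrable f" and S: "S \<in> sets borel"
  shows "square_integrable (\<lambda>x. indicat_real S x *\<^sub>R f x)"
proof -
  have [measurable]: "f \<in> borel_measurable borel" "S \<in> sets borel"
    using assms by (simp_all add: square_integrable_def)
  have "integrable lborel (\<lambda>x. (norm (indicat_real S x *\<^sub>R f x))\<^sup>2)"
  proof (rule Bochner_Integration.integrable_bound)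
    show "integrable lborel (\<lambda>x. (norm (f x))\<^sup>2)"
      using f by (simp add: square_integrable_def)
    show "(\<lambda>x. (norm (indicat_real S x *\<^sub>R f x))\<^sup>2) \<in> borel_measurable lborel"
      by measurable
    show "AE x in lborel. norm ((norm (indicat_real S x *\<^sub>R f x))\<^sup>2) \<le> norm ((norm (f x))\<^sup>2)"
      by (simp add: indicator_def)
  qed
  then show ?thesis
    by (simp add: square_integrable_def)
qed

lemma square_integrable_inner:
  assumes "square_integrable f" "square_integrable g"
  shows "integrable lborel (\<lambda>x. f x \<bullet> g x)"
proof -
  have [measurable]: "f \<in> borel_measurable borel" "g \<in> borel_measurable borel"
    using assms by (simp_all add: square_integrable_def)
  have "norm (f x \<bullet> g x) \<le> norm ((norm (f x))\<^sup>2 + (norm (g x))\<^sup>2)" for x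
  proof -
    have "\<bar>f x \<bullet> g x\<bar> \<le> norm (f x) * norm (g x)"
      by (rule Cauchy_Schwarz_ineq2)
    moreover have "2 * (norm (f x) * norm (g x)) \<le> (norm (f x))\<^sup>2 + (norm (g x))\<^sup>2"
      using sum_squares_bound[of "norm (f x)" "norm (g x)"] by simp
    moreover have "0 \<le> norm (f x) * norm (g x)"
      by simp
    ultimately show ?thesis
      by simp
  qed
  moreover have "integrable lborel (\<lambda>x. (norm (f x))\<^sup>2 + (norm (g x))\<^sup>2)"
    using assms by (intro Bochner_Integration.integrable_add) (simp_all add: square_integrable_def)
  moreover have "(\<lambda>x. f x \<bullet> g x) \<in> borel_measurable lborel"
    by measurable
  ultimately show ?thesis
    by (intro Bochner_Integration.integrable_bound[where g = "\<lambda>x. f x \<bullet> g x"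
        and f = "\<lambda>x. (norm (f x))\<^sup>2 + (norm (g x))\<^sup>2"] AE_I2)
qed

quotient_type (overloaded) ('a, 'b) l2 = "'a::euclidean_space \<Rightarrow> 'b::euclidean_space" /
  partial: "\<lambda>f g. square_integrable f \<and> square_integrable g \<and> (AE x in lborel. f x = g x)"
proof (rule part_equivpI)
  show "\<exists>f::'a \<Rightarrow> 'b. square_integrable f \<and> square_integrable f \<and> (AE x in lborel. f x = f x)"
    by (rule exI[of _ "\<lambda>x. 0"]) (simp add: square_integrable_zero)
  show "symp (\<lambda>(f::'a \<Rightarrow> 'b) g. square_integrable f \<and> square_integrable g \<and> (AE x in lborel. f x = g x))"
    by (auto intro!: sympI elim: AE_mp)
  show "transp (\<lambda>(f::'a \<Rightarrow> 'b) g. square_integrable f \<and> square_integrable g \<and> (AE x in lborel. f x = g x))"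
    by (rule transpI) auto
qed

text \<open>The whole-space \<open>L\<^sub>2\<close> is an inner product space; in particular its \<open>norm\<close> and \<open>\<bullet>\<close> are the
  \<open>L\<^sub>2\<close> norm and inner product.\<close>

instantiation l2 :: (euclidean_space, euclidean_space) real_inner
begin

lift_definition zero_l2 :: "('a, 'b) l2" is "\<lambda>x. 0"
  by (simp add: square_integrable_zero)

lift_definition plus_l2 :: "('a, 'b) l2 \<Rightarrow> ('a, 'b) l2 \<Rightarrow> ('a, 'b) l2" is "\<lambda>f g x. f x + g x"
  by (auto simp: square_integrable_add)

lift_definition minus_l2 :: "('a, 'b) l2 \<Rightarrow> ('a, 'b) l2 \<Rightarrow> ('a, 'b) l2" is "\<lambda>f g x. f x - g x"
  by (auto simp: square_integrable_diff)

lift_definition uminus_l2 :: "('a, 'b) l2 \<Rightarrow> ('a, 'b) l2" is "\<lambda>f x. - f x"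
  by (auto simp: square_integrable_uminus)

lift_definition scaleR_l2 :: "real \<Rightarrow> ('a, 'b) l2 \<Rightarrow> ('a, 'b) l2" is "\<lambda>c f x. c *\<^sub>R f x"
  by (auto simp: square_integrable_scaleR)

lift_definition inner_l2 :: "('a, 'b) l2 \<Rightarrow> ('a, 'b) l2 \<Rightarrow> real" is
  "\<lambda>f g. LINT x|lborel. f x \<bullet> g x"
  by (rule integral_cong_AE)
    (auto simp: square_integrable_def intro!: borel_measurable_inner)

definition norm_l2 :: "('a, 'b) l2 \<Rightarrow> real" where
  "norm_l2 u = sqrt (u \<bullet> u)"

definition dist_l2 :: "('a, 'b) l2 \<Rightarrow> ('a, 'b) l2 \<Rightarrow> real" where
  "dist_l2 u v = norm (u - v)"

definition sgn_l2 :: "('a, 'b) l2 \<Rightarrow> ('a, 'b) l2" where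
  "sgn_l2 u = inverse (norm u) *\<^sub>R u"

definition uniformity_l2 :: "(('a, 'b) l2 \<times> ('a, 'b) l2) filter" where
  "uniformity_l2 = (INF e\<in>{0<..}. principal {(u, v). dist u v < e})"

definition open_l2 :: "('a, 'b) l2 set \<Rightarrow> bool" where
  "open_l2 U \<longleftrightarrow> (\<forall>u\<in>U. \<forall>\<^sub>F (u', v) in uniformity. u' = u \<longrightarrow> v \<in> U)"

instance
proof
  fix u v w :: "('a, 'b) l2" and a b :: real
  show "u + v + w = u + (v + w)"
    by transfer (auto simp: square_integrable_add add.assoc)
  show "u + v = v + u"
    by transfer (auto simp: square_integrable_add add.commute)
  show "0 + u = u"
    by transfer auto
  show "- u + u = 0"
    by transfer (auto simp: square_integrable_zero)
  show "u - v = u + - v"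
    by transfer (auto simp: square_integrable_diff)
  show "a *\<^sub>R (u + v) = a *\<^sub>R u + a *\<^sub>R v"
    by transfer (auto simp: square_integrable_add square_integrable_scaleR scaleR_add_right)
  show "(a + b) *\<^sub>R u = a *\<^sub>R u + b *\<^sub>R u"
    by transfer (auto simp: square_integrable_add square_integrable_scaleR scaleR_add_left)
  show "a *\<^sub>R b *\<^sub>R u = (a * b) *\<^sub>R u"
    by transfer (auto simp: square_integrable_scaleR)
  show "1 *\<^sub>R u = u"
    by transfer auto
  show "dist u v = norm (u - v)"
    by (rule dist_l2_def)
  show "sgn u = inverse (norm u) *\<^sub>R u"
    by (rule sgn_l2_def)
  show "uniformity = (INF e\<in>{0<..}. principal {(u, v :: ('a, 'b) l2). dist u v < e})"
    by (rule uniformity_l2_def)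
  show "open U \<longleftrightarrow> (\<forall>u\<in>U. \<forall>\<^sub>F (u', v) in uniformity. u' = u \<longrightarrow> v \<in> U)" for U :: "('a, 'b) l2 set"
    by (rule open_l2_def)
  show "u \<bullet> v = v \<bullet> u"
    by transfer (simp add: inner_commute)
  show "(u + v) \<bullet> w = u \<bullet> w + v \<bullet> w"
    by transfer (auto simp: inner_add_left square_integrable_inner)
  show "(a *\<^sub>R u) \<bullet> v = a * (u \<bullet> v)"
    by transfer simp
  show "0 \<le> u \<bullet> u"
    by transfer simp
  show "u \<bullet> u = 0 \<longleftrightarrow> u = 0"
  proof transfer
    fix f :: "'a \<Rightarrow> 'b"
    assume "square_integrable f \<and> square_integrable f \<and> (AE x in lborel. f x = f x)"
    then have f: "square_integrable f"
      by simp
    have "(LINT x|lborel. f x \<bullet> f x) = 0 \<longleftrightarrow> (AE x in lborel. f x \<bullet> f x = 0)"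
      by (rule integral_nonneg_eq_0_iff_AE) (simp_all add: f square_integrable_inner)
    then show "(LINT x|lborel. f x \<bullet> f x) = 0 \<longleftrightarrow>
        square_integrable f \<and> square_integrable (\<lambda>x. 0 :: 'b) \<and> (AE x in lborel. f x = 0)"
      by (simp add: f square_integrable_zero)
  qed
  show "norm u = sqrt (u \<bullet> u)"
    by (rule norm_l2_def)
qed

end

text \<open>\<open>L2 S\<close> is \<open>L\<^sub>2(S)\<close>, identified with the classes on the whole space that vanish off \<open>S\<close>.
  So \<open>norm u\<close> and \<open>u \<bullet> v\<close> are the norm and inner product of \<open>L\<^sub>2(S)\<close> for \<open>u, v \<in> L2 S\<close>, and \<open>u \<bullet> v\<close>
  is the inner product of \<open>L\<^sub>2(T)\<close> as soon as one of \<open>u, v\<close> lies in \<open>L2 T\<close>.\<close>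

lift_definition vanishes_off :: "'a::euclidean_space set \<Rightarrow> ('a, 'b::euclidean_space) l2 \<Rightarrow> bool" is
  "\<lambda>S f. AE x in lborel. x \<notin> S \<longrightarrow> f x = 0"
proof -
  fix S :: "'a set" and f g :: "'a \<Rightarrow> 'b"
  assume "square_integrable f \<and> square_integrable g \<and> (AE x in lborel. f x = g x)"
  then have "AE x in lborel. f x = g x"
    by simp
  then have "AE x in lborel. (x \<notin> S \<longrightarrow> f x = 0) = (x \<notin> S \<longrightarrow> g x = 0)"
    by eventually_elim simp
  then show "(AE x in lborel. x \<notin> S \<longrightarrow> f x = 0) = (AE x in lborel. x \<notin> S \<longrightarrow> g x = 0)"
    by (rule eventually_subst)
qed

definition L2 :: "'a::euclidean_space set \<Rightarrow> ('a, 'b::euclidean_space) l2 set" where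
  "L2 S = {u. vanishes_off S u}"

lift_definition restrict_l2 :: "'a::euclidean_space set \<Rightarrow> ('a, 'b::euclidean_space) l2 \<Rightarrow> ('a, 'b) l2" is
  "\<lambda>S f. if S \<in> sets borel then (\<lambda>x. indicat_real S x *\<^sub>R f x) else (\<lambda>x. 0)"
  by (auto simp: square_integrable_zero square_integrable_indicator)


section \<open>Weak derivatives and Sobolev spaces\<close>

primrec C_k :: "nat \<Rightarrow> ('a::euclidean_space \<Rightarrow> real) \<Rightarrow> bool" where
  "C_k 0 f \<longleftrightarrow> continuous_on UNIV f"
| "C_k (Suc k) f \<longleftrightarrow>
     (\<forall>x. f differentiable (at x)) \<and> (\<forall>b\<in>Basis. C_k k (\<lambda>x. frechet_derivative f (at x) b))"

definition test_functions :: "'a::euclidean_space set \<Rightarrow> ('a \<Rightarrow> real) set" where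
  "test_functions S =
     {\<phi>. (\<forall>k. C_k k \<phi>) \<and> compact (closure {x. \<phi> x \<noteq> 0}) \<and> closure {x. \<phi> x \<noteq> 0} \<subseteq> S}"

definition gradient :: "('a::euclidean_space \<Rightarrow> real) \<Rightarrow> 'a \<Rightarrow> 'a" where
  "gradient \<phi> x = (\<Sum>b\<in>Basis. frechet_derivative \<phi> (at x) b *\<^sub>R b)"

lemma test_function_measurable:
  assumes "\<phi> \<in> test_functions S"
  shows "\<phi> \<in> borel_measurable borel"
    and "b \<in> Basis \<Longrightarrow> (\<lambda>x. frechet_derivative \<phi> (at x) b) \<in> borel_measurable borel"
    and "gradient \<phi> \<in> borel_measurable borel"
proof -
  have "C_k 0 \<phi>" "C_k (Suc 0) \<phi>"
    using assms by (simp_all only: test_functions_def mem_Collect_eq)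
  then show "\<phi> \<in> borel_measurable borel"
    by (auto intro!: borel_measurable_continuous_onI)
  show *: "(\<lambda>x. frechet_derivative \<phi> (at x) b) \<in> borel_measurable borel" if "b \<in> Basis" for b
    using \<open>C_k (Suc 0) \<phi>\<close> that by (auto intro!: borel_measurable_continuous_onI)
  have "(\<lambda>x. \<Sum>b\<in>Basis. frechet_derivative \<phi> (at x) b *\<^sub>R b) \<in> borel_measurable borel"
    by (intro borel_measurable_sum borel_measurable_scaleR *) auto
  then show "gradient \<phi> \<in> borel_measurable borel"
    by (simp add: gradient_def[abs_def])
qed

text \<open>The integrals extend over the whole space, but the test functions are supported in \<open>S\<close>.\<close>

lift_definition has_weak_gradient ::
  "'a::euclidean_space set \<Rightarrow> ('a, real) l2 \<Rightarrow> ('a, 'a) l2 \<Rightarrow> bool" is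
  "\<lambda>S v g. \<forall>\<phi>\<in>test_functions S. \<forall>b\<in>Basis.
     (LINT x|lborel. v x * frechet_derivative \<phi> (at x) b) = - (LINT x|lborel. (g x \<bullet> b) * \<phi> x)"
proof -
  fix S :: "'a set" and v v' :: "'a \<Rightarrow> real" and g g' :: "'a \<Rightarrow> 'a"
  assume v: "square_integrable v \<and> square_integrable v' \<and> (AE x in lborel. v x = v' x)"
    and g: "square_integrable g \<and> square_integrable g' \<and> (AE x in lborel. g x = g' x)"
  have [measurable]: "v \<in> borel_measurable borel" "v' \<in> borel_measurable borel"
    "g \<in> borel_measurable borel" "g' \<in> borel_measurable borel"
    using v g by (auto simp: square_integrable_measurable)
  have "(LINT x|lborel. v x * frechet_derivative \<phi> (at x) b) =
          (LINT x|lborel. v' x * frechet_derivative \<phi> (at x) b)"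
    and "(LINT x|lborel. (g x \<bullet> b) * \<phi> x) = (LINT x|lborel. (g' x \<bullet> b) * \<phi> x)"
    if "\<phi> \<in> test_functions S" "b \<in> Basis" for \<phi> b
  proof -
    have [measurable]: "\<phi> \<in> borel_measurable borel"
      "(\<lambda>x. frechet_derivative \<phi> (at x) b) \<in> borel_measurable borel"
      using that by (simp_all add: test_function_measurable)
    show "(LINT x|lborel. v x * frechet_derivative \<phi> (at x) b) =
          (LINT x|lborel. v' x * frechet_derivative \<phi> (at x) b)"
      using v by (intro integral_cong_AE) auto
    show "(LINT x|lborel. (g x \<bullet> b) * \<phi> x) = (LINT x|lborel. (g' x \<bullet> b) * \<phi> x)"
      using g by (intro integral_cong_AE) auto
  qed
  then show "(\<forall>\<phi>\<in>test_functions S. \<forall>b\<in>Basis.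
       (LINT x|lborel. v x * frechet_derivative \<phi> (at x) b) = - (LINT x|lborel. (g x \<bullet> b) * \<phi> x)) =
     (\<forall>\<phi>\<in>test_functions S. \<forall>b\<in>Basis.
       (LINT x|lborel. v' x * frechet_derivative \<phi> (at x) b) = - (LINT x|lborel. (g' x \<bullet> b) * \<phi> x))"
    by simp
qed

lift_definition has_weak_divergence ::
  "'a::euclidean_space set \<Rightarrow> ('a, 'a) l2 \<Rightarrow> ('a, real) l2 \<Rightarrow> bool" is
  "\<lambda>S \<tau> d. \<forall>\<phi>\<in>test_functions S.
     (LINT x|lborel. \<tau> x \<bullet> gradient \<phi> x) = - (LINT x|lborel. d x * \<phi> x)"
proof -
  fix S :: "'a set" and \<tau> \<tau>' :: "'a \<Rightarrow> 'a" and d d' :: "'a \<Rightarrow> real"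
  assume \<tau>: "square_integrable \<tau> \<and> square_integrable \<tau>' \<and> (AE x in lborel. \<tau> x = \<tau>' x)"
    and d: "square_integrable d \<and> square_integrable d' \<and> (AE x in lborel. d x = d' x)"
  have [measurable]: "\<tau> \<in> borel_measurable borel" "\<tau>' \<in> borel_measurable borel"
    "d \<in> borel_measurable borel" "d' \<in> borel_measurable borel"
    using \<tau> d by (auto simp: square_integrable_measurable)
  have "(LINT x|lborel. \<tau> x \<bullet> gradient \<phi> x) = (LINT x|lborel. \<tau>' x \<bullet> gradient \<phi> x)"
    and "(LINT x|lborel. d x * \<phi> x) = (LINT x|lborel. d' x * \<phi> x)"
    if "\<phi> \<in> test_functions S" for \<phi>
  proof -
    have [measurable]: "\<phi> \<in> borel_measurable borel" "gradient \<phi> \<in> borel_measurable borel"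
      using that by (simp_all add: test_function_measurable)
    show "(LINT x|lborel. \<tau> x \<bullet> gradient \<phi> x) = (LINT x|lborel. \<tau>' x \<bullet> gradient \<phi> x)"
      using \<tau> by (intro integral_cong_AE) auto
    show "(LINT x|lborel. d x * \<phi> x) = (LINT x|lborel. d' x * \<phi> x)"
      using d by (intro integral_cong_AE) auto
  qed
  then show "(\<forall>\<phi>\<in>test_functions S.
       (LINT x|lborel. \<tau> x \<bullet> gradient \<phi> x) = - (LINT x|lborel. d x * \<phi> x)) =
     (\<forall>\<phi>\<in>test_functions S.
       (LINT x|lborel. \<tau>' x \<bullet> gradient \<phi> x) = - (LINT x|lborel. d' x * \<phi> x))"
    by simp
qed

definition H1 :: "'a::euclidean_space set \<Rightarrow> ('a, real) l2 set" where
  "H1 S = {v \<in> L2 S. \<exists>g\<in>L2 S. has_weak_gradient S v g}"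

definition wgrad :: "'a::euclidean_space set \<Rightarrow> ('a, real) l2 \<Rightarrow> ('a, 'a) l2" where
  "wgrad S v = (THE g. g \<in> L2 S \<and> has_weak_gradient S v g)"

definition norm_H1 :: "'a::euclidean_space set \<Rightarrow> ('a, real) l2 \<Rightarrow> real" where
  "norm_H1 S v = sqrt ((norm v)\<^sup>2 + (norm (wgrad S v))\<^sup>2)"

definition H10 :: "'a::euclidean_space set \<Rightarrow> ('a, real) l2 set" where
  "H10 S = {v \<in> H1 S. \<forall>e>0. \<exists>\<phi>\<in>test_functions S. norm_H1 S (v - abs_l2 \<phi>) < e}"

definition Hdiv :: "'a::euclidean_space set \<Rightarrow> ('a, 'a) l2 set" where
  "Hdiv S = {\<tau> \<in> L2 S. \<exists>d\<in>L2 S. has_weak_divergence S \<tau> d}"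

definition wdiv :: "'a::euclidean_space set \<Rightarrow> ('a, 'a) l2 \<Rightarrow> ('a, real) l2" where
  "wdiv S \<tau> = (THE d. d \<in> L2 S \<and> has_weak_divergence S \<tau> d)"

definition norm_Hdiv :: "'a::euclidean_space set \<Rightarrow> ('a, 'a) l2 \<Rightarrow> real" where
  "norm_Hdiv S \<tau> = sqrt ((norm \<tau>)\<^sup>2 + (norm (wdiv S \<tau>))\<^sup>2)"

text \<open>For \<open>\<tau> \<in> Hdiv S\<close> the normal component on the boundary is not a function in general; it is the
  functional given by Green's formula,
  \<open>\<langle>\<tau> \<cdot> n, w\<rangle> = (div \<tau>, w) + (\<tau>, \<nabla>w)\<close> for \<open>w \<in> H1 S\<close>.\<close>

definition normal_trace :: "'a::euclidean_space set \<Rightarrow> ('a, 'a) l2 \<Rightarrow> ('a, real) l2 \<Rightarrow> real" where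
  "normal_trace S \<tau> = (\<lambda>w. if w \<in> H1 S then wdiv S \<tau> \<bullet> w + \<tau> \<bullet> wgrad S w else 0)"

definition Hdiv0 :: "'a::euclidean_space set \<Rightarrow> ('a, 'a) l2 set" where
  "Hdiv0 S = {\<tau> \<in> Hdiv S. normal_trace S \<tau> = 0}"


section \<open>Lipschitz domains and meshes\<close>

text \<open>Near each boundary point the domain is the strict epigraph, in some direction \<open>e\<close>, of a
  Lipschitz function on the hyperplane orthogonal to \<open>e\<close>.\<close>

definition lipschitz_domain :: "'a::euclidean_space set \<Rightarrow> bool" where
  "lipschitz_domain S \<longleftrightarrow> open S \<and> connected S \<and> S \<noteq> {} \<and>
     (\<forall>p\<in>frontier S. \<exists>e r K. \<exists>\<psi>::'a \<Rightarrow> real.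
        norm e = 1 \<and> 0 < r \<and> lipschitz_on K {y. y \<bullet> e = 0} \<psi> \<and>
        S \<inter> ball p r = {x \<in> ball p r. \<psi> (x - (x \<bullet> e) *\<^sub>R e) < x \<bullet> e})"

definition is_mesh :: "'a::euclidean_space set \<Rightarrow> 'a set set \<Rightarrow> bool" where
  "is_mesh \<Omega> M \<longleftrightarrow> finite M \<and> pairwise disjnt M \<and>
     (\<forall>T\<in>M. lipschitz_domain T \<and> T \<subseteq> \<Omega>) \<and> closure \<Omega> = (\<Union>T\<in>M. closure T)"


section \<open>Broken spaces and traces on the skeleton\<close>

text \<open>An element of a product over the mesh is a family indexed by the mesh elements, set to \<open>0\<close> at
  all other indices.\<close>

definition H1_broken :: "'a::euclidean_space set set \<Rightarrow> ('a set \<Rightarrow> ('a, real) l2) set" where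
  "H1_broken M = {v. (\<forall>T\<in>M. v T \<in> H1 T) \<and> (\<forall>T. T \<notin> M \<longrightarrow> v T = 0)}"

definition Hdiv_broken :: "'a::euclidean_space set set \<Rightarrow> ('a set \<Rightarrow> ('a, 'a) l2) set" where
  "Hdiv_broken M = {\<tau>. (\<forall>T\<in>M. \<tau> T \<in> Hdiv T) \<and> (\<forall>T. T \<notin> M \<longrightarrow> \<tau> T = 0)}"

text \<open>The canonical map from functions on the whole domain to families of functions on the elements.\<close>

definition broken :: "'a::euclidean_space set set \<Rightarrow> ('a, 'b::euclidean_space) l2 \<Rightarrow> 'a set \<Rightarrow> ('a, 'b) l2" where
  "broken M u = (\<lambda>T. if T \<in> M then restrict_l2 T u else 0)"

definition skeleton_pairing ::
  "'a::euclidean_space set set \<Rightarrow> ('a set \<Rightarrow> ('a, real) l2) \<Rightarrow> ('a set \<Rightarrow> ('a, 'a) l2) \<Rightarrow> real" where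
  "skeleton_pairing M v \<tau> = (\<Sum>T\<in>M. v T \<bullet> wdiv T (\<tau> T)) + (\<Sum>T\<in>M. wgrad T (v T) \<bullet> \<tau> T)"

text \<open>Functionals on a broken space are set to \<open>0\<close> off that space, so that equality of functions is
  equality of functionals.\<close>

definition tr_grad ::
  "'a::euclidean_space set set \<Rightarrow> ('a set \<Rightarrow> ('a, real) l2) \<Rightarrow> ('a set \<Rightarrow> ('a, 'a) l2) \<Rightarrow> real" where
  "tr_grad M v = (\<lambda>\<tau>. if \<tau> \<in> Hdiv_broken M then skeleton_pairing M v \<tau> else 0)"

definition tr_div ::
  "'a::euclidean_space set set \<Rightarrow> ('a set \<Rightarrow> ('a, 'a) l2) \<Rightarrow> ('a set \<Rightarrow> ('a, real) l2) \<Rightarrow> real" where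
  "tr_div M \<tau> = (\<lambda>v. if v \<in> H1_broken M then skeleton_pairing M v \<tau> else 0)"

type_synonym 'a grad_trace = "('a set \<Rightarrow> ('a, 'a) l2) \<Rightarrow> real"
type_synonym 'a div_trace = "('a set \<Rightarrow> ('a, real) l2) \<Rightarrow> real"

definition H_half :: "'a::euclidean_space set \<Rightarrow> 'a set set \<Rightarrow> 'a grad_trace set" where
  "H_half \<Omega> M = (\<lambda>v. tr_grad M (broken M v)) ` H1 \<Omega>"

definition H_half0 :: "'a::euclidean_space set \<Rightarrow> 'a set set \<Rightarrow> 'a grad_trace set" where
  "H_half0 \<Omega> M = (\<lambda>v. tr_grad M (broken M v)) ` H10 \<Omega>"

definition H_mhalf :: "'a::euclidean_space set \<Rightarrow> 'a set set \<Rightarrow> 'a div_trace set" where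
  "H_mhalf \<Omega> M = (\<lambda>\<tau>. tr_div M (broken M \<tau>)) ` Hdiv \<Omega>"

definition H_mhalf0 :: "'a::euclidean_space set \<Rightarrow> 'a set set \<Rightarrow> 'a div_trace set" where
  "H_mhalf0 \<Omega> M = (\<lambda>\<tau>. tr_div M (broken M \<tau>)) ` Hdiv0 \<Omega>"

definition norm_half :: "'a::euclidean_space set \<Rightarrow> 'a set set \<Rightarrow> 'a grad_trace \<Rightarrow> real" where
  "norm_half \<Omega> M h = Inf {norm_H1 \<Omega> v |v. v \<in> H1 \<Omega> \<and> tr_grad M (broken M v) = h}"

definition norm_mhalf :: "'a::euclidean_space set \<Rightarrow> 'a set set \<Rightarrow> 'a div_trace \<Rightarrow> real" where
  "norm_mhalf \<Omega> M h = Inf {norm_Hdiv \<Omega> \<tau> |\<tau>. \<tau> \<in> Hdiv \<Omega> \<and> tr_div M (broken M \<tau>) = h}"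


section \<open>The ultraweak formulation\<close>

type_synonym 'a trial =
  "('a, 'a) l2 \<times> ('a, real) l2 \<times> ('a, 'a) l2 \<times> ('a, real) l2 \<times>
   'a div_trace \<times> 'a grad_trace \<times> 'a div_trace \<times> 'a grad_trace"

type_synonym 'a test =
  "('a set \<Rightarrow> ('a, 'a) l2) \<times> ('a set \<Rightarrow> ('a, real) l2) \<times>
   ('a set \<Rightarrow> ('a, 'a) l2) \<times> ('a set \<Rightarrow> ('a, real) l2)"

definition trial_space :: "'a::euclidean_space set \<Rightarrow> 'a set set \<Rightarrow> 'a trial set" where
  "trial_space \<Omega> M = L2 \<Omega> \<times> L2 \<Omega> \<times> L2 \<Omega> \<times> L2 \<Omega> \<times>
     H_mhalf0 \<Omega> M \<times> H_half0 \<Omega> M \<times> H_mhalf \<Omega> M \<times> H_half \<Omega> M"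

definition norm_trial :: "'a::euclidean_space set \<Rightarrow> 'a set set \<Rightarrow> 'a trial \<Rightarrow> real" where
  "norm_trial \<Omega> M = (\<lambda>(u1, u2, u3, u4, h1, h2, h3, h4).
     sqrt ((norm u1)\<^sup>2 + (norm u2)\<^sup>2 + (norm u3)\<^sup>2 + (norm u4)\<^sup>2 +
       (norm_mhalf \<Omega> M h1)\<^sup>2 + (norm_half \<Omega> M h2)\<^sup>2 + (norm_mhalf \<Omega> M h3)\<^sup>2 + (norm_half \<Omega> M h4)\<^sup>2))"

definition test_space :: "'a::euclidean_space set set \<Rightarrow> 'a test set" where
  "test_space M = Hdiv_broken M \<times> H1_broken M \<times> Hdiv_broken M \<times> H1_broken M"

definition inner_Hdiv_broken ::
  "'a::euclidean_space set set \<Rightarrow> ('a set \<Rightarrow> ('a, 'a) l2) \<Rightarrow> ('a set \<Rightarrow> ('a, 'a) l2) \<Rightarrow> real" where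
  "inner_Hdiv_broken M \<sigma> \<tau> = (\<Sum>T\<in>M. \<sigma> T \<bullet> \<tau> T + wdiv T (\<sigma> T) \<bullet> wdiv T (\<tau> T))"

definition inner_H1_broken ::
  "'a::euclidean_space set set \<Rightarrow> ('a set \<Rightarrow> ('a, real) l2) \<Rightarrow> ('a set \<Rightarrow> ('a, real) l2) \<Rightarrow> real" where
  "inner_H1_broken M w v = (\<Sum>T\<in>M. w T \<bullet> v T + wgrad T (w T) \<bullet> wgrad T (v T))"

definition inner_test :: "'a::euclidean_space set set \<Rightarrow> 'a test \<Rightarrow> 'a test \<Rightarrow> real" where
  "inner_test M = (\<lambda>(w1, w2, w3, w4) (v1, v2, v3, v4).
     inner_Hdiv_broken M w1 v1 + inner_H1_broken M w2 v2 +
     inner_Hdiv_broken M w3 v3 + inner_H1_broken M w4 v4)"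

definition b_form :: "'a::euclidean_space set set \<Rightarrow> 'a trial \<Rightarrow> 'a test \<Rightarrow> real" where
  "b_form M = (\<lambda>(u1, u2, u3, u4, h1, h2, h3, h4) (v1, v2, v3, v4).
     (\<Sum>T\<in>M. u1 \<bullet> (v1 T - wgrad T (v4 T)))
     - (\<Sum>T\<in>M. u2 \<bullet> (v4 T + wdiv T (v3 T)))
     - (\<Sum>T\<in>M. u3 \<bullet> (v3 T + wgrad T (v2 T)))
     - (\<Sum>T\<in>M. u4 \<bullet> (v2 T + wdiv T (v1 T)))
     + h1 v4 + h2 v3 + h3 v2 + h4 v1)"

definition load :: "'a::euclidean_space set set \<Rightarrow> ('a, 'a) l2 \<Rightarrow> 'a test \<Rightarrow> real" where
  "load M f = (\<lambda>(v1, v2, v3, v4). \<Sum>T\<in>M. f \<bullet> v1 T)"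

definition trial_to_test :: "'a::euclidean_space set set \<Rightarrow> 'a trial \<Rightarrow> 'a test" where
  "trial_to_test M u =
     (THE w. w \<in> test_space M \<and> (\<forall>v\<in>test_space M. inner_test M w v = b_form M u v))"

definition is_solution ::
  "'a::euclidean_space set \<Rightarrow> 'a set set \<Rightarrow> ('a, 'a) l2 \<Rightarrow> 'a trial \<Rightarrow> bool" where
  "is_solution \<Omega> M f u \<longleftrightarrow>
     u \<in> trial_space \<Omega> M \<and> (\<forall>v\<in>test_space M. b_form M u v = load M f v)"

definition is_discrete_solution ::
  "'a::euclidean_space set set \<Rightarrow> ('a, 'a) l2 \<Rightarrow> 'a trial set \<Rightarrow> 'a trial \<Rightarrow> bool" where
  "is_discrete_solution M f U\<^sub>h u\<^sub>h \<longleftrightarrow>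
     u\<^sub>h \<in> U\<^sub>h \<and>
     (\<forall>\<delta>u\<in>U\<^sub>h. b_form M u\<^sub>h (trial_to_test M \<delta>u) = load M f (trial_to_test M \<delta>u))"

definition finite_dim_subspace :: "'a::real_vector set \<Rightarrow> 'a set \<Rightarrow> bool" where
  "finite_dim_subspace W V \<longleftrightarrow> subspace W \<and> W \<subseteq> V \<and> (\<exists>B. finite B \<and> W = span B)"

end

theory Submission
  imports Defs
begin

text \<open>
  The test norm is realised by gluing the element contributions of a test function and of its
  piecewise derivative into one \<open>L\<^sub>2\<close> pair on \<open>\<Omega>\<close>. The trial-to-test operator then becomes the
  orthogonal projection of an explicit residual (built from the \<open>L\<^sub>2\<close> components and arbitrary conforming
  representatives of the traces) onto a closed subspace. What the projection removes is itself conforming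
  and has zero trace, so it can be absorbed into the representatives: the energy norm is the norm of the
  residual of a conforming first-order system on \<open>\<Omega>\<close>, and the mesh disappears from the inf-sup
  estimate. That system is stable by the identity
  \<open>\<parallel>\<tau>\<^sub>1\<parallel>\<^sup>2 + \<parallel>\<nabla>w\<^sub>2\<parallel>\<^sup>2 = (F\<^sub>1, \<tau>\<^sub>1) + (\<nabla>w\<^sub>2, F\<^sub>3) - (w\<^sub>2, F\<^sub>2) + (w\<^sub>4, F\<^sub>4)\<close>, the Poincare
  inequality for \<open>w\<^sub>2\<close>, and the bound \<open>\<parallel>w\<parallel> \<le> C (\<parallel>\<nabla>w\<parallel> + \<parallel>w\<parallel>\<^bsub>-1\<^esub>)\<close> on bounded Lipschitz domains, which follows
  by translating off the boundary and mollifying in the interior. Quasi-optimality is the best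
  approximation property of Galerkin projections in the energy norm.
\<close>

text \<open>A gradient with its potential and a field with its divergence are both points of one
  Hilbert space: an \<open>L2\<close> field paired with an \<open>L2\<close> function. There Green's
  formula is orthogonality. Within \<open>L2 \<Omega> \<times> L2 \<Omega>\<close>, the graph over
  \<open>H10\<close> is the orthogonal complement of the graph over \<open>Hdiv\<close>, and the
  graph over \<open>Hdiv0\<close> that of the graph over \<open>H1\<close>. So orthogonality to the
  broken graphs, which contain the conforming ones, already supplies the regularity and the boundary
  condition of what the projection removes. The obstacle to stability is \<open>w4\<close>: it
  satisfies no boundary condition, so its gradient does not see additive constants. It is controlled
  because it equals the divergence of \<open>t3\<close> up to a residual, which bounds its negative
  norm. That norm only involves compactly supported test functions, so \<open>t3\<close> may have
  any normal component. The final constant is 36 times that of the conforming system: 12 for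
  continuity of the form, 3 for passing from single components to the product norm.\<close>

section \<open>Smooth bump functions\<close>

text \<open>For \<open>P = 1\<close> this is the classical flat function exp(-1/t). The polynomial
  in 1/t is carried along because it makes the family closed under differentiation.\<close>

definition exp_bump :: "real poly \<Rightarrow> real \<Rightarrow> real" where
  "exp_bump P t = (if 0 < t then poly P (1 / t) * exp (- (1 / t)) else 0)"

lemma poly_exp_minus_tendsto_0: "((\<lambda>x::real. poly P x * exp (- x)) \<longlongrightarrow> 0) at_top"
proof -
  have "((\<lambda>x::real. \<Sum>i\<le>degree P. coeff P i * (x ^ i / exp x)) \<longlongrightarrow> (\<Sum>i\<le>degree P. coeff P i * 0)) at_top"
    by (intro tendsto_intros tendsto_power_div_exp_0)
  then show ?thesis
    by (simp add: poly_altdef sum_distrib_right sum_divide_distrib exp_minus divide_inverse mult.assoc)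
qed

lemma exp_bump_tendsto_0: "(exp_bump P \<longlongrightarrow> 0) (at 0)"
proof (rule filterlim_split_at)
  have "\<forall>\<^sub>F t in at_left 0. 0 = exp_bump P t"
    by (auto simp: eventually_at_left_field exp_bump_def intro!: exI[of _ "-1"])
  then show "(exp_bump P \<longlongrightarrow> 0) (at_left 0)"
    by (rule tendsto_cong[THEN iffD1]) simp
  have "((\<lambda>t. poly P (inverse t) * exp (- inverse t)) \<longlongrightarrow> 0) (at_right 0)"
    by (rule filterlim_compose[OF poly_exp_minus_tendsto_0 filterlim_inverse_at_top_right])
  moreover have "\<forall>\<^sub>F t in at_right 0. poly P (inverse t) * exp (- inverse t) = exp_bump P t"
    by (auto simp: eventually_at_right_field exp_bump_def inverse_eq_divide intro!: exI[of _ "1"])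
  ultimately show "(exp_bump P \<longlongrightarrow> 0) (at_right 0)"
    by (rule tendsto_cong[THEN iffD1, rotated])
qed

text \<open>For positive t, differentiating P(1/t) exp(-1/t) gives (P - P')(1/t) exp(-1/t) / t^2,
  and the factor 1/t^2 is the polynomial \<open>[:0, 0, 1:]\<close> at 1/t. At 0 all these functions
  are flat.\<close>

lemma exp_bump_has_derivative:
  "(exp_bump P has_real_derivative exp_bump ((P - pderiv P) * [:0, 0, 1:]) t) (at t)"
proof -
  consider "t < 0" | "t = 0" | "t > 0" by linarith
  then show ?thesis
  proof cases
    case 1
    then have "\<forall>\<^sub>F s in nhds t. exp_bump P s = 0"
      using eventually_nhds_in_open[of "{..<0}" t] by (auto elim!: eventually_mono simp: exp_bump_def)
    then have "(exp_bump P has_real_derivative 0) (at t) \<longleftrightarrow> ((\<lambda>_. 0) has_real_derivative 0) (at t)"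
      by (intro DERIV_cong_ev) auto
    with 1 show ?thesis by (simp add: exp_bump_def)
  next
    case 2
    \<comment> \<open>\<open>pCons 0 P\<close> multiplies by 1/t, so this is the difference quotient
      of \<open>exp_bump P\<close> at 0.\<close>
    have "(exp_bump (pCons 0 P) \<longlongrightarrow> 0) (at 0)"
      by (rule exp_bump_tendsto_0)
    then have "((\<lambda>h. (exp_bump P (0 + h) - exp_bump P 0) / h) \<longlongrightarrow> 0) (at 0)"
      by (rule tendsto_cong[THEN iffD1, rotated])
        (auto simp: exp_bump_def eventually_at_filter)
    with 2 show ?thesis
      by (simp add: DERIV_def exp_bump_def[of _ 0])
  next
    case 3
    have *: "((\<lambda>t. poly P (1 / t) * exp (- (1 / t))) has_real_derivative
        exp_bump ((P - pderiv P) * [:0, 0, 1:]) t) (at t)"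
      using 3 by (auto intro!: derivative_eq_intros DERIV_chain2[OF poly_DERIV]
          simp: exp_bump_def field_simps power2_eq_square)
    have "\<forall>\<^sub>F s in nhds t. exp_bump P s = poly P (1 / s) * exp (- (1 / s))"
      using eventually_nhds_in_open[of "{0<..}" t] 3 by (auto elim!: eventually_mono simp: exp_bump_def)
    then show ?thesis
      using * by (subst DERIV_cong_ev) auto
  qed
qed

section \<open>Calculus of \<open>C_k\<close> functions\<close>

lemma C_k_Suc_imp: "C_k (Suc k) f \<Longrightarrow> C_k k f"
proof (induction k arbitrary: f)
  case 0
  then show ?case
    by (auto intro!: continuous_at_imp_continuous_on differentiable_imp_continuous_within)
next
  case (Suc k)
  then show ?case by (subst C_k.simps(2), subst (asm) C_k.simps(2)) blast
qed

lemma C_k_const: "C_k k (\<lambda>x. c)"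
  by (induction k arbitrary: c) (auto simp: frechet_derivative_const)

lemma C_k_add: "C_k k f \<Longrightarrow> C_k k g \<Longrightarrow> C_k k (\<lambda>x. f x + g x)"
proof (induction k arbitrary: f g)
  case (Suc k)
  have "frechet_derivative (\<lambda>x. f x + g x) (at x) =
      (\<lambda>h. frechet_derivative f (at x) h + frechet_derivative g (at x) h)" for x
    using Suc.prems by (auto intro!: frechet_derivative_at[symmetric] has_derivative_add
        frechet_derivative_works[THEN iffD1])
  with Suc show ?case by (auto intro!: differentiable_add)
qed (auto intro!: continuous_intros)

lemma C_k_scale: "C_k k f \<Longrightarrow> C_k k (\<lambda>x. c * f x)"
proof (induction k arbitrary: f)
  case (Suc k)
  have "frechet_derivative (\<lambda>x. c * f x) (at x) = (\<lambda>h. c * frechet_derivative f (at x) h)" for x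
    using Suc.prems by (auto intro!: frechet_derivative_at[symmetric] has_derivative_mult_right
        frechet_derivative_works[THEN iffD1])
  with Suc show ?case by (auto intro!: differentiable_mult)
qed (auto intro!: continuous_intros)

lemma C_k_diff: "C_k k f \<Longrightarrow> C_k k g \<Longrightarrow> C_k k (\<lambda>x. f x - g x)"
  using C_k_add[of k f "\<lambda>x. -1 * g x"] C_k_scale[of k g "-1"] by simp

lemma C_k_mult: "C_k k f \<Longrightarrow> C_k k g \<Longrightarrow> C_k k (\<lambda>x. f x * g x)"
proof (induction k arbitrary: f g)
  case (Suc k)
  have "C_k k f" "C_k k g"
    using Suc.prems by (blast intro: C_k_Suc_imp)+
  have "frechet_derivative (\<lambda>x. f x * g x) (at x) =
      (\<lambda>h. f x * frechet_derivative g (at x) h + frechet_derivative f (at x) h * g x)" for x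
    using Suc.prems by (auto intro!: frechet_derivative_at[symmetric] has_derivative_mult
        frechet_derivative_works[THEN iffD1])
  with Suc \<open>C_k k f\<close> \<open>C_k k g\<close> show ?case
    by (auto intro!: differentiable_mult C_k_add)
qed (auto intro!: continuous_intros)

lemma C_k_prod: "finite I \<Longrightarrow> (\<And>i. i \<in> I \<Longrightarrow> C_k k (f i)) \<Longrightarrow> C_k k (\<lambda>x. \<Prod>i\<in>I. f i x)"
  by (induction I rule: finite_induct) (auto intro!: C_k_const C_k_mult)

lemma C_k_power: "C_k k f \<Longrightarrow> C_k k (\<lambda>x. f x ^ n)"
  by (induction n) (auto intro!: C_k_const C_k_mult)

lemma frechet_derivative_shift:
  assumes "\<And>x. f differentiable (at x)"
  shows "frechet_derivative (\<lambda>x. f (x + a)) (at x) = frechet_derivative f (at (x + a))"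
proof -
  have "((\<lambda>x. x + a) has_derivative (\<lambda>h. h)) (at x)"
    by (auto intro!: derivative_eq_intros)
  from has_derivative_compose[OF this frechet_derivative_works[THEN iffD1, OF assms]]
  show ?thesis by (intro frechet_derivative_at[symmetric]) simp
qed

lemma C_k_shift: "C_k k f \<Longrightarrow> C_k k (\<lambda>x. f (x + a))"
proof (induction k arbitrary: f)
  case 0
  then show ?case by (auto intro!: continuous_on_compose2[of UNIV f] continuous_intros)
next
  case (Suc k)
  have "(\<lambda>x. f (x + a)) differentiable at x" for x
  proof -
    have "f \<circ> (\<lambda>x. x + a) differentiable at x"
      using Suc.prems by (intro differentiable_chain_at) (auto intro!: derivative_intros)
    then show ?thesis by (simp add: o_def)
  qed
  with Suc.prems Suc.IH[of "\<lambda>x. frechet_derivative f (at x) b" for b] show ?case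
    by (simp add: frechet_derivative_shift)
qed

text \<open>The induction must let \<open>P\<close> vary: a derivative replaces it by another
  polynomial and contributes a constant factor.\<close>

lemma C_k_exp_bump: "C_k k (\<lambda>x. exp_bump P (c * (x \<bullet> e) + d))"
proof (induction k arbitrary: P)
  case 0
  have "continuous_on UNIV (exp_bump P)"
    using exp_bump_has_derivative by (intro DERIV_continuous_on) auto
  then show ?case by (auto intro!: continuous_on_compose2[of UNIV "exp_bump P"] continuous_intros)
next
  case (Suc k)
  define Q where "Q = (P - pderiv P) * [:0, 0, 1:]"
  have *: "((\<lambda>x. exp_bump P (c * (x \<bullet> e) + d)) has_derivative
     (\<lambda>h. c * (h \<bullet> e) * exp_bump Q (c * (x \<bullet> e) + d))) (at x)" for x
  proof -
    have "((\<lambda>x. c * (x \<bullet> e) + d) has_derivative (\<lambda>h. c * (h \<bullet> e))) (at x)"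
      by (auto intro!: derivative_eq_intros)
    moreover have "(exp_bump P has_derivative (\<lambda>h. h * exp_bump Q (c * (x \<bullet> e) + d))) (at (c * (x \<bullet> e) + d))"
      using exp_bump_has_derivative[of P] by (simp add: Q_def has_field_derivative_def mult_commute_abs)
    ultimately show ?thesis by (rule has_derivative_compose)
  qed
  then have "frechet_derivative (\<lambda>x. exp_bump P (c * (x \<bullet> e) + d)) (at x) =
      (\<lambda>h. c * (h \<bullet> e) * exp_bump Q (c * (x \<bullet> e) + d))" for x
    by (intro frechet_derivative_at[symmetric])
  then show ?case
    using * Suc[of Q] by (auto simp: differentiable_def intro!: C_k_scale)
qed

text \<open>Positive exactly on the open box, with values in [0, 1]; both properties serve to
  approximate the indicator of the box by smooth functions.\<close>

definition box_bump :: "'a::euclidean_space \<Rightarrow> 'a \<Rightarrow> 'a \<Rightarrow> real" where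
  "box_bump a b x = (\<Prod>i\<in>Basis. exp_bump 1 (x \<bullet> i - a \<bullet> i) * exp_bump 1 (b \<bullet> i - x \<bullet> i))"

lemma C_k_box_bump: "C_k k (box_bump a b)"
proof -
  have "C_k k (\<lambda>x. exp_bump 1 (x \<bullet> i - a \<bullet> i) * exp_bump 1 (b \<bullet> i - x \<bullet> i))" for i
    using C_k_mult[OF C_k_exp_bump[of k 1 1 i "- (a \<bullet> i)"] C_k_exp_bump[of k 1 "-1" i "b \<bullet> i"]]
    by (simp add: algebra_simps)
  then show ?thesis
    unfolding box_bump_def[abs_def] by (intro C_k_prod) auto
qed

lemma exp_bump_1: "0 \<le> exp_bump 1 t" "exp_bump 1 t \<le> 1" "0 < exp_bump 1 t \<longleftrightarrow> 0 < t"
  by (auto simp: exp_bump_def)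

lemma box_bump_pos: "x \<in> box a b \<Longrightarrow> 0 < box_bump a b x"
  by (auto simp: box_bump_def box_def exp_bump_1 intro!: prod_pos mult_pos_pos)

lemma box_bump_eq_0: "x \<notin> box a b \<Longrightarrow> box_bump a b x = 0"
  by (fastforce simp: box_bump_def box_def exp_bump_def)

lemma box_bump_le_1: "0 \<le> box_bump a b x" "box_bump a b x \<le> 1"
  by (auto simp: box_bump_def exp_bump_1 intro!: prod_nonneg prod_le_1 mult_le_one)

lemma test_functionsI_box:
  assumes "\<And>k. C_k k \<phi>" "\<And>x. x \<notin> box a b \<Longrightarrow> \<phi> x = 0" "cbox a b \<subseteq> S"
  shows "\<phi> \<in> test_functions S"
proof -
  have "{x. \<phi> x \<noteq> 0} \<subseteq> cbox a b"
    using assms(2) box_subset_cbox by blast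
  then have *: "closure {x. \<phi> x \<noteq> 0} \<subseteq> cbox a b"
    by (intro closure_minimal) auto
  then have "compact (closure {x. \<phi> x \<noteq> 0})"
    using bounded_subset[OF bounded_cbox *] by (auto simp: compact_eq_bounded_closed)
  with * assms show ?thesis by (auto simp: test_functions_def)
qed

section \<open>Hilbert space projections and completeness of \<open>L\<^sub>2\<close>\<close>

text \<open>A minimising sequence for the distance is Cauchy by the parallelogram law. Its limit is
  optimal along every line in \<open>W\<close>, which is the orthogonality.\<close>

lemma projection_exists:
  fixes W :: "'a::{real_inner,complete_space} set"
  assumes W: "subspace W" "closed W"
  shows "\<exists>w\<in>W. \<forall>v\<in>W. (a - w) \<bullet> v = 0"
proof -
  define D where "D = (INF w\<in>W. (norm (a - w))\<^sup>2)"
  have ne: "W \<noteq> {}" using W subspace_0 by blast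
  have bdd: "bdd_below ((\<lambda>w. (norm (a - w))\<^sup>2) ` W)"
    by (auto intro!: bdd_belowI[of _ 0])
  have D: "D \<le> (norm (a - w))\<^sup>2" if "w \<in> W" for w
    unfolding D_def using bdd that by (rule cINF_lower)
  have "\<exists>w\<in>W. (norm (a - w))\<^sup>2 < D + 1 / real (Suc n)" for n
    using cINF_less_iff[OF ne bdd, of "D + 1 / real (Suc n)"] unfolding D_def by simp
  then obtain w where w: "w n \<in> W" "(norm (a - w n))\<^sup>2 < D + 1 / real (Suc n)" for n
    by metis
  have par: "(norm (w n - w m))\<^sup>2 \<le> 2 / real (Suc n) + 2 / real (Suc m)" for n m
  proof -
    \<comment> \<open>The midpoint competes in the infimum \<open>D\<close>; this is where convexity
      of \<open>W\<close> enters.\<close>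
    have "(1/2) *\<^sub>R (w n + w m) \<in> W"
      using W w by (intro subspace_scale subspace_add) auto
    from D[OF this] have "4 * D \<le> (norm (2 *\<^sub>R (a - (1/2) *\<^sub>R (w n + w m))))\<^sup>2"
      by (simp add: power_mult_distrib del: scaleR_scaleR)
    also have "2 *\<^sub>R (a - (1/2) *\<^sub>R (w n + w m)) = (a - w n) + (a - w m)"
      by (simp add: algebra_simps scaleR_2)
    finally have "4 * D \<le> (norm ((a - w n) + (a - w m)))\<^sup>2" .
    moreover have "(norm (w n - w m))\<^sup>2 + (norm ((a - w n) + (a - w m)))\<^sup>2
        = 2 * (norm (a - w n))\<^sup>2 + 2 * (norm (a - w m))\<^sup>2"
      by (simp add: power2_norm_eq_inner inner_simps inner_commute algebra_simps)
    ultimately show ?thesis using w(2)[of n] w(2)[of m] by simp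
  qed
  have "Cauchy w"
  proof (rule CauchyI)
    fix e :: real assume "0 < e"
    then obtain N where N: "4 / e\<^sup>2 < real N" using reals_Archimedean2 by blast
    have "norm (w m - w n) < e" if "m \<ge> N" "n \<ge> N" for m n
    proof -
      have "0 < 4 / e\<^sup>2" using \<open>0 < e\<close> by simp
      with N have "0 < real N" by linarith
      have "(norm (w m - w n))\<^sup>2 \<le> 2 / real (Suc m) + 2 / real (Suc n)" by (rule par)
      also have "\<dots> < 2 / real N + 2 / real N"
        using that \<open>0 < real N\<close> by (intro add_strict_mono divide_strict_left_mono) auto
      also have "\<dots> < e\<^sup>2" using N \<open>0 < e\<close> \<open>0 < real N\<close> by (simp add: field_simps)
      finally show ?thesis using \<open>0 < e\<close> by (meson less_eq_real_def power2_less_imp_less)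
    qed
    then show "\<exists>M. \<forall>m\<ge>M. \<forall>n\<ge>M. norm (w m - w n) < e" by blast
  qed
  then obtain p where p: "w \<longlonglongrightarrow> p"
    using Cauchy_convergent_iff convergent_def by blast
  have "p \<in> W" using W(2) w(1) p closed_sequentially by blast
  have "(\<lambda>n. (norm (a - w n))\<^sup>2) \<longlonglongrightarrow> (norm (a - p))\<^sup>2"
    using p by (intro tendsto_intros)
  moreover have "(\<lambda>n. D + 1 / real (Suc n)) \<longlonglongrightarrow> D + 0"
    by (intro tendsto_intros LIMSEQ_Suc[OF lim_1_over_n])
  ultimately have pD: "(norm (a - p))\<^sup>2 \<le> D"
    using w(2) by (intro LIMSEQ_le[of "\<lambda>n. (norm (a - w n))\<^sup>2" _ "\<lambda>n. D + 1 / real (Suc n)"])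
      (auto intro: less_imp_le)
  have "(a - p) \<bullet> v = 0" if "v \<in> W" for v
  proof (cases "v = 0")
    case False
    \<comment> \<open>The minimiser of the quadratic in \<open>t\<close> along the direction
      \<open>v\<close>; any gain over \<open>p\<close> would contradict \<open>D\<close>.\<close>
    define t where "t = ((a - p) \<bullet> v) / (v \<bullet> v)"
    have "p + t *\<^sub>R v \<in> W" using W \<open>p \<in> W\<close> that by (intro subspace_add subspace_scale)
    from pD D[OF this] have "(norm (a - p))\<^sup>2 \<le> (norm (a - (p + t *\<^sub>R v)))\<^sup>2" by (rule order_trans)
    also have "a - (p + t *\<^sub>R v) = (a - p) - t *\<^sub>R v" by simp
    also have "(norm ((a - p) - t *\<^sub>R v))\<^sup>2 = (norm (a - p))\<^sup>2 - 2 * t * ((a - p) \<bullet> v) + t\<^sup>2 * (v \<bullet> v)"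
      by (simp only: power2_norm_eq_inner) (simp add: inner_diff inner_commute power2_eq_square algebra_simps)
    finally have "((a - p) \<bullet> v)\<^sup>2 / (v \<bullet> v) \<le> 0"
      using False by (simp add: t_def power2_eq_square)
    moreover have "0 < v \<bullet> v" using False by simp
    ultimately have "((a - p) \<bullet> v)\<^sup>2 \<le> 0" by (simp only: divide_le_0_iff) linarith
    then show ?thesis by simp
  qed simp
  with \<open>p \<in> W\<close> show ?thesis by blast
qed

lemma closed_orthogonal_comp: "closed {x::'a::real_inner. \<forall>y\<in>N. x \<bullet> y = 0}"
proof -
  have "closed {x. x \<bullet> y = 0}" for y :: 'a
    by (intro closed_Collect_eq continuous_intros)
  then have "closed (\<Inter>y\<in>N. {x. x \<bullet> y = 0})" by blast
  also have "(\<Inter>y\<in>N. {x. x \<bullet> y = 0}) = {x. \<forall>y\<in>N. x \<bullet> y = 0}" by auto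
  finally show ?thesis .
qed

lemma orthogonal_closure:
  fixes x :: "'a::real_inner"
  assumes "\<And>y. y \<in> N \<Longrightarrow> x \<bullet> y = 0" "y \<in> closure N"
  shows "x \<bullet> y = 0"
proof -
  have "closed {y. x \<bullet> y = 0}" by (intro closed_Collect_eq continuous_intros)
  then have "closure N \<subseteq> {y. x \<bullet> y = 0}" using assms(1) by (intro closure_minimal) auto
  with assms(2) show ?thesis by auto
qed

lemma subspace_closure:
  fixes N :: "'a::real_normed_vector set"
  assumes N: "subspace N"
  shows "subspace (closure N)"
proof (rule subspaceI)
  show "0 \<in> closure N" using N subspace_0 closure_subset by blast
  fix x y :: 'a and c :: real
  assume x: "x \<in> closure N"
  then obtain f where f: "\<And>n. f n \<in> N" "f \<longlonglongrightarrow> x" unfolding closure_sequential by blast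
  show "c *\<^sub>R x \<in> closure N"
    unfolding closure_sequential
    using f N by (intro exI[of _ "\<lambda>n. c *\<^sub>R f n"]) (auto intro!: tendsto_intros subspace_scale)
  assume "y \<in> closure N"
  then obtain g where g: "\<And>n. g n \<in> N" "g \<longlonglongrightarrow> y" unfolding closure_sequential by blast
  show "x + y \<in> closure N"
    unfolding closure_sequential
    using f g N by (intro exI[of _ "\<lambda>n. f n + g n"]) (auto intro!: tendsto_intros subspace_add)
qed

text \<open>The residual of the projection onto the closure is orthogonal to \<open>N\<close>, hence
  by assumption to \<open>x\<close>, hence to itself. Density of test functions is obtained this
  way, with no explicit approximation of a given function.\<close>

lemma in_closure_if_double_orthogonal:
  fixes N :: "'a::{real_inner,complete_space} set"
  assumes N: "subspace N" and x: "\<And>y. (\<forall>z\<in>N. y \<bullet> z = 0) \<Longrightarrow> x \<bullet> y = 0"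
  shows "x \<in> closure N"
proof -
  obtain w where w: "w \<in> closure N" "\<forall>v\<in>closure N. (x - w) \<bullet> v = 0"
    using projection_exists[OF subspace_closure[OF N] closed_closure, of x] by blast
  have "x \<bullet> (x - w) = 0" using w closure_subset by (intro x) blast
  moreover have "(x - w) \<bullet> w = 0" using w by blast
  ultimately have "(x - w) \<bullet> (x - w) = 0" by (simp add: inner_simps inner_commute)
  with w show ?thesis by simp
qed

text \<open>Finite dimension replaces completeness: an orthogonal generating set gives the
  projection as a finite Fourier sum.\<close>

lemma projection_exists_span:
  fixes B :: "'a::real_inner set"
  assumes "finite B"
  shows "\<exists>w\<in>span B. \<forall>v\<in>span B. (a - w) \<bullet> v = 0"
proof -
  obtain C where C: "finite C" "span C = span B" "pairwise orthogonal C"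
    using basis_orthogonal[OF assms] by blast
  define w where "w = (\<Sum>c\<in>C. (c \<bullet> a / (c \<bullet> c)) *\<^sub>R c)"
  have "w \<in> span C" unfolding w_def by (intro span_sum span_scale span_base)
  have "(a - w) \<bullet> c = 0" if c: "c \<in> C" for c
  proof -
    have "w \<bullet> c = (\<Sum>d\<in>C. (if d = c then c \<bullet> a else 0))"
      unfolding w_def inner_sum_left using C(3) c
      by (intro sum.cong) (auto simp: pairwise_def orthogonal_def)
    then show ?thesis using c C(1) by (simp add: inner_diff_left) (simp add: inner_commute)
  qed
  note orth = this
  have "(a - w) \<bullet> v = 0" if "v \<in> span C" for v
    using that by (induction v rule: span_induct_alt) (auto simp: inner_add_right orth)
  with \<open>w \<in> span C\<close> C(2) show ?thesis by auto
qed

section \<open>Representatives of \<open>l2\<close> classes and completeness\<close>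

lemma l2_cases:
  fixes u :: "('a::euclidean_space, 'b::euclidean_space) l2"
  obtains f where "square_integrable f" "u = abs_l2 f"
  by (induction u rule: l2.abs_induct) blast

lemma abs_l2_eq_iff:
  "square_integrable f \<Longrightarrow> square_integrable g \<Longrightarrow> abs_l2 f = abs_l2 g \<longleftrightarrow> (AE x in lborel. f x = g x)"
  using Quotient3_rel[OF Quotient3_l2, of f g] by simp

lemma abs_l2_inner:
  "square_integrable f \<Longrightarrow> square_integrable g \<Longrightarrow> abs_l2 f \<bullet> abs_l2 g = (LINT x|lborel. f x \<bullet> g x)"
  by (subst inner_l2.abs_eq) auto

lemma abs_l2_add:
  "square_integrable f \<Longrightarrow> square_integrable g \<Longrightarrow> abs_l2 f + abs_l2 g = abs_l2 (\<lambda>x. f x + g x)"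
  by (subst plus_l2.abs_eq) auto

lemma abs_l2_diff:
  "square_integrable f \<Longrightarrow> square_integrable g \<Longrightarrow> abs_l2 f - abs_l2 g = abs_l2 (\<lambda>x. f x - g x)"
  by (subst minus_l2.abs_eq) auto

lemma abs_l2_scaleR: "square_integrable f \<Longrightarrow> c *\<^sub>R abs_l2 f = abs_l2 (\<lambda>x. c *\<^sub>R f x)"
  by (subst scaleR_l2.abs_eq) auto

lemma abs_l2_zero: "0 = abs_l2 (\<lambda>x. 0)"
  by (fact zero_l2.abs_eq)

lemma abs_l2_norm: "square_integrable f \<Longrightarrow> (norm (abs_l2 f))\<^sup>2 = (LINT x|lborel. (norm (f x))\<^sup>2)"
  by (simp add: power2_norm_eq_inner abs_l2_inner)

lemma abs_l2_vanishes_off: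
  "square_integrable f \<Longrightarrow> vanishes_off S (abs_l2 f) \<longleftrightarrow> (AE x in lborel. x \<notin> S \<longrightarrow> f x = 0)"
  by (subst vanishes_off.abs_eq) auto

lemma abs_l2_restrict:
  "square_integrable f \<Longrightarrow> S \<in> sets borel \<Longrightarrow> restrict_l2 S (abs_l2 f) = abs_l2 (\<lambda>x. indicat_real S x *\<^sub>R f x)"
  by (subst restrict_l2.abs_eq) auto

lemma square_integrable_norm_iff:
  "f \<in> borel_measurable borel \<Longrightarrow>
    square_integrable f \<longleftrightarrow> (\<integral>\<^sup>+x. ennreal ((norm (f x))\<^sup>2) \<partial>lborel) < \<infinity>"
  by (simp add: square_integrable_def integrable_iff_bounded)

lemma norm_abs_l2_nn_integral:
  assumes "square_integrable f"
  shows "(\<integral>\<^sup>+x. ennreal ((norm (f x))\<^sup>2) \<partial>lborel) = ennreal ((norm (abs_l2 f))\<^sup>2)"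
  using assms by (subst nn_integral_eq_integral) (auto simp: abs_l2_norm square_integrable_def)

text \<open>An \<open>L\<^sub>2\<close> Cauchy sequence need not be Cauchy in \<open>L\<^sub>1\<close> on the whole space; it becomes so after
  multiplication by a positive square-integrable weight.\<close>

lemma l2_Cauchy_imp_convergent:
  fixes X :: "nat \<Rightarrow> ('a::euclidean_space, 'b::euclidean_space) l2"
  assumes X: "Cauchy X"
  shows "convergent X"
proof -
  have "\<exists>f. square_integrable f \<and> X n = abs_l2 f" for n
    by (metis l2_cases)
  then obtain f where f: "square_integrable (f n)" "X n = abs_l2 (f n)" for n
    by metis
  have fm[measurable]: "f n \<in> borel_measurable borel" for n
    using f(1) square_integrable_measurable by blast
  obtain h :: "'a \<Rightarrow> ennreal" where [measurable]: "h \<in> borel_measurable lborel"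
    and h_int: "integral\<^sup>N lborel h \<noteq> \<infinity>" and h: "\<And>x. 0 < h x \<and> h x < \<infinity>"
    using sigma_finite_measure.Ex_finite_integrable_function[OF sigma_finite_lborel] by auto
  define w where "w x = sqrt (enn2real (h x))" for x
  have w_pos: "0 < w x" for x using h[of x] by (simp add: w_def enn2real_positive_iff)
  have [measurable]: "w \<in> borel_measurable borel" unfolding w_def[abs_def] by measurable
  have "(\<integral>\<^sup>+x. ennreal ((norm (w x))\<^sup>2) \<partial>lborel) = integral\<^sup>N lborel h"
    using h by (intro nn_integral_cong) (simp add: w_def)
  then have w: "square_integrable w"
    using h_int by (simp add: square_integrable_norm_iff less_top[symmetric])
  have nd: "square_integrable (\<lambda>x. norm (f i x - f j x))" for i j
    using square_integrable_diff[OF f(1) f(1)] by (auto simp: square_integrable_def)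
  have wf: "integrable lborel (\<lambda>x. w x *\<^sub>R f n x)" for n
  proof -
    have "square_integrable (\<lambda>x. norm (f n x))" using f(1)[of n] by (auto simp: square_integrable_def)
    from square_integrable_inner[OF w this] show ?thesis
      by (rule Bochner_Integration.integrable_bound) (auto simp: abs_mult)
  qed
  \<comment> \<open>Cauchy-Schwarz with the weight turns the distance in \<open>l2\<close> into a
    bound on the weighted integral of the difference.\<close>
  have L1: "(LINT x|lborel. norm (w x *\<^sub>R f i x - w x *\<^sub>R f j x)) \<le> norm (abs_l2 w) * norm (X i - X j)" for i j
  proof -
    have "norm (w x *\<^sub>R f i x - w x *\<^sub>R f j x) = w x \<bullet> norm (f i x - f j x)" for x
      using w_pos[of x] by (simp flip: scaleR_diff_right)
    then have "(LINT x|lborel. norm (w x *\<^sub>R f i x - w x *\<^sub>R f j x)) = abs_l2 w \<bullet> abs_l2 (\<lambda>x. norm (f i x - f j x))"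
      using w nd by (simp add: abs_l2_inner)
    also have "\<dots> \<le> norm (abs_l2 w) * norm (abs_l2 (\<lambda>x. norm (f i x - f j x)))"
      by (rule norm_cauchy_schwarz)
    also have "norm (abs_l2 (\<lambda>x. norm (f i x - f j x))) = norm (X i - X j)"
      unfolding f(2) abs_l2_diff[OF f(1) f(1)]
      by (rule power2_eq_imp_eq)
        (simp_all add: abs_l2_norm[OF nd] abs_l2_norm[OF square_integrable_diff[OF f(1) f(1)]])
    finally show ?thesis .
  qed
  obtain r where r: "strict_mono r" and AE: "AE x in lborel. Cauchy (\<lambda>i. w x *\<^sub>R f (r i) x)"
  proof (rule cauchy_L1_AE_cauchy_subseq[OF wf])
    fix e :: real assume e: "0 < e"
    define c where "c = norm (abs_l2 w) + 1"
    have c: "c > 0" by (simp add: c_def add_nonneg_pos)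
    obtain N where N: "\<And>i j. i \<ge> N \<Longrightarrow> j \<ge> N \<Longrightarrow> norm (X i - X j) < e / c"
      using CauchyD[OF X, of "e / c"] c e by auto
    have "(LINT x|lborel. norm (w x *\<^sub>R f i x - w x *\<^sub>R f j x)) < e" if "i \<ge> N" "j \<ge> N" for i j
    proof -
      have "norm (abs_l2 w) * norm (X i - X j) \<le> c * norm (X i - X j)"
        by (intro mult_right_mono) (auto simp: c_def)
      also have "\<dots> < c * (e / c)" using N[OF that] c by (intro mult_strict_left_mono)
      finally show ?thesis using L1[of i j] c by simp
    qed
    then show "\<exists>N. \<forall>i\<ge>N. \<forall>j\<ge>N. (LINT x|lborel. norm (w x *\<^sub>R f i x - w x *\<^sub>R f j x)) < e" by blast
  qed
  define F where "F x = lim (\<lambda>m. f (r m) x)" for x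
  have [measurable]: "F \<in> borel_measurable borel"
    unfolding F_def[abs_def] by (intro borel_measurable_lim_metric) simp
  have AE_lim: "AE x in lborel. (\<lambda>m. f (r m) x) \<longlonglongrightarrow> F x"
    using AE
  proof eventually_elim
    case (elim x)
    then have "convergent (\<lambda>i. w x *\<^sub>R f (r i) x)" by (simp add: Cauchy_convergent_iff)
    then obtain L where "(\<lambda>i. w x *\<^sub>R f (r i) x) \<longlonglongrightarrow> L"
      by (auto simp: convergent_def)
    from tendsto_scaleR[OF tendsto_const[of "inverse (w x)"] this]
    have "convergent (\<lambda>i. inverse (w x) *\<^sub>R (w x *\<^sub>R f (r i) x))"
      unfolding convergent_def by (rule exI)
    then show ?case using w_pos[of x] by (simp add: F_def convergent_LIMSEQ_iff)
  qed
  \<comment> \<open>Fatou's lemma along the almost everywhere convergent subsequence transfers the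
    Cauchy bound to \<open>F\<close>, before \<open>F\<close> is known to be
    square-integrable.\<close>
  have key: "(\<integral>\<^sup>+x. ennreal ((norm (F x - f n x))\<^sup>2) \<partial>lborel) \<le> ennreal (e\<^sup>2)"
    if N: "\<And>i j. i \<ge> N \<Longrightarrow> j \<ge> N \<Longrightarrow> norm (X i - X j) < e" and n: "n \<ge> N" for N n e
  proof -
    have "(\<integral>\<^sup>+x. ennreal ((norm (F x - f n x))\<^sup>2) \<partial>lborel)
        = (\<integral>\<^sup>+x. liminf (\<lambda>m. ennreal ((norm (f (r m) x - f n x))\<^sup>2)) \<partial>lborel)"
      using AE_lim
      by (intro nn_integral_cong_AE)
        (auto elim!: eventually_mono intro!: lim_imp_Liminf[symmetric] tendsto_intros)
    also have "\<dots> \<le> liminf (\<lambda>m. \<integral>\<^sup>+x. ennreal ((norm (f (r m) x - f n x))\<^sup>2) \<partial>lborel)"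
      by (intro nn_integral_liminf) simp
    also have "\<dots> = liminf (\<lambda>m. ennreal ((norm (X (r m) - X n))\<^sup>2))"
      unfolding f(2) abs_l2_diff[OF f(1) f(1)]
        norm_abs_l2_nn_integral[OF square_integrable_diff[OF f(1) f(1)]] ..
    also have "\<dots> \<le> ennreal (e\<^sup>2)"
    proof (rule Liminf_le)
      show "\<forall>\<^sub>F m in sequentially. ennreal ((norm (X (r m) - X n))\<^sup>2) \<le> ennreal (e\<^sup>2)"
        using eventually_ge_at_top[of N]
      proof eventually_elim
        case (elim m)
        then have "r m \<ge> N" using seq_suble[OF r, of m] by simp
        then show ?case using N[OF _ n, of "r m"] by (intro ennreal_leI power_mono) auto
      qed
    qed simp
    finally show ?thesis .
  qed
  obtain N1 where "\<And>i j. i \<ge> N1 \<Longrightarrow> j \<ge> N1 \<Longrightarrow> norm (X i - X j) < 1"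
    using CauchyD[OF X, of 1] by auto
  from key[OF this, of N1 N1] have "square_integrable (\<lambda>x. F x - f N1 x)"
    by (subst square_integrable_norm_iff) (auto intro: le_less_trans)
  from square_integrable_add[OF this f(1)[of N1]] have F: "square_integrable F" by simp
  have "X \<longlonglongrightarrow> abs_l2 F"
  proof (rule LIMSEQ_I)
    fix e :: real assume e: "0 < e"
    then obtain N where N: "\<And>i j. i \<ge> N \<Longrightarrow> j \<ge> N \<Longrightarrow> norm (X i - X j) < e / 2"
      using CauchyD[OF X, of "e / 2"] by auto
    have "norm (X n - abs_l2 F) < e" if "n \<ge> N" for n
    proof -
      have "ennreal ((norm (abs_l2 F - X n))\<^sup>2) \<le> ennreal ((e/2)\<^sup>2)"
        using key[OF N that]
        unfolding f(2) abs_l2_diff[OF F f(1)]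
          norm_abs_l2_nn_integral[OF square_integrable_diff[OF F f(1)]] .
      then have "(norm (abs_l2 F - X n))\<^sup>2 \<le> (e/2)\<^sup>2"
        by (subst (asm) ennreal_le_iff) auto
      then have "norm (abs_l2 F - X n) \<le> e / 2"
        by (rule power2_le_imp_le) (use e in simp)
      then show ?thesis unfolding norm_minus_commute[of "X n"] using e by linarith
    qed
    then show "\<exists>no. \<forall>n\<ge>no. norm (X n - abs_l2 F) < e" by blast
  qed
  then show ?thesis by (auto simp: convergent_def)
qed

instance l2 :: (euclidean_space, euclidean_space) complete_space
  by standard (rule l2_Cauchy_imp_convergent)

section \<open>Test functions and the fundamental lemma\<close>

text \<open>Boxes are an intersection-stable generator of the Borel sets. The sets with vanishing
  integral are closed under disjoint countable unions and, thanks to \<open>whole\<close>, under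
  complements, so they are all Borel sets.\<close>

lemma integral_eq_0_if_boxes:
  fixes f :: "'a::euclidean_space \<Rightarrow> real"
  assumes f: "integrable lborel f" and whole: "(LINT x|lborel. f x) = 0"
    and box: "\<And>c d. (LINT x:box c d|lborel. f x) = 0"
  shows "AE x in lborel. f x = 0"
proof -
  have si: "set_integrable lborel A f" if "A \<in> sets borel" for A
    unfolding set_integrable_def using f that by (intro integrable_mult_indicator) auto
  have "(LINT x:A|lborel. f x) = 0" if A: "A \<in> sets borel" for A
  proof -
    have "A \<in> sigma_sets UNIV (range (\<lambda>(a, b). box a b))"
      using A by (simp add: borel_eq_box[where 'a='a])
    then show ?thesis
    proof (induction rule: sigma_sets_induct_disjoint[rotated 2, consumes 1, case_names basic empty compl union Int sub])
      case (compl A)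
      then have A: "A \<in> sets borel" by (simp add: borel_eq_box[where 'a='a])
      have "(LINT x:A \<union> (UNIV - A)|lborel. f x) = (LINT x:A|lborel. f x) + (LINT x:UNIV - A|lborel. f x)"
        using A by (intro set_integral_Un si) auto
      then show ?case using compl whole by (simp add: set_lebesgue_integral_def)
    next
      case (union A)
      then have A: "A i \<in> sets borel" for i by (auto simp: borel_eq_box[where 'a='a])
      have "(LINT x:(\<Union>i. A i)|lborel. f x) = (\<Sum>i. (LINT x:(A i)|lborel. f x))"
        using union A by (intro lebesgue_integral_countable_add si) (auto simp: disjoint_family_on_def)
      then show ?case using union by simp
    qed (use box in \<open>auto simp: Int_stable_def box_Int_box set_lebesgue_integral_def\<close>)
  qed
  then show ?thesis
    using sigma_finite_measure.density_zero[OF sigma_finite_lborel f] by simp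
qed

lemma square_integrable_indicator_bounded:
  assumes "S \<in> sets borel" "bounded S"
  shows "square_integrable (indicat_real S)"
proof -
  have "(\<integral>\<^sup>+x. ennreal ((norm (indicat_real S x))\<^sup>2) \<partial>lborel) = (\<integral>\<^sup>+x. indicator S x \<partial>lborel)"
    by (intro nn_integral_cong) (auto simp: indicator_def)
  also have "\<dots> < \<infinity>"
    using assms emeasure_bounded_finite by simp
  finally show ?thesis using assms by (simp add: square_integrable_norm_iff)
qed

lemma test_functions_mono: "S \<subseteq> T \<Longrightarrow> test_functions S \<subseteq> test_functions T"
  by (auto simp: test_functions_def)

text \<open>The fundamental lemma of the calculus of variations. Test functions approximate
  indicators of boxes in \<open>S\<close> boundedly, boxes determine an integrable function, and
  countably many closed boxes cover \<open>S\<close>.\<close>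

lemma test_function_orthogonal_imp_AE_0:
  fixes u :: "'a::euclidean_space \<Rightarrow> real"
  assumes u: "square_integrable u" and S: "open S"
    and orth: "\<And>\<phi>. \<phi> \<in> test_functions S \<Longrightarrow> (LINT x|lborel. u x * \<phi> x) = 0"
  shows "AE x in lborel. x \<in> S \<longrightarrow> u x = 0"
proof -
  have um[measurable]: "u \<in> borel_measurable borel" using u by (rule square_integrable_measurable)
  have ind_int: "integrable lborel (\<lambda>x. indicat_real (box a b) x * u x)" for a b
    using square_integrable_inner[OF square_integrable_indicator_bounded[of "box a b"] u] by simp
  have box0: "(LINT x|lborel. indicat_real (box a b) x * u x) = 0" if ab: "cbox a b \<subseteq> S" for a b
  proof -
    \<comment> \<open>A polynomial in the bump without constant term, hence smooth and zero off the
      box; on the box it tends to 1, since the bump is positive there.\<close>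
    define \<phi> where "\<phi> n x = 1 - (1 - box_bump a b x) ^ n" for n :: nat and x
    have \<phi>_test: "\<phi> n \<in> test_functions S" for n
      unfolding \<phi>_def[abs_def]
      by (rule test_functionsI_box[OF _ _ ab]) (auto intro!: C_k_diff C_k_const C_k_power C_k_box_bump simp: box_bump_eq_0)
    have [measurable]: "\<phi> n \<in> borel_measurable borel" for n
      using \<phi>_test test_function_measurable by blast
    have \<phi>_bound: "0 \<le> \<phi> n x" "\<phi> n x \<le> indicat_real (box a b) x" for n x
      using box_bump_le_1[of a b x] box_bump_eq_0[of x a b]
      by (auto simp: \<phi>_def indicator_def power_le_one)
    have "(\<lambda>n. LINT x|lborel. u x * \<phi> n x) \<longlonglongrightarrow> (LINT x|lborel. indicat_real (box a b) x * u x)"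
    proof (rule integral_dominated_convergence)
      show "integrable lborel (\<lambda>x. norm (indicat_real (box a b) x * u x))"
        using ind_int by (rule integrable_norm)
      show "AE x in lborel. (\<lambda>n. u x * \<phi> n x) \<longlonglongrightarrow> indicat_real (box a b) x * u x"
      proof (rule AE_I2)
        fix x
        have "(\<lambda>n. \<phi> n x) \<longlonglongrightarrow> indicat_real (box a b) x"
        proof (cases "x \<in> box a b")
          case True
          have "(\<lambda>n. 1 - (1 - box_bump a b x) ^ n) \<longlonglongrightarrow> 1 - 0"
            using box_bump_pos[OF True] box_bump_le_1[of a b x]
            by (intro tendsto_intros LIMSEQ_realpow_zero) auto
          with True show ?thesis by (simp add: \<phi>_def)
        next
          case False
          then show ?thesis by (simp add: \<phi>_def box_bump_eq_0)
        qed
        from tendsto_mult[OF tendsto_const[of "u x"] this]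
        show "(\<lambda>n. u x * \<phi> n x) \<longlonglongrightarrow> indicat_real (box a b) x * u x"
          by (simp add: mult.commute)
      qed
      show "AE x in lborel. norm (u x * \<phi> n x) \<le> norm (indicat_real (box a b) x * u x)" for n
        using \<phi>_bound[of n] by (auto simp: abs_mult mult.commute intro!: mult_left_mono AE_I2)
    qed measurable
    then show ?thesis
      using orth[OF \<phi>_test] by (simp add: LIMSEQ_const_iff)
  qed
  have AE_box: "AE x in lborel. x \<in> cbox a b \<longrightarrow> u x = 0" if ab: "cbox a b \<subseteq> S" for a b
  proof -
    have "AE x in lborel. indicat_real (box a b) x * u x = 0"
    proof (rule integral_eq_0_if_boxes[OF ind_int box0[OF ab]])
      fix c d
      \<comment> \<open>Cutting with another box leaves a box whose closure is in \<open>S\<close>,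
        or nothing, so \<open>box0\<close> covers every case that
        \<open>integral_eq_0_if_boxes\<close> asks for.\<close>
      obtain p q where pq: "box c d \<inter> box a b = box p q" by (simp add: box_Int_box)
      have "(LINT x:box c d|lborel. indicat_real (box a b) x * u x) = (LINT x|lborel. indicat_real (box p q) x * u x)"
        unfolding set_lebesgue_integral_def pq[symmetric]
        by (intro Bochner_Integration.integral_cong) (auto simp: indicator_def)
      also have "\<dots> = 0"
      proof (cases "box p q = {}")
        case False
        have "box p q \<subseteq> cbox a b" using pq box_subset_cbox[of a b] by blast
        with False have "cbox p q \<subseteq> cbox a b" by (metis closure_box closure_minimal closed_cbox)
        with ab show ?thesis by (intro box0) auto
      qed simp
      finally show "(LINT x:box c d|lborel. indicat_real (box a b) x * u x) = 0" .
    qed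
    moreover have "AE x in lborel. x \<notin> cbox a b - box a b"
      by (rule AE_not_in[OF null_sets_cbox_Diff_box])
    ultimately show ?thesis by eventually_elim (auto simp: indicator_def)
  qed
  obtain D where D: "countable D" "D \<subseteq> Pow S" "\<And>X. X \<in> D \<Longrightarrow> \<exists>a b. X = cbox a b" "\<Union>D = S"
    using open_countable_Union_open_cbox[OF S] by blast
  have "AE x in lborel. \<forall>X\<in>D. x \<in> X \<longrightarrow> u x = 0"
    unfolding AE_ball_countable[OF D(1)]
  proof
    fix X assume X: "X \<in> D"
    then obtain a b where "X = cbox a b" using D(3) by blast
    then show "AE x in lborel. x \<in> X \<longrightarrow> u x = 0" using AE_box X D(2) by blast
  qed
  then show ?thesis by eventually_elim (use D(4) in blast)
qed

section \<open>Supports, gradients and square-integrability of test functions\<close>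

lemma test_function_eq_0: "\<phi> \<in> test_functions S \<Longrightarrow> x \<notin> S \<Longrightarrow> \<phi> x = 0"
  by (auto simp: test_functions_def closure_def)

lemma test_functions_subset_cball:
  assumes "\<phi> \<in> test_functions S"
  obtains R where "\<And>x. norm x > R \<Longrightarrow> \<phi> x = 0"
proof -
  have "bounded {x. \<phi> x \<noteq> 0}"
    using assms compact_imp_bounded bounded_subset closure_subset by (fastforce simp: test_functions_def)
  then obtain R where "\<And>x. \<phi> x \<noteq> 0 \<Longrightarrow> norm x \<le> R" by (auto simp: bounded_iff)
  then show ?thesis by (intro that[of R]) force
qed

lemma test_function_C_k: "\<phi> \<in> test_functions S \<Longrightarrow> C_k k \<phi>"
  by (simp add: test_functions_def)

lemma test_function_differentiable: "\<phi> \<in> test_functions S \<Longrightarrow> \<phi> differentiable (at x)"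
  using test_function_C_k[of \<phi> S "Suc 0"] by simp

lemma frechet_derivative_eq_gradient:
  assumes "\<phi> differentiable (at x)"
  shows "frechet_derivative \<phi> (at x) h = gradient \<phi> x \<bullet> h"
proof -
  interpret linear "frechet_derivative \<phi> (at x)"
    using assms by (rule linear_frechet_derivative)
  have "frechet_derivative \<phi> (at x) h = frechet_derivative \<phi> (at x) (\<Sum>b\<in>Basis. (h \<bullet> b) *\<^sub>R b)"
    by (simp add: euclidean_representation)
  also have "\<dots> = gradient \<phi> x \<bullet> h"
    unfolding sum scaleR gradient_def inner_sum_left by (simp add: inner_commute mult.commute)
  finally show ?thesis .
qed

lemma gradient_eq_0_off_support:
  assumes "\<phi> \<in> test_functions S" "x \<notin> closure {x. \<phi> x \<noteq> 0}"
  shows "gradient \<phi> x = 0"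
proof -
  have "\<forall>\<^sub>F y in nhds x. \<phi> y = 0"
  proof (rule eventually_mono)
    show "\<forall>\<^sub>F y in nhds x. y \<in> - closure {x. \<phi> x \<noteq> 0}"
      using assms(2) by (intro eventually_nhds_in_open) auto
  qed (auto simp: closure_def)
  moreover have "\<phi> x = 0" using assms(2) by (auto simp: closure_def)
  ultimately have "\<forall>\<^sub>F y in at x. 0 = \<phi> y" "\<phi> x = 0"
    by (auto simp: eventually_at_filter elim!: eventually_mono)
  then have "(\<phi> has_derivative (\<lambda>h. 0)) (at x)"
    by (intro has_derivative_transform_eventually[OF has_derivative_const, of 0 \<phi>]) simp_all
  then have "frechet_derivative \<phi> (at x) = (\<lambda>h. 0)" by (rule frechet_derivative_at[symmetric])
  then show ?thesis by (simp add: gradient_def)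
qed

lemma continuous_gradient:
  assumes "\<phi> \<in> test_functions S"
  shows "continuous_on UNIV (gradient \<phi>)"
  using test_function_C_k[OF assms, of "Suc 0"]
  by (auto simp: gradient_def[abs_def] intro!: continuous_intros)

lemma square_integrable_if_compact_support:
  fixes f :: "'a::euclidean_space \<Rightarrow> 'b::euclidean_space"
  assumes f: "continuous_on UNIV f" and K: "compact K" and z: "\<And>x. x \<notin> K \<Longrightarrow> f x = 0"
  shows "square_integrable f"
proof -
  have "integrable lborel (\<lambda>x. indicat_real K x *\<^sub>R (norm (f x))\<^sup>2)"
    using f by (intro borel_integrable_compact[OF K] continuous_intros) (auto intro: continuous_on_subset)
  also have "(\<lambda>x. indicat_real K x *\<^sub>R (norm (f x))\<^sup>2) = (\<lambda>x. (norm (f x))\<^sup>2)"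
    using z by (auto simp: indicator_def fun_eq_iff)
  finally show ?thesis
    using f by (simp add: square_integrable_def borel_measurable_continuous_onI)
qed

lemma square_integrable_test:
  assumes "\<phi> \<in> test_functions S"
  shows "square_integrable \<phi>" and "square_integrable (gradient \<phi>)"
proof -
  have K: "compact (closure {x. \<phi> x \<noteq> 0})" using assms by (simp add: test_functions_def)
  show "square_integrable \<phi>"
    using test_function_C_k[OF assms, of 0]
    by (intro square_integrable_if_compact_support[OF _ K]) (auto simp: closure_def)
  show "square_integrable (gradient \<phi>)"
    using gradient_eq_0_off_support[OF assms]
    by (intro square_integrable_if_compact_support[OF continuous_gradient[OF assms] K])
qed

lemma square_integrable_scaleR_vector:
  fixes f :: "'a::euclidean_space \<Rightarrow> real" and b :: "'b::euclidean_space"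
  assumes "square_integrable f"
  shows "square_integrable (\<lambda>x. f x *\<^sub>R b)"
proof -
  have [measurable]: "f \<in> borel_measurable borel" using assms by (rule square_integrable_measurable)
  show ?thesis using assms by (auto simp: square_integrable_def power_mult_distrib)
qed

lemma square_integrable_inner_vector:
  fixes f :: "'a::euclidean_space \<Rightarrow> 'b::euclidean_space"
  assumes "square_integrable f"
  shows "square_integrable (\<lambda>x. f x \<bullet> b)"
proof (subst square_integrable_norm_iff)
  have [measurable]: "f \<in> borel_measurable borel" using assms by (rule square_integrable_measurable)
  show "(\<lambda>x. f x \<bullet> b) \<in> borel_measurable borel" by measurable
  have "(\<integral>\<^sup>+x. ennreal ((norm (f x \<bullet> b))\<^sup>2) \<partial>lborel) \<le> (\<integral>\<^sup>+x. ennreal ((norm (norm b *\<^sub>R f x))\<^sup>2) \<partial>lborel)"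
    using Cauchy_Schwarz_ineq2[of "f _" b]
    by (intro nn_integral_mono ennreal_leI power_mono) (auto simp: mult.commute)
  also have "\<dots> < \<infinity>"
    using square_integrable_scaleR[OF assms, of "norm b"] by (subst (asm) square_integrable_norm_iff) auto
  finally show "(\<integral>\<^sup>+x. ennreal ((norm (f x \<bullet> b))\<^sup>2) \<partial>lborel) < \<infinity>" .
qed

lemma norm_abs_l2_inner_vector:
  fixes f :: "'a::euclidean_space \<Rightarrow> 'b::euclidean_space"
  assumes f: "square_integrable f"
  shows "norm (abs_l2 (\<lambda>x. f x \<bullet> b)) \<le> norm b * norm (abs_l2 f)"
proof -
  note fb = square_integrable_inner_vector[OF f, of b] and bf = square_integrable_scaleR[OF f, of "norm b"]
  have "(norm (abs_l2 (\<lambda>x. f x \<bullet> b)))\<^sup>2 = (LINT x|lborel. (norm (f x \<bullet> b))\<^sup>2)"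
    using fb by (simp only: abs_l2_norm)
  also have "\<dots> \<le> (LINT x|lborel. (norm (norm b *\<^sub>R f x))\<^sup>2)"
    using fb bf Cauchy_Schwarz_ineq2[of "f _" b]
    by (intro integral_mono power_mono) (auto simp: square_integrable_def mult.commute)
  also have "\<dots> = (norm (norm b *\<^sub>R abs_l2 f))\<^sup>2"
    using bf f by (simp only: abs_l2_norm abs_l2_scaleR)
  finally have "norm (abs_l2 (\<lambda>x. f x \<bullet> b)) \<le> norm (norm b *\<^sub>R abs_l2 f)"
    by (rule power2_le_imp_le) simp
  then show ?thesis by simp
qed

lemma gradient_add:
  "f differentiable (at x) \<Longrightarrow> g differentiable (at x) \<Longrightarrow> gradient (\<lambda>x. f x + g x) x = gradient f x + gradient g x"
proof -
  assume a: "f differentiable (at x)" "g differentiable (at x)"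
  have "frechet_derivative (\<lambda>x. f x + g x) (at x) =
      (\<lambda>h. frechet_derivative f (at x) h + frechet_derivative g (at x) h)"
    using a by (auto intro!: frechet_derivative_at[symmetric] has_derivative_add
        frechet_derivative_works[THEN iffD1])
  then show ?thesis by (simp add: gradient_def scaleR_add_left sum.distrib)
qed

lemma gradient_scale:
  "f differentiable (at x) \<Longrightarrow> gradient (\<lambda>x. c * f x) x = c *\<^sub>R gradient f x"
proof -
  assume a: "f differentiable (at x)"
  have "frechet_derivative (\<lambda>x. c * f x) (at x) = (\<lambda>h. c * frechet_derivative f (at x) h)"
    using a by (auto intro!: frechet_derivative_at[symmetric] has_derivative_mult_right
        frechet_derivative_works[THEN iffD1])
  then show ?thesis by (simp add: gradient_def scaleR_sum_right)
qed

lemma test_functions_add: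
  assumes "f \<in> test_functions S" "g \<in> test_functions S"
  shows "(\<lambda>x. f x + g x) \<in> test_functions S"
proof -
  have "closure {x. f x + g x \<noteq> 0} \<subseteq> closure ({x. f x \<noteq> 0} \<union> {x. g x \<noteq> 0})"
    by (intro closure_mono) auto
  then have *: "closure {x. f x + g x \<noteq> 0} \<subseteq> closure {x. f x \<noteq> 0} \<union> closure {x. g x \<noteq> 0}"
    by (simp add: closure_Un)
  then have "compact (closure {x. f x + g x \<noteq> 0})"
    using assms by (intro compact_closure[THEN iffD2] bounded_subset[OF _ subset_trans[OF closure_subset *]])
      (auto simp: test_functions_def compact_imp_bounded)
  with * assms show ?thesis by (auto simp: test_functions_def intro: C_k_add)
qed

lemma test_functions_scale:
  assumes "f \<in> test_functions S"
  shows "(\<lambda>x. c * f x) \<in> test_functions S"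
proof -
  have *: "closure {x. c * f x \<noteq> 0} \<subseteq> closure {x. f x \<noteq> 0}"
    by (intro closure_mono) auto
  then have "compact (closure {x. c * f x \<noteq> 0})"
    using assms by (intro compact_closure[THEN iffD2] bounded_subset[OF _ subset_trans[OF closure_subset *]])
      (auto simp: test_functions_def compact_imp_bounded)
  with * assms show ?thesis by (auto simp: test_functions_def intro: C_k_scale)
qed

lemma test_functions_zero: "(\<lambda>x. 0) \<in> test_functions S"
  by (simp add: test_functions_def C_k_const)

text \<open>\<open>q\<close> lies in the closure of the test functions, so the bound extends by
  continuity to \<open>q\<close> itself. The later duality arguments end here, and
  \<open>C = 0\<close> gives vanishing.\<close>

lemma l2_bound_by_test_functions:
  fixes q :: "('a::euclidean_space, real) l2"
  assumes V: "open V" and q: "q \<in> L2 V"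
    and C: "0 \<le> C"
    and bound: "\<And>\<phi>. \<phi> \<in> test_functions V \<Longrightarrow> q \<bullet> abs_l2 \<phi> \<le> C * norm (abs_l2 \<phi>)"
  shows "norm q \<le> C"
proof -
  define N where "N = abs_l2 ` test_functions V"
  have "subspace N"
    unfolding N_def
  proof (rule subspaceI)
    show "0 \<in> abs_l2 ` test_functions V" using test_functions_zero by (auto simp: abs_l2_zero)
    fix x y :: "('a, real) l2" and c :: real
    assume x: "x \<in> abs_l2 ` test_functions V"
    then show "c *\<^sub>R x \<in> abs_l2 ` test_functions V"
      by (auto simp: abs_l2_scaleR square_integrable_test intro: test_functions_scale)
    assume "y \<in> abs_l2 ` test_functions V"
    with x show "x + y \<in> abs_l2 ` test_functions V"
      by (auto simp: abs_l2_add square_integrable_test intro: test_functions_add)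
  qed
  have "q \<in> closure N"
  proof (rule in_closure_if_double_orthogonal[OF \<open>subspace N\<close>])
    fix y assume y: "\<forall>z\<in>N. y \<bullet> z = 0"
    obtain f where f: "square_integrable f" "y = abs_l2 f" by (rule l2_cases)
    obtain g where g: "square_integrable g" "q = abs_l2 g" by (rule l2_cases)
    have "AE x in lborel. x \<in> V \<longrightarrow> f x = 0"
    proof (rule test_function_orthogonal_imp_AE_0[OF f(1) V])
      fix \<phi> assume \<phi>: "\<phi> \<in> test_functions V"
      then have "y \<bullet> abs_l2 \<phi> = 0" using y by (simp add: N_def)
      then show "(LINT x|lborel. f x * \<phi> x) = 0"
        using f square_integrable_test[OF \<phi>] by (simp add: abs_l2_inner)
    qed
    moreover have "AE x in lborel. x \<notin> V \<longrightarrow> g x = 0"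
      using q g by (simp add: L2_def abs_l2_vanishes_off)
    ultimately have "AE x in lborel. g x * f x = 0" by eventually_elim auto
    then have "(LINT x|lborel. g x * f x) = 0" by (rule integral_eq_zero_AE)
    then show "q \<bullet> y = 0" using f g by (simp add: abs_l2_inner)
  qed
  moreover have "closed {y. q \<bullet> y \<le> C * norm y}"
    by (intro closed_Collect_le continuous_intros)
  ultimately have "q \<bullet> q \<le> C * norm q"
    using closure_minimal[of N "{y. q \<bullet> y \<le> C * norm y}"] bound by (auto simp: N_def)
  then have "norm q * norm q \<le> C * norm q"
    by (simp add: power2_norm_eq_inner[symmetric] power2_eq_square)
  then show ?thesis using C by (cases "q = 0") auto
qed

section \<open>Translations and differentiation under the integral\<close>

lemma integral_lborel_shift:
  fixes f :: "'a::euclidean_space \<Rightarrow> 'b::euclidean_space"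
  assumes "f \<in> borel_measurable borel"
  shows "(LINT x|lborel. f (x + z)) = (LINT x|lborel. f x)"
proof -
  have "(LINT x|lborel. f x) = (LINT x|distr lborel borel ((+) z). f x)"
    by (simp only: lborel_distr_plus)
  also have "\<dots> = (LINT x|lborel. f (z + x))"
    using assms by (intro integral_distr) auto
  finally show ?thesis by (simp add: add.commute)
qed

lemma nn_integral_lborel_shift:
  fixes f :: "'a::euclidean_space \<Rightarrow> ennreal"
  assumes "f \<in> borel_measurable borel"
  shows "(\<integral>\<^sup>+x. f (x + z) \<partial>lborel) = (\<integral>\<^sup>+x. f x \<partial>lborel)"
proof -
  have "(\<integral>\<^sup>+x. f x \<partial>lborel) = (\<integral>\<^sup>+x. f x \<partial>distr lborel borel ((+) z))"
    by (simp only: lborel_distr_plus)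
  also have "\<dots> = (\<integral>\<^sup>+x. f (z + x) \<partial>lborel)"
    using assms by (intro nn_integral_distr) auto
  finally show ?thesis by (simp add: add.commute)
qed

lemma square_integrable_shift:
  fixes f :: "'a::euclidean_space \<Rightarrow> 'b::euclidean_space"
  assumes "square_integrable f"
  shows "square_integrable (\<lambda>x. f (x + z))"
proof -
  have [measurable]: "f \<in> borel_measurable borel" using assms by (rule square_integrable_measurable)
  have "(\<integral>\<^sup>+x. ennreal ((norm (f (x + z)))\<^sup>2) \<partial>lborel) = (\<integral>\<^sup>+x. ennreal ((norm (f x))\<^sup>2) \<partial>lborel)"
    by (rule nn_integral_lborel_shift) measurable
  then show ?thesis using assms by (simp add: square_integrable_norm_iff)
qed

lemma norm_abs_l2_shift:
  assumes "square_integrable f"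
  shows "norm (abs_l2 (\<lambda>x. f (x + z))) = norm (abs_l2 f)"
proof -
  have [measurable]: "f \<in> borel_measurable borel" using assms by (rule square_integrable_measurable)
  have "(norm (abs_l2 (\<lambda>x. f (x + z))))\<^sup>2 = (norm (abs_l2 f))\<^sup>2"
    using integral_lborel_shift[of "\<lambda>x. (norm (f x))\<^sup>2" z] assms
    by (simp add: abs_l2_norm square_integrable_shift)
  then show ?thesis by (rule power2_eq_imp_eq) auto
qed

lemma test_functions_shift:
  assumes \<phi>: "\<phi> \<in> test_functions S" and S: "\<And>x. x \<in> S \<Longrightarrow> x + z \<in> S'"
  shows "(\<lambda>x. \<phi> (x - z)) \<in> test_functions S'"
proof -
  have "{x. \<phi> (x - z) \<noteq> 0} = (+) z ` {x. \<phi> x \<noteq> 0}"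
    by (auto simp: image_iff) (metis add.commute diff_add_cancel)
  then have cl: "closure {x. \<phi> (x - z) \<noteq> 0} = (+) z ` closure {x. \<phi> x \<noteq> 0}"
    by (simp add: closure_translation)
  moreover have "C_k k (\<lambda>x. \<phi> (x - z))" for k
    using C_k_shift[OF test_function_C_k[OF \<phi>], of k "- z"] by simp
  ultimately show ?thesis
    using \<phi> S compact_translation[of "closure {x. \<phi> x \<noteq> 0}" z]
    unfolding test_functions_def mem_Collect_eq cl by (auto simp: add.commute)
qed

lemma gradient_shift:
  assumes "\<phi> \<in> test_functions S"
  shows "gradient (\<lambda>x. \<phi> (x - a)) x = gradient \<phi> (x - a)"
  using frechet_derivative_shift[of \<phi> "- a" x] test_function_differentiable[OF assms]
  by (simp add: gradient_def)

lemma gradient_bounded: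
  assumes "\<phi> \<in> test_functions S"
  obtains B where "0 \<le> B" "\<And>x. norm (gradient \<phi> x) \<le> B"
proof -
  have K: "compact (closure {x. \<phi> x \<noteq> 0})" using assms by (simp add: test_functions_def)
  have "continuous_on (closure {x. \<phi> x \<noteq> 0}) (gradient \<phi>)"
    using continuous_gradient[OF assms] by (rule continuous_on_subset) simp
  then have "bounded (gradient \<phi> ` closure {x. \<phi> x \<noteq> 0})"
    using K compact_continuous_image compact_imp_bounded by blast
  then obtain B where B: "\<And>x. x \<in> closure {x. \<phi> x \<noteq> 0} \<Longrightarrow> norm (gradient \<phi> x) \<le> B"
    by (auto simp: bounded_iff)
  show ?thesis
  proof (rule that[of "\<bar>B\<bar>"])
    show "norm (gradient \<phi> x) \<le> \<bar>B\<bar>" for x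
      using B[of x] gradient_eq_0_off_support[OF assms, of x] by (cases "x \<in> closure {x. \<phi> x \<noteq> 0}") auto
  qed simp
qed

lemma test_function_has_derivative:
  assumes "\<phi> \<in> test_functions S"
  shows "(\<phi> has_derivative (\<lambda>h. gradient \<phi> x \<bullet> h)) (at x)"
  using frechet_derivative_works[THEN iffD1, OF test_function_differentiable[OF assms, of x]]
  by (simp add: frechet_derivative_eq_gradient[OF test_function_differentiable[OF assms], abs_def])

lemma test_function_lipschitz:
  assumes \<phi>: "\<phi> \<in> test_functions S" and B: "\<And>x. norm (gradient \<phi> x) \<le> B"
  shows "\<bar>\<phi> x - \<phi> y\<bar> \<le> B * norm (x - y)"
proof -
  have "norm (\<phi> x - \<phi> y) \<le> B * norm (x - y)"
  proof (rule differentiable_bound[of UNIV \<phi> "\<lambda>x h. gradient \<phi> x \<bullet> h"])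
    show "onorm (\<lambda>h. gradient \<phi> x \<bullet> h) \<le> B" for x
    proof (rule onorm_le)
      show "norm (gradient \<phi> x \<bullet> h) \<le> B * norm h" for h
        using Cauchy_Schwarz_ineq2[of "gradient \<phi> x" h] mult_right_mono[OF B[of x], of "norm h"] by simp
    qed
  qed (use test_function_has_derivative[OF \<phi>] in auto)
  then show ?thesis by simp
qed

text \<open>The translation acts on the smooth factor, so dominated convergence applies although
  \<open>p\<close> is only square-integrable.\<close>

lemma integral_test_shift_derivative_0:
  fixes p :: "'a::euclidean_space \<Rightarrow> real"
  assumes p: "square_integrable p" and \<phi>: "\<phi> \<in> test_functions S"
  shows "((\<lambda>h. LINT x|lborel. p x * \<phi> (x - h *\<^sub>R z)) has_real_derivative
      - (LINT x|lborel. p x * (gradient \<phi> x \<bullet> z))) (at 0)"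
proof -
  have [measurable]: "p \<in> borel_measurable borel" "\<phi> \<in> borel_measurable borel" "gradient \<phi> \<in> borel_measurable borel"
    using p \<phi> test_function_measurable by (auto simp: square_integrable_measurable)
  have si: "square_integrable (\<lambda>x. \<phi> (x - a))" for a
    using square_integrable_shift[OF square_integrable_test(1)[OF \<phi>], of "- a"] by simp
  obtain R where R: "\<And>x. norm x > R \<Longrightarrow> \<phi> x = 0" using test_functions_subset_cball[OF \<phi>] by blast
  obtain B where B: "0 \<le> B" "\<And>x. norm (gradient \<phi> x) \<le> B" using gradient_bounded[OF \<phi>] by blast
  have "(\<lambda>n. (LINT x|lborel. p x * ((\<phi> (x - h n *\<^sub>R z) - \<phi> x) / h n)))
      \<longlonglongrightarrow> (LINT x|lborel. p x * - (gradient \<phi> x \<bullet> z))"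
    if h: "\<And>n. h n \<noteq> 0" "h \<longlonglongrightarrow> 0" for h :: "nat \<Rightarrow> real"
  proof -
    obtain M where M: "\<And>n. \<bar>h n\<bar> \<le> M"
      using convergent_imp_Bseq[OF convergentI[OF h(2)]] by (auto simp: Bseq_def)
    \<comment> \<open>Off this ball both \<phi> and all its translates by
      \<open>h n *\<^sub>R z\<close> vanish, because \<open>M\<close> bounds every
      \<open>h n\<close>; so one dominating function serves for all n.\<close>
    define K :: "'a set" where "K = cball 0 (R + M * norm z)"
    have "integrable lborel (\<lambda>x. indicat_real K x * p x)"
      using square_integrable_inner[OF square_integrable_indicator_bounded[of K] p] by (simp add: K_def)
    then have dom: "integrable lborel (\<lambda>x. (B * norm z) * \<bar>indicat_real K x * p x\<bar>)"
      by (intro integrable_mult_right integrable_abs) auto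
    show ?thesis
    proof (rule integral_dominated_convergence[OF _ _ dom])
      show "AE x in lborel. (\<lambda>n. p x * ((\<phi> (x - h n *\<^sub>R z) - \<phi> x) / h n)) \<longlonglongrightarrow> p x * - (gradient \<phi> x \<bullet> z)"
      proof (intro AE_I2 tendsto_mult tendsto_const)
        fix x
        have "((\<lambda>t. x - t *\<^sub>R z) has_derivative (\<lambda>t. - (t *\<^sub>R z))) (at 0)"
          by (auto intro!: derivative_eq_intros)
        from has_derivative_compose[OF this, of \<phi> "\<lambda>h. gradient \<phi> x \<bullet> h"]
        have "((\<lambda>t. \<phi> (x - t *\<^sub>R z)) has_derivative (\<lambda>t. - (gradient \<phi> x \<bullet> z) * t)) (at 0)"
          using test_function_has_derivative[OF \<phi>] by (simp add: mult.commute)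
        then have "((\<lambda>t. \<phi> (x - t *\<^sub>R z)) has_real_derivative - (gradient \<phi> x \<bullet> z)) (at 0)"
          unfolding has_field_derivative_def .
        then have *: "((\<lambda>t. (\<phi> (x - t *\<^sub>R z) - \<phi> x) / t) \<longlongrightarrow> - (gradient \<phi> x \<bullet> z)) (at 0)"
          by (simp add: DERIV_def)
        have "filterlim h (at 0) sequentially"
          using h by (auto simp: filterlim_at)
        from filterlim_compose[OF * this]
        show "(\<lambda>n. (\<phi> (x - h n *\<^sub>R z) - \<phi> x) / h n) \<longlonglongrightarrow> - (gradient \<phi> x \<bullet> z)" .
      qed
      fix n
      show "AE x in lborel. norm (p x * ((\<phi> (x - h n *\<^sub>R z) - \<phi> x) / h n))
          \<le> B * norm z * \<bar>indicat_real K x * p x\<bar>"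
      proof (rule AE_I2)
        fix x
        show "norm (p x * ((\<phi> (x - h n *\<^sub>R z) - \<phi> x) / h n)) \<le> B * norm z * \<bar>indicat_real K x * p x\<bar>"
        proof (cases "x \<in> K")
          case True
          have "\<bar>\<phi> (x - h n *\<^sub>R z) - \<phi> x\<bar> \<le> B * (\<bar>h n\<bar> * norm z)"
            using test_function_lipschitz[OF \<phi> B(2), of "x - h n *\<^sub>R z" x] by simp
          then have "\<bar>\<phi> (x - h n *\<^sub>R z) - \<phi> x\<bar> / \<bar>h n\<bar> \<le> B * norm z"
            using h(1)[of n] by (simp add: field_simps)
          from mult_left_mono[OF this, of "\<bar>p x\<bar>"] True show ?thesis
            by (simp add: abs_mult mult_ac)
        next
          case False
          then have nx: "norm x > R + M * norm z" by (simp add: K_def)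
          have "norm (h n *\<^sub>R z) \<le> M * norm z" using M[of n] by (simp add: mult_right_mono)
          then have "norm (x - h n *\<^sub>R z) > R" using nx norm_triangle_ineq2[of x "h n *\<^sub>R z"] by linarith
          moreover have "0 \<le> M * norm z" using M[of 0] by (intro mult_nonneg_nonneg) auto
          then have "norm x > R" using nx by linarith
          ultimately show ?thesis using R False by simp
        qed
      qed
    qed measurable
  qed
  note main = this
  have quotient: "(LINT x|lborel. p x * ((\<phi> (x - h *\<^sub>R z) - \<phi> x) / h))
      = ((LINT x|lborel. p x * \<phi> (x - h *\<^sub>R z)) - (LINT x|lborel. p x * \<phi> (x - 0 *\<^sub>R z))) / h" for h
    using square_integrable_inner[OF p si[of "h *\<^sub>R z"]] square_integrable_inner[OF p square_integrable_test(1)[OF \<phi>]]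
    by (simp add: right_diff_distrib divide_simps flip: Bochner_Integration.integral_diff)
  show ?thesis
    unfolding DERIV_def tendsto_at_iff_sequentially comp_def
  proof (intro allI impI)
    fix h :: "nat \<Rightarrow> real" assume "\<forall>i. h i \<in> UNIV - {0}" "h \<longlonglongrightarrow> 0"
    then show "(\<lambda>n. ((LINT x|lborel. p x * \<phi> (x - (0 + h n) *\<^sub>R z))
        - (LINT x|lborel. p x * \<phi> (x - 0 *\<^sub>R z))) / h n)
      \<longlonglongrightarrow> - (LINT x|lborel. p x * (gradient \<phi> x \<bullet> z))"
      using main[of h] unfolding quotient add_0 by simp
  qed
qed

lemma integral_test_shift_derivative:
  fixes p :: "'a::euclidean_space \<Rightarrow> real"
  assumes p: "square_integrable p" and \<phi>: "\<phi> \<in> test_functions S"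
  shows "((\<lambda>s. LINT x|lborel. p x * \<phi> (x - s *\<^sub>R z)) has_real_derivative
      - (LINT x|lborel. p x * (gradient \<phi> (x - s *\<^sub>R z) \<bullet> z))) (at s)"
proof -
  have "(\<lambda>x. \<phi> (x - s *\<^sub>R z)) \<in> test_functions UNIV"
    using \<phi> by (rule test_functions_shift) auto
  from integral_test_shift_derivative_0[OF p this, of z]
  have "((\<lambda>h. LINT x|lborel. p x * \<phi> (x - (h + s) *\<^sub>R z)) has_real_derivative
      - (LINT x|lborel. p x * (gradient \<phi> (x - s *\<^sub>R z) \<bullet> z))) (at 0)"
    by (simp add: gradient_shift[OF \<phi>] algebra_simps)
  then show ?thesis
    using DERIV_shift[of "\<lambda>s. LINT x|lborel. p x * \<phi> (x - s *\<^sub>R z)" _ 0 s] by simp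
qed

text \<open>By translation invariance, moving one factor along \<open>z\<close> is the same as
  moving the other along \<open>- z\<close>. Both descriptions of the integral are differentiated at
  0, and derivatives are unique.\<close>

lemma test_functions_integration_by_parts:
  assumes \<phi>: "\<phi> \<in> test_functions S" and \<psi>: "\<psi> \<in> test_functions T"
  shows "(LINT x|lborel. \<phi> x * (gradient \<psi> x \<bullet> z)) = - (LINT x|lborel. (gradient \<phi> x \<bullet> z) * \<psi> x)"
proof -
  have [measurable]: "\<phi> \<in> borel_measurable borel" "\<psi> \<in> borel_measurable borel"
    using \<phi> \<psi> test_function_measurable by auto
  have "(LINT x|lborel. \<phi> x * \<psi> (x - s *\<^sub>R z)) = (LINT x|lborel. \<psi> x * \<phi> (x - s *\<^sub>R (- z)))" for s
    using integral_lborel_shift[of "\<lambda>x. \<phi> x * \<psi> (x - s *\<^sub>R z)" "s *\<^sub>R z"] by (simp add: mult.commute)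
  with integral_test_shift_derivative_0[OF square_integrable_test(1)[OF \<phi>] \<psi>, of z]
    integral_test_shift_derivative_0[OF square_integrable_test(1)[OF \<psi>] \<phi>, of "- z"]
  show ?thesis by (auto dest: DERIV_unique simp: mult.commute)
qed

section \<open>Estimates on Lipschitz domains\<close>

text \<open>By duality it suffices to test against \<phi> supported in \<open>V\<close>. Moving
  \<phi> along the segment in direction \<open>z\<close> keeps its support in \<Omega>, so the mean
  value theorem reduces the increment to the weak gradient tested against one translate of
  \<phi>.\<close>

lemma weak_gradient_translation_bound:
  fixes p :: "'a::euclidean_space \<Rightarrow> real"
  assumes p: "square_integrable p" and g: "square_integrable g"
    and weak: "\<And>\<phi>. \<phi> \<in> test_functions \<Omega> \<Longrightarrow>
      (LINT x|lborel. p x * (gradient \<phi> x \<bullet> z)) = - (LINT x|lborel. (g x \<bullet> z) * \<phi> x)"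
    and V: "open V" "\<And>x s. x \<in> V \<Longrightarrow> 0 \<le> s \<Longrightarrow> s \<le> 1 \<Longrightarrow> x + s *\<^sub>R z \<in> \<Omega>"
  shows "norm (abs_l2 (\<lambda>x. indicat_real V x * (p (x + z) - p x))) \<le> norm z * norm (abs_l2 g)"
proof -
  note [measurable] = square_integrable_measurable[OF p] square_integrable_measurable[OF g]
  define q where "q x = indicat_real V x * (p (x + z) - p x)" for x
  have d: "square_integrable (\<lambda>x. p (x + z) - p x)"
    by (rule square_integrable_diff[OF square_integrable_shift[OF p] p])
  from square_integrable_indicator[OF this, of V] V(1) have q: "square_integrable q"
    by (simp add: q_def[abs_def])
  note gz = square_integrable_inner_vector[OF g, of z] and gz_norm = norm_abs_l2_inner_vector[OF g, of z]
  have "norm (abs_l2 q) \<le> norm z * norm (abs_l2 g)"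
  proof (rule l2_bound_by_test_functions[OF V(1)])
    show "abs_l2 q \<in> L2 V"
      using q by (auto simp: L2_def abs_l2_vanishes_off q_def)
    fix \<phi> assume \<phi>: "\<phi> \<in> test_functions V"
    have [measurable]: "\<phi> \<in> borel_measurable borel" using \<phi> test_function_measurable by auto
    note s\<phi> = square_integrable_test(1)[OF \<phi>]
    note \<phi>V = test_function_eq_0[OF \<phi>]
    define F where "F s = (LINT x|lborel. p x * \<phi> (x - s *\<^sub>R z))" for s
    define F' where "F' s = - (LINT x|lborel. p x * (gradient \<phi> (x - s *\<^sub>R z) \<bullet> z))" for s
    have F: "(F has_real_derivative F' s) (at s)" for s
      unfolding F_def[abs_def] F'_def by (rule integral_test_shift_derivative[OF p \<phi>])
    have F'_le: "F' s \<le> norm z * norm (abs_l2 g) * norm (abs_l2 \<phi>)" if s: "0 \<le> s" "s \<le> 1" for s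
    proof -
      have "(\<lambda>x. \<phi> (x - s *\<^sub>R z)) \<in> test_functions \<Omega>"
        using V(2) s by (intro test_functions_shift[OF \<phi>]) auto
      from weak[OF this] have "F' s = (LINT x|lborel. (g x \<bullet> z) * \<phi> (x - s *\<^sub>R z))"
        by (simp add: F'_def gradient_shift[OF \<phi>])
      also have "\<dots> = abs_l2 (\<lambda>x. g x \<bullet> z) \<bullet> abs_l2 (\<lambda>x. \<phi> (x + (- (s *\<^sub>R z))))"
        by (subst abs_l2_inner[OF gz square_integrable_shift[OF s\<phi>]]) simp
      also have "\<dots> \<le> norm (abs_l2 (\<lambda>x. g x \<bullet> z)) * norm (abs_l2 \<phi>)"
        using norm_cauchy_schwarz norm_abs_l2_shift[OF s\<phi>] by metis
      also have "\<dots> \<le> norm z * norm (abs_l2 g) * norm (abs_l2 \<phi>)"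
        using gz_norm by (intro mult_right_mono) auto
      finally show ?thesis .
    qed
    obtain s where s: "0 < s" "s < 1" "F 1 - F 0 = (1 - 0) * F' s"
      using MVT2[of 0 1 F F'] F by auto
    have "abs_l2 q \<bullet> abs_l2 \<phi> = (LINT x|lborel. p (x + z) * \<phi> x - p x * \<phi> x)"
      unfolding abs_l2_inner[OF q s\<phi>]
      by (intro Bochner_Integration.integral_cong) (auto simp: q_def indicator_def \<phi>V algebra_simps)
    also have "\<dots> = (LINT x|lborel. p (x + z) * \<phi> x) - (LINT x|lborel. p x * \<phi> x)"
      using square_integrable_inner[OF square_integrable_shift[OF p] s\<phi>] square_integrable_inner[OF p s\<phi>]
      by (intro Bochner_Integration.integral_diff) auto
    also have "(LINT x|lborel. p (x + z) * \<phi> x) = F 1"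
      using integral_lborel_shift[of "\<lambda>x. p x * \<phi> (x - z)" z] by (simp add: F_def)
    also have "(LINT x|lborel. p x * \<phi> x) = F 0" by (simp add: F_def)
    finally show "abs_l2 q \<bullet> abs_l2 \<phi> \<le> norm z * norm (abs_l2 g) * norm (abs_l2 \<phi>)"
      using s F'_le[of s] by simp
  qed simp
  then show ?thesis by (simp add: q_def[abs_def])
qed


section \<open>Restriction of \<open>l2\<close> classes to Borel sets\<close>

lemma restrict_l2_inner:
  assumes "S \<in> sets borel"
  shows "restrict_l2 S u \<bullet> v = u \<bullet> restrict_l2 S v"
proof -
  obtain f where f: "square_integrable f" "u = abs_l2 f" by (rule l2_cases)
  obtain g where g: "square_integrable g" "v = abs_l2 g" by (rule l2_cases)
  show ?thesis
    unfolding f(2) g(2) abs_l2_restrict[OF f(1) assms] abs_l2_restrict[OF g(1) assms]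
      abs_l2_inner[OF square_integrable_indicator[OF f(1) assms] g(1)]
      abs_l2_inner[OF f(1) square_integrable_indicator[OF g(1) assms]]
    by simp
qed

lemma restrict_l2_eq_iff:
  assumes "S \<in> sets borel"
  shows "restrict_l2 S u = u \<longleftrightarrow> u \<in> L2 S"
proof -
  obtain f where f: "square_integrable f" "u = abs_l2 f" by (rule l2_cases)
  show ?thesis
    unfolding f(2) L2_def mem_Collect_eq abs_l2_restrict[OF f(1) assms] abs_l2_vanishes_off[OF f(1)]
      abs_l2_eq_iff[OF square_integrable_indicator[OF f(1) assms] f(1)]
    by (intro AE_cong) (auto simp: indicator_def)
qed

lemma restrict_l2_restrict:
  assumes "S \<in> sets borel" "T \<in> sets borel"
  shows "restrict_l2 S (restrict_l2 T u) = restrict_l2 (S \<inter> T) u"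
proof -
  obtain f where f: "square_integrable f" "u = abs_l2 f" by (rule l2_cases)
  show ?thesis
    unfolding f(2) abs_l2_restrict[OF f(1) assms(2)] abs_l2_restrict[OF f(1) sets.Int[OF assms]]
      abs_l2_restrict[OF square_integrable_indicator[OF f(1) assms(2)] assms(1)]
    by (simp add: indicator_inter_arith)
qed

text \<open>Linearity follows from self-adjointness, since a class is determined by its inner
  products.\<close>

lemma restrict_l2_add: "S \<in> sets borel \<Longrightarrow> restrict_l2 S (u + v) = restrict_l2 S u + restrict_l2 S v"
  by (rule vector_eq_rdot[THEN iffD1]) (simp add: restrict_l2_inner inner_add_left)

lemma restrict_l2_scaleR: "S \<in> sets borel \<Longrightarrow> restrict_l2 S (c *\<^sub>R u) = c *\<^sub>R restrict_l2 S u"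
  by (rule vector_eq_rdot[THEN iffD1]) (simp add: restrict_l2_inner)

lemma restrict_l2_diff: "S \<in> sets borel \<Longrightarrow> restrict_l2 S (u - v) = restrict_l2 S u - restrict_l2 S v"
  by (rule vector_eq_rdot[THEN iffD1]) (simp add: restrict_l2_inner inner_diff_left)

lemma norm_restrict_l2:
  assumes "square_integrable f" "S \<in> sets borel"
  shows "(norm (restrict_l2 S (abs_l2 f)))\<^sup>2 = (LINT x|lborel. indicat_real S x * (norm (f x))\<^sup>2)"
  unfolding abs_l2_restrict[OF assms] abs_l2_norm[OF square_integrable_indicator[OF assms]]
  by (intro Bochner_Integration.integral_cong) (auto simp: indicator_def)

lemma norm_restrict_l2_le: "S \<in> sets borel \<Longrightarrow> norm (restrict_l2 S u) \<le> norm u"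
proof -
  assume S: "S \<in> sets borel"
  have "norm (restrict_l2 S u) * norm (restrict_l2 S u) = restrict_l2 S u \<bullet> u"
    using S by (simp add: restrict_l2_inner restrict_l2_restrict power2_norm_eq_inner[symmetric] flip: power2_eq_square)
      (metis inner_commute inf.idem power2_norm_eq_inner restrict_l2_inner restrict_l2_restrict)
  also have "\<dots> \<le> norm (restrict_l2 S u) * norm u" by (rule norm_cauchy_schwarz)
  finally show ?thesis by (cases "restrict_l2 S u = 0") auto
qed

lemma norm_restrict_l2_mono:
  assumes "A \<subseteq> B" "A \<in> sets borel" "B \<in> sets borel"
  shows "norm (restrict_l2 A u) \<le> norm (restrict_l2 B u)"
  using norm_restrict_l2_le[OF assms(2), of "restrict_l2 B u"] assms
  by (simp add: restrict_l2_restrict Int_absorb2)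

lemma norm_restrict_l2_Un:
  assumes "A \<in> sets borel" "B \<in> sets borel"
  shows "norm (restrict_l2 (A \<union> B) u) \<le> norm (restrict_l2 A u) + norm (restrict_l2 B u)"
proof -
  obtain f where f: "square_integrable f" "u = abs_l2 f" by (rule l2_cases)
  have BA: "B - A \<in> sets borel" and AB: "A \<union> B \<in> sets borel" using assms by auto
  have "restrict_l2 (A \<union> B) u = restrict_l2 A u + restrict_l2 (B - A) u"
    unfolding f(2) abs_l2_restrict[OF f(1) assms(1)] abs_l2_restrict[OF f(1) BA] abs_l2_restrict[OF f(1) AB]
      abs_l2_add[OF square_integrable_indicator[OF f(1) assms(1)] square_integrable_indicator[OF f(1) BA]]
    by (intro arg_cong[of _ _ abs_l2] ext) (auto simp: indicator_def)
  also have "norm \<dots> \<le> norm (restrict_l2 A u) + norm (restrict_l2 (B - A) u)"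
    by (rule norm_triangle_ineq)
  also have "norm (restrict_l2 (B - A) u) \<le> norm (restrict_l2 B u)"
    using assms by (intro norm_restrict_l2_mono) auto
  finally show ?thesis by simp
qed

text \<open>\<open>p\<close> has weak gradient \<open>g\<close> on \<open>\<Omega>\<close>, and its norm in the dual of \<open>H\<^sup>1\<^sub>0\<close> is at most a multiple of \<open>N\<close>.\<close>

definition weakly_bounded :: "'a::euclidean_space set \<Rightarrow> ('a \<Rightarrow> real) \<Rightarrow> ('a \<Rightarrow> 'a) \<Rightarrow> real \<Rightarrow> bool" where
  "weakly_bounded \<Omega> p g N \<longleftrightarrow> square_integrable p \<and> square_integrable g \<and>
    (\<forall>\<phi>\<in>test_functions \<Omega>. \<forall>z. (LINT x|lborel. p x * (gradient \<phi> x \<bullet> z)) = - (LINT x|lborel. (g x \<bullet> z) * \<phi> x)) \<and>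
    (\<forall>\<phi>\<in>test_functions \<Omega>. \<bar>LINT x|lborel. p x * \<phi> x\<bar> \<le> N * (norm (abs_l2 \<phi>) + norm (abs_l2 (gradient \<phi>))))"

text \<open>The estimate localised to \<open>A\<close>, with one constant for all functions. Its
  stability under finite unions reduces \<Omega> to an interior compact set and finitely many
  boundary patches.\<close>

definition controlled_on :: "'a::euclidean_space set \<Rightarrow> 'a set \<Rightarrow> bool" where
  "controlled_on \<Omega> A \<longleftrightarrow> A \<in> sets borel \<and> (\<exists>C\<ge>0. \<forall>p g N. 0 \<le> N \<longrightarrow> weakly_bounded \<Omega> p g N \<longrightarrow>
     norm (restrict_l2 A (abs_l2 p)) \<le> C * (norm (abs_l2 g) + N))"

lemma controlled_on_mono: "controlled_on \<Omega> B \<Longrightarrow> A \<subseteq> B \<Longrightarrow> A \<in> sets borel \<Longrightarrow> controlled_on \<Omega> A"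
  unfolding controlled_on_def by (meson norm_restrict_l2_mono order_trans)

lemma controlled_on_Un:
  assumes "controlled_on \<Omega> A" "controlled_on \<Omega> B"
  shows "controlled_on \<Omega> (A \<union> B)"
proof -
  obtain C where C: "0 \<le> C"
    "\<And>p g N. 0 \<le> N \<Longrightarrow> weakly_bounded \<Omega> p g N \<Longrightarrow> norm (restrict_l2 A (abs_l2 p)) \<le> C * (norm (abs_l2 g) + N)"
    using assms(1) unfolding controlled_on_def by blast
  obtain D where D: "0 \<le> D"
    "\<And>p g N. 0 \<le> N \<Longrightarrow> weakly_bounded \<Omega> p g N \<Longrightarrow> norm (restrict_l2 B (abs_l2 p)) \<le> D * (norm (abs_l2 g) + N)"
    using assms(2) unfolding controlled_on_def by blast
  have AB: "A \<in> sets borel" "B \<in> sets borel" using assms by (auto simp: controlled_on_def)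
  show ?thesis unfolding controlled_on_def
  proof (intro conjI exI[of _ "C + D"] allI impI)
    fix p g N assume *: "0 \<le> N" "weakly_bounded \<Omega> p g N"
    show "norm (restrict_l2 (A \<union> B) (abs_l2 p)) \<le> (C + D) * (norm (abs_l2 g) + N)"
      using norm_restrict_l2_Un[OF AB, of "abs_l2 p"] C(2)[OF *] D(2)[OF *] by (simp add: distrib_right)
  qed (use C(1) D(1) AB in auto)
qed

lemma controlled_on_empty: "controlled_on \<Omega> {}"
  unfolding controlled_on_def
proof (intro conjI exI[of _ 0] allI impI)
  fix p :: "'a \<Rightarrow> real" and g :: "'a \<Rightarrow> 'a" and N assume "weakly_bounded \<Omega> p g N"
  then have "square_integrable p" by (simp add: weakly_bounded_def)
  from norm_restrict_l2[OF this, of "{}"] show "norm (restrict_l2 {} (abs_l2 p)) \<le> 0 * (norm (abs_l2 g) + N)"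
    by simp
qed auto

lemma controlled_on_UN:
  "finite I \<Longrightarrow> (\<And>i. i \<in> I \<Longrightarrow> controlled_on \<Omega> (A i)) \<Longrightarrow> controlled_on \<Omega> (\<Union>i\<in>I. A i)"
  by (induction I rule: finite_induct) (auto intro: controlled_on_empty controlled_on_Un)

section \<open>Mollification and the interior estimate\<close>

lemma mollifier_exists:
  assumes "0 < (e::real)"
  obtains \<phi> :: "'a::euclidean_space \<Rightarrow> real"
  where "\<phi> \<in> test_functions (ball 0 e)" "\<And>x. 0 \<le> \<phi> x" "(LINT x|lborel. \<phi> x) = 1"
    and "integrable lborel \<phi>" "\<exists>B. \<forall>x. \<phi> x \<le> B"
proof -
  obtain a b :: 'a where ab: "0 \<in> box a b" "cbox a b \<subseteq> ball 0 e"
    using open_contains_cbox[of "ball (0::'a) e" 0] assms open_ball by (metis centre_in_ball)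
  define H where "H = box_bump a b"
  have H: "H \<in> test_functions (ball 0 e)"
    unfolding H_def by (rule test_functionsI_box[OF C_k_box_bump box_bump_eq_0 ab(2)])
  have [measurable]: "H \<in> borel_measurable borel" using H test_function_measurable by blast
  have "integrable lborel (indicat_real (box a b))"
    using square_integrable_inner[OF square_integrable_indicator_bounded square_integrable_indicator_bounded, of "box a b" "box a b"]
    by (simp flip: indicator_inter_arith)
  then have int: "integrable lborel H"
  proof (rule Bochner_Integration.integrable_bound)
    show "AE x in lborel. norm (H x) \<le> norm (indicat_real (box a b) x)"
      by (auto simp: H_def indicator_def box_bump_le_1 box_bump_eq_0)
  qed measurable
  have H01: "0 \<le> H x" "H x \<le> 1" "x \<in> box a b \<Longrightarrow> 0 < H x" for x
    by (auto simp: H_def box_bump_le_1 box_bump_pos)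
  have "(LINT x|lborel. H x) \<noteq> 0"
  proof
    assume "(LINT x|lborel. H x) = 0"
    then have "AE x in lborel. H x = 0"
      by (subst (asm) integral_nonneg_eq_0_iff_AE[OF int]) (auto simp: H01)
    then have "AE x in lborel. x \<notin> box a b"
      by eventually_elim (use H01(3) in force)
    then have "emeasure lborel (box a b) = 0"
      by (subst (asm) AE_iff_measurable[of "box a b"]) auto
    moreover have "a \<bullet> i < b \<bullet> i" if "i \<in> Basis" for i
      using ab(1) that by (force simp: mem_box)
    then have "0 < emeasure lborel (box a b)"
      by (simp add: emeasure_lborel_box_eq less_imp_le prod_pos inner_diff_left)
    ultimately show False by simp
  qed
  moreover have "0 \<le> (LINT x|lborel. H x)"
    by (intro Bochner_Integration.integral_nonneg) (simp add: H01)
  ultimately have pos: "0 < (LINT x|lborel. H x)" by simp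
  define c where "c = 1 / (LINT x|lborel. H x)"
  have c: "0 < c" using pos by (simp add: c_def)
  show ?thesis
  proof (rule that[of "\<lambda>x. c * H x"])
    show "(\<lambda>x. c * H x) \<in> test_functions (ball 0 e)" by (rule test_functions_scale[OF H])
    show "0 \<le> c * H x" for x using c H01(1)[of x] by simp
    show "(LINT x|lborel. c * H x) = 1" using pos by (simp add: c_def)
    show "integrable lborel (\<lambda>x. c * H x)" using int by simp
    show "\<exists>B. \<forall>x. c * H x \<le> B"
      using c H01(2) by (intro exI[of _ "c * 1"] allI mult_left_mono) auto
  qed
qed

text \<open>Expanding \<open>\<integral> (p (x + z) - p x)\<^sup>2 \<phi> z dz\<close> and dropping the term \<open>\<integral> (p (x + z))\<^sup>2 \<phi> z dz \<ge> 0\<close>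
  replaces the usual appeal to Jensen's inequality.\<close>

lemma square_le_mollified:
  fixes p :: "'a::euclidean_space \<Rightarrow> real"
  assumes p: "square_integrable p" and \<phi>: "\<phi> \<in> test_functions S" "\<And>x. 0 \<le> \<phi> x"
    "(LINT x|lborel. \<phi> x) = 1" "integrable lborel \<phi>" "\<exists>B. \<forall>x. \<phi> x \<le> B"
    and m: "\<bar>LINT y|lborel. p y * \<phi> (y - x)\<bar> \<le> c"
  shows "ennreal ((p x)\<^sup>2) \<le> 2 * (\<integral>\<^sup>+z. ennreal ((p (x + z) - p x)\<^sup>2) * ennreal (\<phi> z) \<partial>lborel) + ennreal (4 * c\<^sup>2)"
proof -
  have [measurable]: "p \<in> borel_measurable borel" "\<phi> \<in> borel_measurable borel"
    using p \<phi> test_function_measurable by (auto simp: square_integrable_measurable)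
  have px: "square_integrable (\<lambda>z. p (x + z))"
    using square_integrable_shift[OF p, of x] by (simp add: add.commute)
  obtain B where B: "\<And>x. \<phi> x \<le> B" using \<phi> by blast
  have i1: "integrable lborel (\<lambda>z. (p (x + z))\<^sup>2 * \<phi> z)"
  proof (rule Bochner_Integration.integrable_bound)
    show "integrable lborel (\<lambda>z. B * (p (x + z))\<^sup>2)"
      using px by (auto simp: square_integrable_def)
    have "0 \<le> B" using B[of 0] \<phi>(2)[of 0] by simp
    then show "AE z in lborel. norm ((p (x + z))\<^sup>2 * \<phi> z) \<le> norm (B * (p (x + z))\<^sup>2)"
      using B \<phi>(2) by (auto simp: abs_mult mult.commute[of B] intro!: mult_left_mono)
  qed measurable
  have i2: "integrable lborel (\<lambda>z. p (x + z) * \<phi> z)"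
    using square_integrable_inner[OF px square_integrable_test(1)[OF \<phi>(1)]] by simp
  define m where "m = (LINT z|lborel. p (x + z) * \<phi> z)"
  have m_eq: "m = (LINT y|lborel. p y * \<phi> (y - x))"
    using integral_lborel_shift[of "\<lambda>y. p y * \<phi> (y - x)" x] by (simp add: m_def add.commute)
  define I where "I = (LINT z|lborel. (p (x + z) - p x)\<^sup>2 * \<phi> z)"
  have exp: "(p (x + z) - p x)\<^sup>2 * \<phi> z = (p (x + z))\<^sup>2 * \<phi> z - 2 * p x * (p (x + z) * \<phi> z) + (p x)\<^sup>2 * \<phi> z" for z
    by (simp add: power2_eq_square algebra_simps)
  have i3: "integrable lborel (\<lambda>z. (p (x + z) - p x)\<^sup>2 * \<phi> z)"
    unfolding exp using i1 i2 \<phi>(4) by simp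
  have "I = (LINT z|lborel. (p (x + z))\<^sup>2 * \<phi> z) - 2 * p x * m + (p x)\<^sup>2"
    unfolding I_def exp m_def using i1 i2 \<phi>(3,4) by simp
  moreover have "0 \<le> (LINT z|lborel. (p (x + z))\<^sup>2 * \<phi> z)"
    using \<phi>(2) by (intro Bochner_Integration.integral_nonneg) auto
  \<comment> \<open>Young's inequality, weighted so that half of the square can be absorbed on the
    left; this produces the factors 2 and 4.\<close>
  moreover have "2 * (p x * m) \<le> (p x)\<^sup>2 / 2 + 2 * m\<^sup>2"
    using zero_le_power2[of "p x - 2 * m"] by (simp add: power2_eq_square algebra_simps)
  ultimately have "(p x)\<^sup>2 \<le> 2 * I + 4 * m\<^sup>2" by simp
  also have "m\<^sup>2 \<le> c\<^sup>2"
    using m m_eq by (intro abs_le_square_iff[THEN iffD1]) linarith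
  finally have "ennreal ((p x)\<^sup>2) \<le> ennreal (2 * I + 4 * c\<^sup>2)" by (intro ennreal_leI) simp
  also have "\<dots> = 2 * ennreal I + ennreal (4 * c\<^sup>2)"
  proof -
    have "0 \<le> I" unfolding I_def using \<phi>(2) by (intro Bochner_Integration.integral_nonneg) auto
    then show ?thesis by (simp add: ennreal_plus ennreal_mult)
  qed
  also have "ennreal I = (\<integral>\<^sup>+z. ennreal ((p (x + z) - p x)\<^sup>2 * \<phi> z) \<partial>lborel)"
    unfolding I_def using \<phi>(2) i3 by (intro nn_integral_eq_integral[symmetric]) auto
  also have "\<dots> = (\<integral>\<^sup>+z. ennreal ((p (x + z) - p x)\<^sup>2) * ennreal (\<phi> z) \<partial>lborel)"
    by (intro nn_integral_cong ennreal_mult) (simp_all add: \<phi>(2))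
  finally show ?thesis .
qed

text \<open>At each point of a neighbourhood \<open>V\<close> of \<open>K\<close> the function is
  compared with a local mean. The mean is a pairing with a test function, hence bounded through
  \<open>N\<close>; the squared deviation, integrated over \<open>V\<close>, is an average over
  \<open>z\<close> of translation increments, bounded by the gradient.\<close>

lemma controlled_on_compact:
  fixes \<Omega> :: "'a::euclidean_space set"
  assumes \<Omega>: "open \<Omega>" and K: "compact K" "K \<subseteq> \<Omega>"
  shows "controlled_on \<Omega> K"
proof -
  obtain e0 where e0: "0 < e0" "{x. infdist x K \<le> e0} \<subseteq> \<Omega> \<or> K = {}"
    using compact_in_open_separated[OF _ K(1) \<Omega> K(2)] zero_less_one by metis
  \<comment> \<open>Half of the margin \<open>e0\<close> is spent on thickening \<open>K\<close> to
    \<open>V\<close>, the other half on translations of \<open>V\<close>.\<close>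
  define e where "e = e0 / 2"
  define V where "V = (\<Union>k\<in>K. ball k e)"
  have e: "0 < e" using e0 by (simp add: e_def)
  have V: "open V" "K \<subseteq> V" "bounded V"
  proof -
    have "V \<subseteq> (\<Union>k\<in>K. cball k e)" unfolding V_def by fastforce
    moreover have "compact (\<Union>k\<in>K. cball k e)" using K(1) e by (intro compact_minkowski_sum_cball)
    ultimately show "bounded V" using compact_imp_bounded bounded_subset by blast
  qed (use e in \<open>auto simp: V_def\<close>)
  have V\<Omega>: "x + z \<in> \<Omega>" if x: "x \<in> V" "norm z \<le> e" for x z
  proof -
    obtain k where k: "k \<in> K" "dist k x < e" using x by (auto simp: V_def)
    have "infdist (x + z) K \<le> dist (x + z) k" using k by (intro infdist_le)
    also have "\<dots> \<le> dist (x + z) x + dist x k" by (rule dist_triangle)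
    also have "\<dots> \<le> e + e" using x k by (simp add: dist_commute dist_norm norm_minus_commute)
    finally show ?thesis using e0 k by (auto simp: e_def)
  qed
  obtain \<phi> :: "'a \<Rightarrow> real" where \<phi>: "\<phi> \<in> test_functions (ball 0 e)" "\<And>x. 0 \<le> \<phi> x"
    "(LINT x|lborel. \<phi> x) = 1" "integrable lborel \<phi>" "\<exists>B. \<forall>x. \<phi> x \<le> B"
    using mollifier_exists[OF e] by metis
  have [measurable]: "\<phi> \<in> borel_measurable borel" "V \<in> sets borel"
    using \<phi> V test_function_measurable by auto
  \<comment> \<open>Both norms are invariant under translation, so one constant bounds the local
    means around all points of \<open>V\<close>.\<close>
  define c where "c = norm (abs_l2 \<phi>) + norm (abs_l2 (gradient \<phi>))"
  have c: "0 \<le> c" by (simp add: c_def)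
  define v where "v = measure lborel V"
  have v: "emeasure lborel V = ennreal v" "0 \<le> v"
    using emeasure_bounded_finite[OF V(3)] by (auto simp: v_def emeasure_eq_ennreal_measure)
  have main: "norm (restrict_l2 V (abs_l2 p)) \<le> (2 * e + 2 * sqrt v * c) * (norm (abs_l2 g) + N)"
    if N: "0 \<le> N" and w: "weakly_bounded \<Omega> p g N" for p g N
  proof -
    have p: "square_integrable p" and g: "square_integrable g" using w by (auto simp: weakly_bounded_def)
    note [measurable] = square_integrable_measurable[OF p] square_integrable_measurable[OF g]
    have pt: "ennreal ((p x)\<^sup>2) \<le> 2 * (\<integral>\<^sup>+z. ennreal ((p (x + z) - p x)\<^sup>2) * ennreal (\<phi> z) \<partial>lborel) + ennreal (4 * (N * c)\<^sup>2)"
      if x: "x \<in> V" for x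
    proof (rule square_le_mollified[OF p \<phi>])
      have sh: "(\<lambda>y. \<phi> (y - x)) \<in> test_functions \<Omega>"
        using V\<Omega>[OF x] by (intro test_functions_shift[OF \<phi>(1)]) (auto simp: add.commute)
      have gs: "gradient (\<lambda>y. \<phi> (y - x)) = (\<lambda>y. gradient \<phi> (y - x))"
        by (rule ext) (rule gradient_shift[OF \<phi>(1)])
      have "\<bar>LINT y|lborel. p y * \<phi> (y - x)\<bar> \<le> N * (norm (abs_l2 (\<lambda>y. \<phi> (y - x))) + norm (abs_l2 (gradient (\<lambda>y. \<phi> (y - x)))))"
        using w sh by (auto simp: weakly_bounded_def)
      also have "\<dots> = N * c"
        using norm_abs_l2_shift[OF square_integrable_test(1)[OF \<phi>(1)], of "- x"]
          norm_abs_l2_shift[OF square_integrable_test(2)[OF \<phi>(1)], of "- x"] by (simp add: c_def gs)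
      finally show "\<bar>LINT y|lborel. p y * \<phi> (y - x)\<bar> \<le> N * c" .
    qed
    \<comment> \<open>The weight \<open>\<phi> z\<close> vanishes unless \<open>z\<close> is shorter
      than \<open>e\<close>, and for such \<open>z\<close> the segments starting in \<open>V\<close>
      stay in \<Omega>.\<close>
    have tr: "(\<integral>\<^sup>+x. indicator V x * ennreal ((p (x + z) - p x)\<^sup>2) \<partial>lborel) * ennreal (\<phi> z)
        \<le> ennreal ((e * norm (abs_l2 g))\<^sup>2) * ennreal (\<phi> z)" for z
    proof (cases "z \<in> ball 0 e")
      case True
      have d: "square_integrable (\<lambda>x. p (x + z) - p x)"
        by (rule square_integrable_diff[OF square_integrable_shift[OF p] p])
      have d': "square_integrable (\<lambda>x. indicat_real V x * (p (x + z) - p x))"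
        using square_integrable_indicator[OF d, of V] by simp
      have "norm (abs_l2 (\<lambda>x. indicat_real V x * (p (x + z) - p x))) \<le> norm z * norm (abs_l2 g)"
      proof (rule weak_gradient_translation_bound[OF p g _ V(1)])
        show "x + s *\<^sub>R z \<in> \<Omega>" if "x \<in> V" "0 \<le> s" "s \<le> 1" for x s
          using True that mult_mono[of s 1 "norm z" e] by (intro V\<Omega>) auto
      qed (use w in \<open>auto simp: weakly_bounded_def\<close>)
      also have "\<dots> \<le> e * norm (abs_l2 g)" using True by (intro mult_right_mono) auto
      finally have "(norm (abs_l2 (\<lambda>x. indicat_real V x * (p (x + z) - p x))))\<^sup>2 \<le> (e * norm (abs_l2 g))\<^sup>2"
        by (rule power_mono) simp
      moreover have "(\<integral>\<^sup>+x. indicator V x * ennreal ((p (x + z) - p x)\<^sup>2) \<partial>lborel)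
          = (\<integral>\<^sup>+x. ennreal ((norm (indicat_real V x * (p (x + z) - p x)))\<^sup>2) \<partial>lborel)"
        by (intro nn_integral_cong) (auto simp: indicator_def)
      ultimately show ?thesis
        by (intro mult_right_mono) (simp_all only: norm_abs_l2_nn_integral[OF d'] ennreal_leI zero_le)
    next
      case False
      then show ?thesis using test_function_eq_0[OF \<phi>(1) False] by simp
    qed
    have "ennreal ((norm (restrict_l2 V (abs_l2 p)))\<^sup>2) = (\<integral>\<^sup>+x. indicator V x * ennreal ((p x)\<^sup>2) \<partial>lborel)"
      unfolding abs_l2_restrict[OF p \<open>V \<in> sets borel\<close>]
        norm_abs_l2_nn_integral[OF square_integrable_indicator[OF p \<open>V \<in> sets borel\<close>], symmetric]
      by (intro nn_integral_cong) (auto simp: indicator_def)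
    also have "\<dots> \<le> (\<integral>\<^sup>+x. 2 * (\<integral>\<^sup>+z. indicator V x * ennreal ((p (x + z) - p x)\<^sup>2) * ennreal (\<phi> z) \<partial>lborel)
        + ennreal (4 * (N * c)\<^sup>2) * indicator V x \<partial>lborel)"
      using pt by (intro nn_integral_mono) (auto simp: indicator_def)
    also have "\<dots> = 2 * (\<integral>\<^sup>+x. (\<integral>\<^sup>+z. indicator V x * ennreal ((p (x + z) - p x)\<^sup>2) * ennreal (\<phi> z) \<partial>lborel) \<partial>lborel)
        + ennreal (4 * (N * c)\<^sup>2) * emeasure lborel V"
      by (simp add: nn_integral_add nn_integral_cmult)
    \<comment> \<open>Tonelli: with \<open>x\<close> innermost, the translation bound applies for
      each fixed \<open>z\<close>.\<close>
    also have "(\<integral>\<^sup>+x. (\<integral>\<^sup>+z. indicator V x * ennreal ((p (x + z) - p x)\<^sup>2) * ennreal (\<phi> z) \<partial>lborel) \<partial>lborel)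
        = (\<integral>\<^sup>+z. (\<integral>\<^sup>+x. indicator V x * ennreal ((p (x + z) - p x)\<^sup>2) * ennreal (\<phi> z) \<partial>lborel) \<partial>lborel)"
      by (rule lborel_pair.Fubini') measurable
    also have "\<dots> = (\<integral>\<^sup>+z. (\<integral>\<^sup>+x. indicator V x * ennreal ((p (x + z) - p x)\<^sup>2) \<partial>lborel) * ennreal (\<phi> z) \<partial>lborel)"
      by (simp add: nn_integral_multc)
    also have "\<dots> \<le> (\<integral>\<^sup>+z. ennreal ((e * norm (abs_l2 g))\<^sup>2) * ennreal (\<phi> z) \<partial>lborel)"
      by (intro nn_integral_mono tr)
    also have "\<dots> = ennreal ((e * norm (abs_l2 g))\<^sup>2)"
      using \<phi> by (simp add: nn_integral_cmult nn_integral_eq_integral)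
    finally have "ennreal ((norm (restrict_l2 V (abs_l2 p)))\<^sup>2)
        \<le> 2 * ennreal ((e * norm (abs_l2 g))\<^sup>2) + ennreal (4 * (N * c)\<^sup>2) * ennreal v"
      using v by (simp add: add_mono mult_left_mono)
    also have "\<dots> = ennreal (2 * (e * norm (abs_l2 g))\<^sup>2 + 4 * (N * c)\<^sup>2 * v)"
      using v by (simp add: ennreal_mult ennreal_plus)
    finally have "(norm (restrict_l2 V (abs_l2 p)))\<^sup>2 \<le> 2 * (e * norm (abs_l2 g))\<^sup>2 + 4 * (N * c)\<^sup>2 * v"
      using v by (subst (asm) ennreal_le_iff) auto
    also have "\<dots> \<le> (2 * e * norm (abs_l2 g) + 2 * sqrt v * c * N)\<^sup>2"
    proof -
      have "0 \<le> 2 * (e * norm (abs_l2 g))\<^sup>2" "0 \<le> e * norm (abs_l2 g) * (sqrt v * (c * N))"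
        using e v c N by (auto intro!: mult_nonneg_nonneg)
      then show ?thesis using v by (simp add: power2_sum power_mult_distrib algebra_simps)
    qed
    finally have "norm (restrict_l2 V (abs_l2 p)) \<le> 2 * e * norm (abs_l2 g) + 2 * sqrt v * c * N"
      by (rule power2_le_imp_le) (use e v c N in \<open>auto intro!: add_nonneg_nonneg mult_nonneg_nonneg\<close>)
    also have "\<dots> \<le> (2 * e + 2 * sqrt v * c) * (norm (abs_l2 g) + N)"
    proof -
      have "0 \<le> 2 * e * N" "0 \<le> 2 * sqrt v * c * norm (abs_l2 g)" using e v c N by auto
      then show ?thesis by (simp add: algebra_simps)
    qed
    finally show ?thesis .
  qed
  have "controlled_on \<Omega> V"
    unfolding controlled_on_def using main e v c
    by (intro conjI exI[of _ "2 * e + 2 * sqrt v * c"]) auto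
  then show ?thesis using V K by (auto intro: controlled_on_mono simp: borel_compact)
qed


section \<open>Boundary patches and null frontiers\<close>

lemma lipschitz_domain_epigraph:
  assumes "lipschitz_domain \<Omega>" "q \<in> frontier \<Omega>"
  obtains e r K \<psi> where "norm e = 1" "0 < r" "lipschitz_on K {y. y \<bullet> e = 0} \<psi>"
    "\<Omega> \<inter> ball q r = {x \<in> ball q r. \<psi> (x - (x \<bullet> e) *\<^sub>R e) < x \<bullet> e}"
  using assms unfolding lipschitz_domain_def by blast

text \<open>Moving along \<open>e\<close> fixes the projection onto the hyperplane and raises the
  height by \<open>t\<close>, so even points on the graph end up strictly above it.\<close>

lemma lipschitz_domain_shift:
  assumes sub: "\<Omega> \<inter> ball q r = {x \<in> ball q r. \<psi> (x - (x \<bullet> e) *\<^sub>R e) < x \<bullet> e}"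
    and e: "norm e = 1" and t: "0 < t" and xr: "x + t *\<^sub>R e \<in> ball q r"
    and x: "\<psi> (x - (x \<bullet> e) *\<^sub>R e) \<le> x \<bullet> e"
  shows "x + t *\<^sub>R e \<in> \<Omega>"
proof -
  have "e \<bullet> e = 1" using e by (simp add: norm_eq_1)
  then have *: "x + t *\<^sub>R e - ((x + t *\<^sub>R e) \<bullet> e) *\<^sub>R e = x - (x \<bullet> e) *\<^sub>R e" "(x + t *\<^sub>R e) \<bullet> e = x \<bullet> e + t"
    by (simp_all add: inner_add_left scaleR_add_left)
  have "x + t *\<^sub>R e \<in> \<Omega> \<inter> ball q r" unfolding sub mem_Collect_eq *(1) unfolding *(2) using xr x t by auto
  then show ?thesis by simp
qed

text \<open>Passing to the closure weakens the strict inequality. Since the ball is open, points of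
  the closure in it are limits of points of \<Omega> in it.\<close>

lemma epigraph_closure_le:
  fixes \<psi> :: "'a::euclidean_space \<Rightarrow> real"
  assumes sub: "\<Omega> \<inter> ball q r = {x \<in> ball q r. \<psi> (x - (x \<bullet> e) *\<^sub>R e) < x \<bullet> e}"
    and e: "norm e = 1" and \<psi>: "lipschitz_on K {y. y \<bullet> e = 0} \<psi>"
    and x: "x \<in> closure \<Omega>" "x \<in> ball q r"
  shows "\<psi> (x - (x \<bullet> e) *\<^sub>R e) \<le> x \<bullet> e"
proof -
  have "e \<bullet> e = 1" using e by (simp add: norm_eq_1)
  then have "continuous_on UNIV (\<lambda>x. \<psi> (x - (x \<bullet> e) *\<^sub>R e))"
    by (intro continuous_on_compose2[OF lipschitz_on_continuous_on[OF \<psi>]] continuous_intros)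
      (auto simp: inner_diff_left)
  then have "closed {x. \<psi> (x - (x \<bullet> e) *\<^sub>R e) \<le> x \<bullet> e}"
    by (intro closed_Collect_le continuous_intros)
  moreover have "\<Omega> \<inter> ball q r \<subseteq> {x. \<psi> (x - (x \<bullet> e) *\<^sub>R e) \<le> x \<bullet> e}"
    unfolding sub by auto
  ultimately have "closure (\<Omega> \<inter> ball q r) \<subseteq> {x. \<psi> (x - (x \<bullet> e) *\<^sub>R e) \<le> x \<bullet> e}"
    by (rule closure_minimal[rotated])
  moreover have "x \<in> closure (\<Omega> \<inter> ball q r)"
    using x open_Int_closure_subset[of "ball q r" \<Omega>] by (auto simp: Int_commute)
  ultimately show ?thesis by auto
qed

text \<open>Translating inward, i.e. upward in the local epigraph representation, moves a boundary patch
  into a compact subset of the domain.\<close>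

lemma controlled_on_boundary_patch:
  fixes \<Omega> :: "'a::euclidean_space set"
  assumes \<Omega>: "lipschitz_domain \<Omega>" "bounded \<Omega>" and q: "q \<in> frontier \<Omega>"
  shows "\<exists>\<rho>>0. controlled_on \<Omega> (\<Omega> \<inter> ball q \<rho>)"
proof -
  obtain e r K \<psi> where e: "norm e = 1" and r: "0 < r" and \<psi>: "lipschitz_on K {y. y \<bullet> e = 0} \<psi>"
    and sub: "\<Omega> \<inter> ball q r = {x \<in> ball q r. \<psi> (x - (x \<bullet> e) *\<^sub>R e) < x \<bullet> e}"
    by (rule lipschitz_domain_epigraph[OF \<Omega>(1) q])
  have o: "open \<Omega>" using \<Omega>(1) by (simp add: lipschitz_domain_def)
  \<comment> \<open>A patch of radius r/4 moved by at most r/2 stays in the ball of radius r, where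
    the epigraph description is valid.\<close>
  define V where "V = \<Omega> \<inter> ball q (r / 4)"
  define z where "z = (r / 2) *\<^sub>R e"
  define Q where "Q = (\<lambda>x. x + z) ` (closure \<Omega> \<inter> cball q (r / 4))"
  have nz: "norm z = r / 2" using e r by (simp add: z_def)
  have in_ball: "x + t *\<^sub>R e \<in> ball q r" if "dist q x \<le> r / 4" "0 \<le> t" "t \<le> r / 2" for x t
  proof -
    have "dist q (x + t *\<^sub>R e) \<le> dist q x + dist x (x + t *\<^sub>R e)" by (rule dist_triangle)
    also have "dist x (x + t *\<^sub>R e) = t" using that e by (simp add: dist_norm)
    finally show ?thesis using that r by simp
  qed
  have "Q \<subseteq> \<Omega>"
  proof
    fix y assume "y \<in> Q"
    then obtain x where x: "y = x + (r / 2) *\<^sub>R e" "x \<in> closure \<Omega>" "dist q x \<le> r / 4"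
      by (auto simp: Q_def z_def)
    have "x \<in> ball q r" using x r by simp
    with x r show "y \<in> \<Omega>"
      using lipschitz_domain_shift[OF sub e, of "r / 2" x] in_ball[of x "r / 2"]
        epigraph_closure_le[OF sub e \<psi>, of x] by auto
  qed
  moreover have "compact Q"
  proof -
    have "compact (closure \<Omega> \<inter> cball q (r / 4))" using \<Omega>(2) by (intro compact_Int) (auto simp: compact_closure)
    then show ?thesis unfolding Q_def by (intro compact_continuous_image continuous_intros)
  qed
  ultimately have "controlled_on \<Omega> Q" using controlled_on_compact[OF o] by blast
  then obtain C where C: "0 \<le> C"
    "\<And>p g N. 0 \<le> N \<Longrightarrow> weakly_bounded \<Omega> p g N \<Longrightarrow> norm (restrict_l2 Q (abs_l2 p)) \<le> C * (norm (abs_l2 g) + N)"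
    unfolding controlled_on_def by blast
  have Vo: "open V" using o by (auto simp: V_def)
  then have Vb: "V \<in> sets borel" by simp
  have Qb: "Q \<in> sets borel" using \<open>compact Q\<close> by (simp add: borel_compact)
  have "norm (restrict_l2 V (abs_l2 p)) \<le> (C + r / 2) * (norm (abs_l2 g) + N)"
    if N: "0 \<le> N" and w: "weakly_bounded \<Omega> p g N" for p g N
  proof -
    have p: "square_integrable p" and g: "square_integrable g" using w by (auto simp: weakly_bounded_def)
    note pz = square_integrable_shift[OF p, of z]
    have step: "norm (abs_l2 (\<lambda>x. indicat_real V x * (p (x + z) - p x))) \<le> r / 2 * norm (abs_l2 g)"
      unfolding nz[symmetric]
    proof (rule weak_gradient_translation_bound[OF p g _ Vo])
      fix x s :: real and y assume y: "y \<in> V" and s: "0 \<le> s" "s \<le> 1"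
      have yr: "dist q y \<le> r / 4" "y \<in> ball q r" "y \<in> \<Omega>" using y r by (auto simp: V_def)
      show "y + s *\<^sub>R z \<in> \<Omega>"
      \<comment> \<open>\<open>lipschitz_domain_shift\<close> asks for a positive shift; at
        \<open>s = 0\<close> the point is in \<Omega> because it is in \<open>V\<close>.\<close>
      proof (cases "s = 0")
        case False
        have "s * (r / 2) \<le> r / 2" using s r by (simp add: mult_left_le_one_le)
        with False s r yr show ?thesis
          using lipschitz_domain_shift[OF sub e, of "s * (r / 2)" y] in_ball[of y "s * (r / 2)"]
            epigraph_closure_le[OF sub e \<psi>, of y] closure_subset by (auto simp: z_def)
      qed (use yr in simp)
    qed (use w in \<open>auto simp: weakly_bounded_def\<close>)
    \<comment> \<open>On \<open>V\<close>, \<open>p\<close> is its translate, whose values are taken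
      in \<open>Q\<close>, minus the increment bounded by \<open>step\<close>.\<close>
    have "restrict_l2 V (abs_l2 p) = restrict_l2 V (abs_l2 (\<lambda>x. p (x + z))) - abs_l2 (\<lambda>x. indicat_real V x * (p (x + z) - p x))"
      using restrict_l2_diff[OF Vb, of "abs_l2 (\<lambda>x. p (x + z))" "abs_l2 p"]
        abs_l2_restrict[OF square_integrable_diff[OF pz p] Vb] abs_l2_diff[OF pz p] by (simp add: algebra_simps)
    then have "norm (restrict_l2 V (abs_l2 p)) \<le> norm (restrict_l2 V (abs_l2 (\<lambda>x. p (x + z)))) + r / 2 * norm (abs_l2 g)"
      using norm_triangle_ineq4[of "restrict_l2 V (abs_l2 (\<lambda>x. p (x + z)))"] step by (smt (verit))
    moreover have "norm (restrict_l2 V (abs_l2 (\<lambda>x. p (x + z)))) \<le> norm (restrict_l2 Q (abs_l2 p))"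
    proof -
      define f where "f x = indicat_real Q x *\<^sub>R p x" for x
      have f: "square_integrable f" unfolding f_def[abs_def] by (rule square_integrable_indicator[OF p Qb])
      have "restrict_l2 V (abs_l2 (\<lambda>x. p (x + z))) = restrict_l2 V (abs_l2 (\<lambda>x. f (x + z)))"
        unfolding abs_l2_restrict[OF pz Vb] abs_l2_restrict[OF square_integrable_shift[OF f] Vb]
        by (intro arg_cong[of _ _ abs_l2] ext)
          (use closure_subset[of \<Omega>] in \<open>auto simp: f_def indicator_def Q_def V_def\<close>)
      also have "norm \<dots> \<le> norm (abs_l2 (\<lambda>x. f (x + z)))" by (rule norm_restrict_l2_le[OF Vb])
      also have "\<dots> = norm (restrict_l2 Q (abs_l2 p))"
        unfolding norm_abs_l2_shift[OF f] by (simp add: f_def[abs_def] abs_l2_restrict[OF p Qb])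
      finally show ?thesis .
    qed
    moreover have "0 \<le> r / 2 * N" using r N by simp
    ultimately show ?thesis using C(2)[OF N w] by (simp add: distrib_right distrib_left)
  qed
  then have "controlled_on \<Omega> V"
    unfolding controlled_on_def using Vb C(1) r by (intro conjI exI[of _ "C + r / 2"]) auto
  then show ?thesis using r unfolding V_def by (intro exI[of _ "r / 4"]) simp
qed

text \<open>The frontier is compact, so finitely many patches cover it; what they leave of the
  closure is compact and contained in \<Omega>.\<close>

lemma controlled_on_lipschitz_domain:
  fixes \<Omega> :: "'a::euclidean_space set"
  assumes \<Omega>: "lipschitz_domain \<Omega>" "bounded \<Omega>"
  shows "controlled_on \<Omega> \<Omega>"
proof -
  have o: "open \<Omega>" using \<Omega>(1) by (simp add: lipschitz_domain_def)
  obtain \<rho> where \<rho>: "\<And>q. q \<in> frontier \<Omega> \<Longrightarrow> 0 < \<rho> q \<and> controlled_on \<Omega> (\<Omega> \<inter> ball q (\<rho> q))"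
    using controlled_on_boundary_patch[OF \<Omega>] by metis
  have "compact (frontier \<Omega>)" using \<Omega>(2) by (simp add: compact_frontier_bounded)
  then obtain F where F: "F \<subseteq> frontier \<Omega>" "finite F" "frontier \<Omega> \<subseteq> (\<Union>q\<in>F. ball q (\<rho> q))"
    using \<rho> by (elim compactE_image[where C="frontier \<Omega>" and f="\<lambda>q. ball q (\<rho> q)"]) auto
  define K where "K = closure \<Omega> - (\<Union>q\<in>F. ball q (\<rho> q))"
  have "compact K" unfolding K_def using \<Omega>(2) by (intro compact_diff) (auto simp: compact_closure)
  moreover have "K \<subseteq> \<Omega>" using F(3) o by (auto simp: K_def frontier_def interior_open)
  ultimately have "controlled_on \<Omega> K" using controlled_on_compact[OF o] by blast
  then have "controlled_on \<Omega> (K \<union> (\<Union>q\<in>F. \<Omega> \<inter> ball q (\<rho> q)))"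
    using F \<rho> by (intro controlled_on_Un controlled_on_UN) auto
  then show ?thesis
    by (rule controlled_on_mono) (use closure_subset[of \<Omega>] o in \<open>auto simp: K_def\<close>)
qed

text \<open>Near each of its points the frontier lies on the graph of a Lipschitz function over a
  hyperplane, hence in a Lipschitz image of a null set.\<close>

lemma frontier_lipschitz_domain_null:
  fixes \<Omega> :: "'a::euclidean_space set"
  assumes \<Omega>: "lipschitz_domain \<Omega>"
  shows "negligible (frontier \<Omega>)"
proof (subst locally_negligible_alt, rule ballI)
  fix q assume q: "q \<in> frontier \<Omega>"
  obtain e r K \<psi> where e: "norm e = 1" and r: "0 < r" and \<psi>: "lipschitz_on K {y. y \<bullet> e = 0} \<psi>"
    and sub: "\<Omega> \<inter> ball q r = {x \<in> ball q r. \<psi> (x - (x \<bullet> e) *\<^sub>R e) < x \<bullet> e}"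
    by (rule lipschitz_domain_epigraph[OF \<Omega> q])
  have o: "open \<Omega>" using \<Omega> by (simp add: lipschitz_domain_def)
  have ee: "e \<bullet> e = 1" using e by (simp add: norm_eq_1)
  define H where "H = {y. y \<bullet> e = 0}"
  have "e \<noteq> 0" using e by auto
  then have "negligible H" unfolding H_def
    using negligible_hyperplane[of e 0] by (simp add: inner_commute)
  then have "negligible ((\<lambda>y. y + \<psi> y *\<^sub>R e) ` H)"
  proof (rule negligible_locally_Lipschitz_image[OF order_refl])
    fix x assume x: "x \<in> H"
    have "norm (y + \<psi> y *\<^sub>R e - (x + \<psi> x *\<^sub>R e)) \<le> (1 + K) * norm (y - x)" if y: "y \<in> H" for y
    proof -
      have "y + \<psi> y *\<^sub>R e - (x + \<psi> x *\<^sub>R e) = (y - x) + (\<psi> y - \<psi> x) *\<^sub>R e" by (simp add: algebra_simps)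
      also have "norm \<dots> \<le> norm (y - x) + norm ((\<psi> y - \<psi> x) *\<^sub>R e)" by (rule norm_triangle_ineq)
      also have "norm ((\<psi> y - \<psi> x) *\<^sub>R e) \<le> K * norm (y - x)"
        using lipschitz_onD[OF \<psi>, of y x] x y e by (simp add: H_def dist_norm)
      finally show ?thesis by (simp add: distrib_right)
    qed
    then show "\<exists>T B. open T \<and> x \<in> T \<and> (\<forall>y\<in>H \<inter> T. norm (y + \<psi> y *\<^sub>R e - (x + \<psi> x *\<^sub>R e)) \<le> B * norm (y - x))"
      by (intro exI[of _ UNIV] exI[of _ "1 + K"]) auto
  qed
  moreover have "frontier \<Omega> \<inter> ball q r \<subseteq> (\<lambda>y. y + \<psi> y *\<^sub>R e) ` H"
  proof
    fix x assume x: "x \<in> frontier \<Omega> \<inter> ball q r"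
    then have "x \<in> closure \<Omega>" "x \<notin> \<Omega>" using o by (auto simp: frontier_def interior_open)
    then have "\<psi> (x - (x \<bullet> e) *\<^sub>R e) = x \<bullet> e"
      using x epigraph_closure_le[OF sub e \<psi>, of x] sub by force
    then have "x = (x - (x \<bullet> e) *\<^sub>R e) + \<psi> (x - (x \<bullet> e) *\<^sub>R e) *\<^sub>R e" by simp
    moreover have "x - (x \<bullet> e) *\<^sub>R e \<in> H" using ee by (simp add: H_def inner_diff_left)
    ultimately show "x \<in> (\<lambda>y. y + \<psi> y *\<^sub>R e) ` H" by blast
  qed
  ultimately have "negligible (frontier \<Omega> \<inter> ball q r)" by (rule negligible_subset)
  moreover have "openin (top_of_set (frontier \<Omega>)) (frontier \<Omega> \<inter> ball q r)" by (simp add: openin_open_Int)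
  ultimately show "\<exists>U. openin (top_of_set (frontier \<Omega>)) U \<and> q \<in> U \<and> negligible U"
    using q r by (intro exI[of _ "frontier \<Omega> \<inter> ball q r"]) auto
qed

text \<open>In a mesh only the closures of the elements are known to cover; what the elements
  themselves may miss lies in their frontiers, which are null.\<close>

lemma mesh_covers_AE:
  fixes \<Omega> :: "'a::euclidean_space set"
  assumes "is_mesh \<Omega> M"
  shows "AE x in lborel. x \<in> \<Omega> \<longrightarrow> x \<in> \<Union>M"
proof -
  have M: "finite M" "\<And>T. T \<in> M \<Longrightarrow> lipschitz_domain T" "closure \<Omega> = (\<Union>T\<in>M. closure T)"
    using assms by (auto simp: is_mesh_def)
  have "negligible (\<Union>T\<in>M. frontier T)"
    using M by (intro negligible_Union) (auto intro: frontier_lipschitz_domain_null)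
  then have "AE x in lebesgue. x \<notin> (\<Union>T\<in>M. frontier T)"
    by (intro AE_not_in) (simp add: negligible_iff_null_sets)
  then have "AE x in lborel. x \<notin> (\<Union>T\<in>M. frontier T)" by (simp add: AE_completion_iff)
  moreover have "x \<in> \<Union>M" if "x \<notin> (\<Union>T\<in>M. frontier T)" "x \<in> \<Omega>" for x
  proof -
    have "x \<in> closure \<Omega>" using that closure_subset by blast
    then obtain T where T: "T \<in> M" "x \<in> closure T" using M by auto
    with that(1) have "x \<in> interior T" by (auto simp: frontier_def)
    then show ?thesis using T interior_subset by blast
  qed
  ultimately show ?thesis by (auto elim!: eventually_mono)
qed

text \<open>A translation of length 2R makes the function orthogonal to its translate. By Pythagoras
  its norm is then at most that of the increment, which the gradient bounds.\<close>

lemma poincare_test_functions: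
  fixes \<Omega> :: "'a::euclidean_space set"
  assumes "bounded \<Omega>"
  shows "\<exists>C\<ge>0. \<forall>\<phi>\<in>test_functions \<Omega>. norm (abs_l2 \<phi>) \<le> C * norm (abs_l2 (gradient \<phi>))"
proof -
  obtain R where R: "0 < R" "\<And>x. x \<in> \<Omega> \<Longrightarrow> norm x < R" using assms by (auto simp: bounded_pos_less)
  obtain b :: 'a where b: "norm b = 1" using vector_choose_size[of 1] by auto
  define z where "z = (2 * R) *\<^sub>R b"
  have nz: "norm z = 2 * R" using R b by (simp add: z_def)
  have "norm (abs_l2 \<phi>) \<le> 2 * R * norm (abs_l2 (gradient \<phi>))" if \<phi>: "\<phi> \<in> test_functions \<Omega>" for \<phi>
  proof -
    note s = square_integrable_test[OF \<phi>]
    note sz = square_integrable_shift[OF s(1), of z]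
    have "norm (abs_l2 (\<lambda>x. indicat_real UNIV x * (\<phi> (x + z) - \<phi> x))) \<le> norm z * norm (abs_l2 (gradient \<phi>))"
      by (rule weak_gradient_translation_bound[OF s, where \<Omega> = UNIV])
        (auto intro: test_functions_integration_by_parts[OF \<phi>])
    then have "norm (abs_l2 (\<lambda>x. \<phi> (x + z)) - abs_l2 \<phi>) \<le> 2 * R * norm (abs_l2 (gradient \<phi>))"
      by (simp add: abs_l2_diff[OF sz s(1)] nz)
    moreover have "abs_l2 (\<lambda>x. \<phi> (x + z)) \<bullet> abs_l2 \<phi> = 0"
    proof -
      have "\<phi> (x + z) = 0 \<or> \<phi> x = 0" for x
      proof (rule ccontr)
        assume "\<not> ?thesis"
        then have "x + z \<in> \<Omega>" "x \<in> \<Omega>" using test_function_eq_0[OF \<phi>] by blast+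
        then have "norm (x + z) < R" "norm x < R" using R by auto
        then show False using nz norm_triangle_ineq4[of "x + z" x] by simp
      qed
      then have "(\<lambda>x. \<phi> (x + z) * \<phi> x) = (\<lambda>x. 0)" by auto
      then show ?thesis by (simp add: abs_l2_inner[OF sz s(1)])
    qed
    then have "(norm (abs_l2 (\<lambda>x. \<phi> (x + z)) - abs_l2 \<phi>))\<^sup>2 = (norm (abs_l2 (\<lambda>x. \<phi> (x + z))))\<^sup>2 + (norm (abs_l2 \<phi>))\<^sup>2"
      by (simp add: power2_norm_eq_inner inner_diff inner_commute)
    then have "norm (abs_l2 \<phi>) \<le> norm (abs_l2 (\<lambda>x. \<phi> (x + z)) - abs_l2 \<phi>)"
      by (intro power2_le_imp_le[OF _ norm_ge_zero]) simp
    ultimately show ?thesis by simp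
  qed
  then show ?thesis using R by (intro exI[of _ "2 * R"]) auto
qed

section \<open>Graphs of the weak gradient and divergence\<close>

text \<open>The gradient comes first to match a field paired with its divergence: orthogonality to
  these pairs is the weak divergence.\<close>

definition test_graph :: "'a::euclidean_space set \<Rightarrow> (('a, 'a) l2 \<times> ('a, real) l2) set" where
  "test_graph S = (\<lambda>\<phi>. (abs_l2 (gradient \<phi>), abs_l2 \<phi>)) ` test_functions S"

text \<open>The field \<open>\<phi> x *\<^sub>R b\<close> has divergence
  \<open>gradient \<phi> x \<bullet> b\<close>: these are smooth fields with their divergences, and
  orthogonality to them is the weak gradient.\<close>

definition vector_test_graph :: "'a::euclidean_space set \<Rightarrow> (('a, 'a) l2 \<times> ('a, real) l2) set" where
  "vector_test_graph S = (\<lambda>(\<phi>, b). (abs_l2 (\<lambda>x. \<phi> x *\<^sub>R b), abs_l2 (\<lambda>x. gradient \<phi> x \<bullet> b))) 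
    ` (test_functions S \<times> Basis)"

definition grad_graph :: "'a::euclidean_space set \<Rightarrow> (('a, 'a) l2 \<times> ('a, real) l2) set" where
  "grad_graph S = (\<lambda>v. (wgrad S v, v)) ` H1 S"

definition grad_graph0 :: "'a::euclidean_space set \<Rightarrow> (('a, 'a) l2 \<times> ('a, real) l2) set" where
  "grad_graph0 S = (\<lambda>v. (wgrad S v, v)) ` H10 S"

definition div_graph :: "'a::euclidean_space set \<Rightarrow> (('a, 'a) l2 \<times> ('a, real) l2) set" where
  "div_graph S = (\<lambda>\<tau>. (\<tau>, wdiv S \<tau>)) ` Hdiv S"

definition div_graph0 :: "'a::euclidean_space set \<Rightarrow> (('a, 'a) l2 \<times> ('a, real) l2) set" where
  "div_graph0 S = (\<lambda>\<tau>. (\<tau>, wdiv S \<tau>)) ` Hdiv0 S"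

lemma L2_subspace:
  assumes "S \<in> sets borel"
  shows "subspace (L2 S)"
  by (rule subspaceI)
    (auto simp: restrict_l2_eq_iff[OF assms, symmetric] restrict_l2_add[OF assms] restrict_l2_scaleR[OF assms]
      intro: restrict_l2_scaleR[OF assms, of 0, simplified])

lemma restrict_l2_in_L2:
  assumes "S \<in> sets borel"
  shows "restrict_l2 S u \<in> L2 S"
  by (simp add: restrict_l2_eq_iff[OF assms, symmetric] restrict_l2_restrict assms)

lemma L2_inner_restrict:
  assumes "S \<in> sets borel" "u \<in> L2 S"
  shows "u \<bullet> restrict_l2 S v = u \<bullet> v"
  using restrict_l2_eq_iff[OF assms(1), of u] restrict_l2_inner[OF assms(1), of u v] assms(2) by simp

text \<open>\<open>L2 S\<close> is the orthogonal complement of the range of the complementary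
  restriction.\<close>

lemma L2_closed:
  assumes "S \<in> sets borel"
  shows "closed (L2 S)"
proof -
  have eq: "L2 S = {u. \<forall>v\<in>range (\<lambda>v. v - restrict_l2 S v). u \<bullet> v = 0}"
  proof (intro set_eqI iffI)
    fix u assume "u \<in> L2 S"
    then show "u \<in> {u. \<forall>v\<in>range (\<lambda>v. v - restrict_l2 S v). u \<bullet> v = 0}"
      by (auto simp: inner_diff_right L2_inner_restrict[OF assms])
  next
    fix u assume *: "u \<in> {u. \<forall>v\<in>range (\<lambda>v. v - restrict_l2 S v). u \<bullet> v = 0}"
    have "u \<bullet> v = restrict_l2 S u \<bullet> v" for v
      using * restrict_l2_inner[OF assms, of u v] by (simp add: inner_diff_right)
    then have "restrict_l2 S u = u" using vector_eq_rdot by metis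
    then show "u \<in> L2 S" by (simp add: restrict_l2_eq_iff[OF assms])
  qed
  show ?thesis by (subst eq) (rule closed_orthogonal_comp)
qed

lemma L2_mono: "S \<subseteq> T \<Longrightarrow> L2 S \<subseteq> L2 T"
proof
  fix u assume *: "S \<subseteq> T" "u \<in> L2 S"
  obtain f where f: "square_integrable f" "u = abs_l2 f" by (rule l2_cases)
  show "u \<in> L2 T" using * f by (auto simp: L2_def abs_l2_vanishes_off elim!: eventually_mono)
qed

lemma test_in_L2:
  assumes "\<phi> \<in> test_functions S"
  shows "abs_l2 \<phi> \<in> L2 S" "abs_l2 (gradient \<phi>) \<in> L2 S"
proof -
  show "abs_l2 \<phi> \<in> L2 S"
    using test_function_eq_0[OF assms] by (auto simp: L2_def abs_l2_vanishes_off square_integrable_test[OF assms])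
  have "gradient \<phi> x = 0" if "x \<notin> S" for x
    using gradient_eq_0_off_support[OF assms, of x] assms that by (auto simp: test_functions_def)
  then show "abs_l2 (gradient \<phi>) \<in> L2 S"
    by (auto simp: L2_def abs_l2_vanishes_off square_integrable_test[OF assms])
qed

section \<open>Weak derivatives as orthogonality relations\<close>

lemma has_weak_divergence_iff:
  "has_weak_divergence S \<tau> d \<longleftrightarrow> (\<forall>x\<in>test_graph S. (\<tau>, d) \<bullet> x = 0)"
proof -
  obtain t where t: "square_integrable t" "\<tau> = abs_l2 t" by (rule l2_cases)
  obtain f where f: "square_integrable f" "d = abs_l2 f" by (rule l2_cases)
  have "has_weak_divergence S \<tau> d \<longleftrightarrow> (\<forall>\<phi>\<in>test_functions S.
     (LINT x|lborel. t x \<bullet> gradient \<phi> x) = - (LINT x|lborel. f x * \<phi> x))"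
    unfolding t(2) f(2) using t f by (subst has_weak_divergence.abs_eq) auto
  also have "\<dots> \<longleftrightarrow> (\<forall>\<phi>\<in>test_functions S. (\<tau>, d) \<bullet> (abs_l2 (gradient \<phi>), abs_l2 \<phi>) = 0)"
    unfolding t(2) f(2)
    by (intro ball_cong refl) (auto simp: abs_l2_inner[OF t(1) square_integrable_test(2)]
        abs_l2_inner[OF f(1) square_integrable_test(1)] eq_neg_iff_add_eq_0)
  finally show ?thesis by (simp add: test_graph_def)
qed

lemma has_weak_gradient_iff:
  "has_weak_gradient S v g \<longleftrightarrow> (\<forall>x\<in>vector_test_graph S. (g, v) \<bullet> x = 0)"
proof -
  obtain t where t: "square_integrable t" "g = abs_l2 t" by (rule l2_cases)
  obtain f where f: "square_integrable f" "v = abs_l2 f" by (rule l2_cases)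
  have "has_weak_gradient S v g \<longleftrightarrow> (\<forall>\<phi>\<in>test_functions S. \<forall>b\<in>Basis.
     (LINT x|lborel. f x * frechet_derivative \<phi> (at x) b) = - (LINT x|lborel. (t x \<bullet> b) * \<phi> x))"
    unfolding t(2) f(2) using t f by (subst has_weak_gradient.abs_eq) auto
  also have "\<dots> \<longleftrightarrow> (\<forall>\<phi>\<in>test_functions S. \<forall>b\<in>Basis.
      (g, v) \<bullet> (abs_l2 (\<lambda>x. \<phi> x *\<^sub>R b), abs_l2 (\<lambda>x. gradient \<phi> x \<bullet> b)) = 0)"
    unfolding t(2) f(2)
    by (intro ball_cong refl)
      (auto simp: abs_l2_inner[OF t(1) square_integrable_scaleR_vector[OF square_integrable_test(1)]]
        abs_l2_inner[OF f(1) square_integrable_inner_vector[OF square_integrable_test(2)]]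
        frechet_derivative_eq_gradient[OF test_function_differentiable] eq_neg_iff_add_eq_0 mult.commute add.commute)
  finally show ?thesis by (auto simp: vector_test_graph_def)
qed

text \<open>The definition tests the coordinate directions only, while the translation estimate
  differentiates along an arbitrary \<open>z\<close>.\<close>

lemma has_weak_gradient_direction:
  assumes w: "has_weak_gradient S (abs_l2 f) (abs_l2 t)" and f: "square_integrable f" and t: "square_integrable t"
    and \<phi>: "\<phi> \<in> test_functions S"
  shows "(LINT x|lborel. f x * (gradient \<phi> x \<bullet> z)) = - (LINT x|lborel. (t x \<bullet> z) * \<phi> x)"
proof -
  have w': "(LINT x|lborel. f x * (gradient \<phi> x \<bullet> b)) = - (LINT x|lborel. (t x \<bullet> b) * \<phi> x)" if "b \<in> Basis" for b
  proof -
    have "\<forall>\<phi>\<in>test_functions S. \<forall>b\<in>Basis.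
     (LINT x|lborel. f x * frechet_derivative \<phi> (at x) b) = - (LINT x|lborel. (t x \<bullet> b) * \<phi> x)"
      using w t f by (subst (asm) has_weak_gradient.abs_eq) auto
    from bspec[OF bspec[OF this \<phi>] that] show ?thesis
      unfolding frechet_derivative_eq_gradient[OF test_function_differentiable[OF \<phi>]] .
  qed
  have z: "y \<bullet> z = (\<Sum>b\<in>Basis. (z \<bullet> b) * (y \<bullet> b))" for y :: 'a
    by (subst euclidean_inner) (simp add: mult.commute)
  have "(LINT x|lborel. f x * (gradient \<phi> x \<bullet> z)) = (LINT x|lborel. (\<Sum>b\<in>Basis. (z \<bullet> b) * (f x * (gradient \<phi> x \<bullet> b))))"
    unfolding z[of "gradient \<phi> _"] by (simp add: sum_distrib_left mult_ac)
  also have "\<dots> = (\<Sum>b\<in>Basis. (z \<bullet> b) * (LINT x|lborel. f x * (gradient \<phi> x \<bullet> b)))"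
    using square_integrable_inner[OF f square_integrable_inner_vector[OF square_integrable_test(2)[OF \<phi>]]]
    by (subst Bochner_Integration.integral_sum) auto
  also have "\<dots> = - (\<Sum>b\<in>Basis. (z \<bullet> b) * (LINT x|lborel. (t x \<bullet> b) * \<phi> x))"
    by (simp add: w' sum_negf)
  also have "(\<Sum>b\<in>Basis. (z \<bullet> b) * (LINT x|lborel. (t x \<bullet> b) * \<phi> x)) = (LINT x|lborel. (\<Sum>b\<in>Basis. (z \<bullet> b) * ((t x \<bullet> b) * \<phi> x)))"
    using square_integrable_inner[OF square_integrable_inner_vector[OF t] square_integrable_test(1)[OF \<phi>]]
    by (subst Bochner_Integration.integral_sum) auto
  also have "\<dots> = (LINT x|lborel. (t x \<bullet> z) * \<phi> x)"
    unfolding z[of "t _"] sum_distrib_right mult.assoc ..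
  finally show ?thesis .
qed

lemma L2_eq_0_if_test_orthogonal:
  assumes "open S" "u \<in> L2 S" "\<And>\<phi>. \<phi> \<in> test_functions S \<Longrightarrow> u \<bullet> abs_l2 \<phi> = 0"
  shows "u = (0 :: ('a::euclidean_space, real) l2)"
  using l2_bound_by_test_functions[OF assms(1,2), of 0] assms(3) by simp

lemma L2_vector_eq_0_if_test_orthogonal:
  fixes u :: "('a::euclidean_space, 'a) l2"
  assumes S: "open S" and u: "u \<in> L2 S"
    and orth: "\<And>\<phi> b. \<phi> \<in> test_functions S \<Longrightarrow> b \<in> Basis \<Longrightarrow> u \<bullet> abs_l2 (\<lambda>x. \<phi> x *\<^sub>R b) = 0"
  shows "u = 0"
proof -
  obtain f where f: "square_integrable f" "u = abs_l2 f" by (rule l2_cases)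
  have "AE x in lborel. x \<in> S \<longrightarrow> f x \<bullet> b = 0" if b: "b \<in> Basis" for b
  proof (rule test_function_orthogonal_imp_AE_0[OF square_integrable_inner_vector[OF f(1)] S])
    fix \<phi> assume \<phi>: "\<phi> \<in> test_functions S"
    from orth[OF \<phi> b] show "(LINT x|lborel. (f x \<bullet> b) * \<phi> x) = 0"
      by (simp add: f(2) abs_l2_inner[OF f(1) square_integrable_scaleR_vector[OF square_integrable_test(1)[OF \<phi>]]] mult.commute)
  qed
  then have "AE x in lborel. \<forall>b\<in>Basis. x \<in> S \<longrightarrow> f x \<bullet> b = 0" by (intro AE_finite_allI) auto
  moreover have "AE x in lborel. x \<notin> S \<longrightarrow> f x = 0" using u f by (simp add: L2_def abs_l2_vanishes_off)
  ultimately have "AE x in lborel. f x = 0" by eventually_elim (use euclidean_all_zero_iff in blast)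
  then show ?thesis unfolding f(2) abs_l2_zero abs_l2_eq_iff[OF f(1) square_integrable_zero] .
qed

text \<open>Two weak divergences in \<open>L2 S\<close> differ by an element of \<open>L2 S\<close>
  orthogonal to all test functions on the open set \<open>S\<close>, so the description in
  \<open>wdiv\<close> denotes.\<close>

lemma wdiv_eq:
  assumes S: "open S" and d: "d \<in> L2 S" "has_weak_divergence S \<tau> d"
  shows "wdiv S \<tau> = d"
  unfolding wdiv_def
proof (rule the_equality)
  fix d' assume d': "d' \<in> L2 S \<and> has_weak_divergence S \<tau> d'"
  have "d' - d = 0"
  proof (rule L2_eq_0_if_test_orthogonal[OF S])
    show "d' - d \<in> L2 S" using d d' S by (intro subspace_diff L2_subspace) auto
    fix \<phi> assume "\<phi> \<in> test_functions S"
    then have "(abs_l2 (gradient \<phi>), abs_l2 \<phi>) \<in> test_graph S" by (simp add: test_graph_def)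
    then have "(\<tau>, d) \<bullet> (abs_l2 (gradient \<phi>), abs_l2 \<phi>) = 0" "(\<tau>, d') \<bullet> (abs_l2 (gradient \<phi>), abs_l2 \<phi>) = 0"
      using d d' unfolding has_weak_divergence_iff by blast+
    then show "(d' - d) \<bullet> abs_l2 \<phi> = 0" by (simp add: inner_diff_left)
  qed
  then show "d' = d" by simp
qed (use d in auto)

lemma wgrad_eq:
  assumes S: "open S" and g: "g \<in> L2 S" "has_weak_gradient S v g"
  shows "wgrad S v = g"
  unfolding wgrad_def
proof (rule the_equality)
  fix g' assume g': "g' \<in> L2 S \<and> has_weak_gradient S v g'"
  have "g' - g = 0"
  proof (rule L2_vector_eq_0_if_test_orthogonal[OF S])
    show "g' - g \<in> L2 S" using g g' S by (intro subspace_diff L2_subspace) auto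
    fix \<phi> and b :: 'a assume "\<phi> \<in> test_functions S" "b \<in> Basis"
    then have "(abs_l2 (\<lambda>x. \<phi> x *\<^sub>R b), abs_l2 (\<lambda>x. gradient \<phi> x \<bullet> b)) \<in> vector_test_graph S"
      by (auto simp: vector_test_graph_def intro!: image_eqI[of _ _ "(\<phi>, b)"])
    then have "(g, v) \<bullet> (abs_l2 (\<lambda>x. \<phi> x *\<^sub>R b), abs_l2 (\<lambda>x. gradient \<phi> x \<bullet> b)) = 0"
      "(g', v) \<bullet> (abs_l2 (\<lambda>x. \<phi> x *\<^sub>R b), abs_l2 (\<lambda>x. gradient \<phi> x \<bullet> b)) = 0"
      using g g' unfolding has_weak_gradient_iff by blast+
    then show "(g' - g) \<bullet> abs_l2 (\<lambda>x. \<phi> x *\<^sub>R b) = 0" by (simp add: inner_diff_left)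
  qed
  then show "g' = g" by simp
qed (use g in auto)

lemma mem_div_graph:
  assumes S: "open S"
  shows "(\<tau>, d) \<in> div_graph S \<longleftrightarrow> \<tau> \<in> L2 S \<and> d \<in> L2 S \<and> has_weak_divergence S \<tau> d"
proof -
  have "(\<tau>, d) \<in> div_graph S \<longleftrightarrow> \<tau> \<in> L2 S \<and> d = wdiv S \<tau> \<and> (\<exists>d'\<in>L2 S. has_weak_divergence S \<tau> d')"
    by (auto simp: div_graph_def Hdiv_def)
  also have "\<dots> \<longleftrightarrow> \<tau> \<in> L2 S \<and> d \<in> L2 S \<and> has_weak_divergence S \<tau> d"
    using wdiv_eq[OF S] by metis
  finally show ?thesis .
qed

lemma mem_grad_graph:
  assumes S: "open S"
  shows "(g, v) \<in> grad_graph S \<longleftrightarrow> g \<in> L2 S \<and> v \<in> L2 S \<and> has_weak_gradient S v g"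
proof -
  have "(g, v) \<in> grad_graph S \<longleftrightarrow> v \<in> L2 S \<and> g = wgrad S v \<and> (\<exists>g'\<in>L2 S. has_weak_gradient S v g')"
    by (auto simp: grad_graph_def H1_def)
  also have "\<dots> \<longleftrightarrow> g \<in> L2 S \<and> v \<in> L2 S \<and> has_weak_gradient S v g"
    using wgrad_eq[OF S] by metis
  finally show ?thesis .
qed

text \<open>As an intersection of closed subspaces the graph is seen at once to be a closed subspace
  itself.\<close>

lemma div_graph_alt:
  assumes S: "open S"
  shows "div_graph S = (L2 S \<times> L2 S) \<inter> {x. \<forall>y\<in>test_graph S. x \<bullet> y = 0}"
proof (rule set_eqI)
  fix x :: "('a, 'a) l2 \<times> ('a, real) l2"
  obtain \<tau> d where x: "x = (\<tau>, d)" by (cases x)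
  show "x \<in> div_graph S \<longleftrightarrow> x \<in> (L2 S \<times> L2 S) \<inter> {x. \<forall>y\<in>test_graph S. x \<bullet> y = 0}"
    unfolding x mem_div_graph[OF S] has_weak_divergence_iff by blast
qed

lemma grad_graph_alt:
  assumes S: "open S"
  shows "grad_graph S = (L2 S \<times> L2 S) \<inter> {x. \<forall>y\<in>vector_test_graph S. x \<bullet> y = 0}"
proof (rule set_eqI)
  fix x :: "('a, 'a) l2 \<times> ('a, real) l2"
  obtain g v where x: "x = (g, v)" by (cases x)
  show "x \<in> grad_graph S \<longleftrightarrow> x \<in> (L2 S \<times> L2 S) \<inter> {x. \<forall>y\<in>vector_test_graph S. x \<bullet> y = 0}"
    unfolding x mem_grad_graph[OF S] has_weak_gradient_iff by blast
qed

lemma subspace_orthogonal_comp: "subspace {x::'a::real_inner. \<forall>y\<in>N. x \<bullet> y = 0}"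
  by (rule subspaceI) (auto simp: inner_add_left)

lemma
  assumes S: "open S"
  shows div_graph_subspace: "subspace (div_graph S)" and div_graph_closed: "closed (div_graph S)"
proof -
  have Sb: "S \<in> sets borel" using S by simp
  show "subspace (div_graph S)"
    unfolding div_graph_alt[OF S]
    by (rule subspace_inter[OF subspace_Times[OF L2_subspace[OF Sb] L2_subspace[OF Sb]] subspace_orthogonal_comp])
  show "closed (div_graph S)"
    unfolding div_graph_alt[OF S]
    by (rule closed_Int[OF closed_Times[OF L2_closed[OF Sb] L2_closed[OF Sb]] closed_orthogonal_comp])
qed

lemma
  assumes S: "open S"
  shows grad_graph_subspace: "subspace (grad_graph S)" and grad_graph_closed: "closed (grad_graph S)"
proof -
  have Sb: "S \<in> sets borel" using S by simp
  show "subspace (grad_graph S)"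
    unfolding grad_graph_alt[OF S]
    by (rule subspace_inter[OF subspace_Times[OF L2_subspace[OF Sb] L2_subspace[OF Sb]] subspace_orthogonal_comp])
  show "closed (grad_graph S)"
    unfolding grad_graph_alt[OF S]
    by (rule closed_Int[OF closed_Times[OF L2_closed[OF Sb] L2_closed[OF Sb]] closed_orthogonal_comp])
qed

lemma test_graph_subset: 
  assumes S: "open S" shows "test_graph S \<subseteq> grad_graph S"
proof
  fix x assume "x \<in> test_graph S"
  then obtain \<phi> where \<phi>: "\<phi> \<in> test_functions S" and x: "x = (abs_l2 (gradient \<phi>), abs_l2 \<phi>)"
    by (auto simp: test_graph_def)
  have "has_weak_gradient S (abs_l2 \<phi>) (abs_l2 (gradient \<phi>))"
    using test_functions_integration_by_parts[OF \<phi>]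
    by (subst has_weak_gradient.abs_eq)
      (auto simp: square_integrable_test[OF \<phi>] frechet_derivative_eq_gradient[OF test_function_differentiable])
  then show "x \<in> grad_graph S" using test_in_L2[OF \<phi>] unfolding x by (simp add: mem_grad_graph[OF S])
qed

lemma subspace_test_graph: "subspace (test_graph S)"
  unfolding test_graph_def
proof (rule subspaceI)
  have "gradient (\<lambda>x. 0) = (\<lambda>x::'a. 0)" by (auto simp: gradient_def frechet_derivative_const)
  then show "0 \<in> (\<lambda>\<phi>. (abs_l2 (gradient \<phi>), abs_l2 \<phi>)) ` test_functions S"
    by (intro image_eqI[OF _ test_functions_zero]) (simp add: zero_prod_def abs_l2_zero)
  fix x y :: "('a, 'a) l2 \<times> ('a, real) l2" and c :: real
  assume "x \<in> (\<lambda>\<phi>. (abs_l2 (gradient \<phi>), abs_l2 \<phi>)) ` test_functions S"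
  then obtain \<phi> where \<phi>: "\<phi> \<in> test_functions S" and x: "x = (abs_l2 (gradient \<phi>), abs_l2 \<phi>)" by auto
  note df = test_function_differentiable[OF \<phi>]
  have "gradient (\<lambda>x. c * \<phi> x) = (\<lambda>x. c *\<^sub>R gradient \<phi> x)" by (rule ext) (rule gradient_scale[OF df])
  then show "c *\<^sub>R x \<in> (\<lambda>\<phi>. (abs_l2 (gradient \<phi>), abs_l2 \<phi>)) ` test_functions S"
    by (intro image_eqI[OF _ test_functions_scale[OF \<phi>, of c]])
      (simp add: x abs_l2_scaleR square_integrable_test[OF \<phi>])
  assume "y \<in> (\<lambda>\<phi>. (abs_l2 (gradient \<phi>), abs_l2 \<phi>)) ` test_functions S"
  then obtain \<psi> where \<psi>: "\<psi> \<in> test_functions S" and y: "y = (abs_l2 (gradient \<psi>), abs_l2 \<psi>)" by auto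
  have "gradient (\<lambda>x. \<phi> x + \<psi> x) = (\<lambda>x. gradient \<phi> x + gradient \<psi> x)"
    by (rule ext) (rule gradient_add[OF df test_function_differentiable[OF \<psi>]])
  then show "x + y \<in> (\<lambda>\<phi>. (abs_l2 (gradient \<phi>), abs_l2 \<phi>)) ` test_functions S"
    by (intro image_eqI[OF _ test_functions_add[OF \<phi> \<psi>]])
      (simp add: x y abs_l2_add square_integrable_test[OF \<phi>] square_integrable_test[OF \<psi>])
qed

section \<open>Boundary conditions as orthogonal complements\<close>

lemma H1_D: "v \<in> H1 S \<Longrightarrow> (wgrad S v, v) \<in> grad_graph S"
  by (simp add: grad_graph_def)

lemma norm_H1_diff_test:
  assumes S: "open S" and x: "(wgrad S v, v) \<in> grad_graph S" and \<phi>: "\<phi> \<in> test_functions S"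
  shows "norm_H1 S (v - abs_l2 \<phi>) = dist (abs_l2 (gradient \<phi>), abs_l2 \<phi>) (wgrad S v, v)"
proof -
  have "(abs_l2 (gradient \<phi>), abs_l2 \<phi>) \<in> grad_graph S"
    using test_graph_subset[OF S] \<phi> by (auto simp: test_graph_def)
  from subspace_diff[OF grad_graph_subspace[OF S] x this]
  have "wgrad S (v - abs_l2 \<phi>) = wgrad S v - abs_l2 (gradient \<phi>)"
    using wgrad_eq[OF S] by (simp add: mem_grad_graph[OF S])
  then show ?thesis by (simp add: norm_H1_def dist_norm norm_Pair norm_minus_commute add.commute)
qed

text \<open>\<open>norm_H1\<close> is the norm of the pair, so the approximation in the definition
  of \<open>H10\<close> is closure in the space of pairs.\<close>

lemma grad_graph0_eq:
  assumes S: "open S"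
  shows "grad_graph0 S = closure (test_graph S)"
proof (intro set_eqI iffI)
  fix x assume "x \<in> grad_graph0 S"
  then obtain v where v: "v \<in> H10 S" and x: "x = (wgrad S v, v)" by (auto simp: grad_graph0_def)
  then have g: "(wgrad S v, v) \<in> grad_graph S" by (auto simp: H10_def H1_D)
  show "x \<in> closure (test_graph S)"
    unfolding closure_approachable x
  proof (intro allI impI)
    fix e :: real assume "0 < e"
    then obtain \<phi> where "\<phi> \<in> test_functions S" "norm_H1 S (v - abs_l2 \<phi>) < e" using v by (auto simp: H10_def)
    then show "\<exists>y\<in>test_graph S. dist y (wgrad S v, v) < e"
      using norm_H1_diff_test[OF S g] by (auto simp: test_graph_def)
  qed
next
  fix x assume x: "x \<in> closure (test_graph S)"
  then have "x \<in> grad_graph S"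
    using closure_minimal[OF test_graph_subset[OF S] grad_graph_closed[OF S]] by blast
  then obtain v where v: "v \<in> H1 S" and xv: "x = (wgrad S v, v)" by (auto simp: grad_graph_def)
  have "v \<in> H10 S"
    unfolding H10_def
  proof (intro CollectI conjI v allI impI)
    fix e :: real assume "0 < e"
    then obtain y where "y \<in> test_graph S" "dist y x < e" using x by (auto simp: closure_approachable)
    then show "\<exists>\<phi>\<in>test_functions S. norm_H1 S (v - abs_l2 \<phi>) < e"
      using norm_H1_diff_test[OF S H1_D[OF v]] by (auto simp: test_graph_def xv)
  qed
  then show "x \<in> grad_graph0 S" by (simp add: grad_graph0_def xv)
qed

lemma div_graph0_eq: "div_graph0 S = {x \<in> div_graph S. \<forall>y\<in>grad_graph S. x \<bullet> y = 0}"
proof -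
  have "normal_trace S \<tau> = 0 \<longleftrightarrow> (\<forall>y\<in>grad_graph S. (\<tau>, wdiv S \<tau>) \<bullet> y = 0)" for \<tau>
    by (auto simp: normal_trace_def fun_eq_iff grad_graph_def add.commute)
  then show ?thesis by (auto simp: div_graph0_def div_graph_def Hdiv0_def)
qed

lemma div_grad0_orthogonal:
  assumes "open S" "x \<in> div_graph S" "y \<in> grad_graph0 S"
  shows "x \<bullet> y = 0"
proof (rule orthogonal_closure)
  show "y \<in> closure (test_graph S)" using assms(3) unfolding grad_graph0_eq[OF assms(1)] .
qed (use assms(2) in \<open>auto simp: div_graph_alt[OF assms(1)]\<close>)

text \<open>By double orthogonality it suffices to pair \<open>x\<close> with a \<open>y\<close>
  orthogonal to the test graph. Cut down to \<open>S\<close>, which changes no pairing involved,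
  such a \<open>y\<close> is a field with its weak divergence, and \<open>x\<close> is orthogonal to
  it.\<close>

lemma grad_graph0_if_orthogonal:
  assumes S: "open S" and x: "x \<in> L2 S \<times> L2 S" and orth: "\<And>y. y \<in> div_graph S \<Longrightarrow> x \<bullet> y = 0"
  shows "x \<in> grad_graph0 S"
  unfolding grad_graph0_eq[OF S]
proof (rule in_closure_if_double_orthogonal[OF subspace_test_graph])
  fix y assume y: "\<forall>z\<in>test_graph S. y \<bullet> z = 0"
  have Sb: "S \<in> sets borel" using S by simp
  obtain y1 y2 where y12: "y = (y1, y2)" by (cases y)
  have "(restrict_l2 S y1, restrict_l2 S y2) \<in> div_graph S"
    unfolding div_graph_alt[OF S]
  proof (intro IntI SigmaI restrict_l2_in_L2[OF Sb] CollectI ballI)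
    fix z assume z: "z \<in> test_graph S"
    obtain z1 z2 where z12: "z = (z1, z2)" by (cases z)
    have "z1 \<in> L2 S" "z2 \<in> L2 S" using z test_in_L2 by (auto simp: test_graph_def z12)
    then show "(restrict_l2 S y1, restrict_l2 S y2) \<bullet> z = 0"
      using bspec[OF y z] by (simp add: z12 y12 restrict_l2_inner[OF Sb] restrict_l2_eq_iff[OF Sb, THEN iffD2])
  qed
  from orth[OF this] show "x \<bullet> y = 0"
    using x by (auto simp: y12 L2_inner_restrict[OF Sb])
qed

text \<open>Orthogonality to the graph of the test functions gives the weak divergence;
  orthogonality to the whole graph of the gradient gives the vanishing normal trace.\<close>

lemma div_graph0_if_orthogonal:
  assumes S: "open S" and x: "x \<in> L2 S \<times> L2 S" and orth: "\<And>y. y \<in> grad_graph S \<Longrightarrow> x \<bullet> y = 0"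
  shows "x \<in> div_graph0 S"
  proof -
  have "\<forall>y\<in>test_graph S. x \<bullet> y = 0" using orth test_graph_subset[OF S] by blast
  then show ?thesis unfolding div_graph0_eq div_graph_alt[OF S] using x orth by simp
qed

section \<open>Estimates for the conforming first-order system\<close>

lemma poincare_grad_graph0:
  fixes \<Omega> :: "'a::euclidean_space set"
  assumes "open \<Omega>" "bounded \<Omega>"
  shows "\<exists>C\<ge>0. \<forall>x\<in>grad_graph0 \<Omega>. norm (snd x) \<le> C * norm (fst x)"
proof -
  obtain C where C: "0 \<le> C" "\<And>\<phi>. \<phi> \<in> test_functions \<Omega> \<Longrightarrow> norm (abs_l2 \<phi>) \<le> C * norm (abs_l2 (gradient \<phi>))"
    using poincare_test_functions[OF assms(2)] by blast
  have "closed {x::('a, 'a) l2 \<times> ('a, real) l2. norm (snd x) \<le> C * norm (fst x)}"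
    by (intro closed_Collect_le continuous_intros)
  then have "closure (test_graph \<Omega>) \<subseteq> {x. norm (snd x) \<le> C * norm (fst x)}"
    using C(2) by (intro closure_minimal) (auto simp: test_graph_def)
  then show ?thesis using C(1) grad_graph0_eq[OF assms(1)] by blast
qed

text \<open>Since \<open>d = div \<tau>\<close>, the terms \<open>\<parallel>\<tau>\<parallel> + \<parallel>d - v\<parallel>\<close> bound the \<open>H\<^sup>-\<^sup>1\<close> norm of \<open>v\<close>.\<close>

lemma grad_graph_norm_bound:
  fixes \<Omega> :: "'a::euclidean_space set"
  assumes \<Omega>: "lipschitz_domain \<Omega>" "bounded \<Omega>"
  shows "\<exists>C\<ge>0. \<forall>g v \<tau> d. (g, v) \<in> grad_graph \<Omega> \<longrightarrow> (\<tau>, d) \<in> div_graph \<Omega> \<longrightarrow>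
    norm v \<le> C * (norm g + norm \<tau> + norm (d - v))"
proof -
  have o: "open \<Omega>" using \<Omega>(1) unfolding lipschitz_domain_def by blast
  obtain C where C: "0 \<le> C"
    "\<And>p g N. 0 \<le> N \<Longrightarrow> weakly_bounded \<Omega> p g N \<Longrightarrow> norm (restrict_l2 \<Omega> (abs_l2 p)) \<le> C * (norm (abs_l2 g) + N)"
    using controlled_on_lipschitz_domain[OF \<Omega>] unfolding controlled_on_def by metis
  have "norm v \<le> C * (norm g + norm \<tau> + norm (d - v))"
    if gv: "(g, v) \<in> grad_graph \<Omega>" and td: "(\<tau>, d) \<in> div_graph \<Omega>" for g v \<tau> d
  proof -
    define N where "N = norm \<tau> + norm (d - v)"
    obtain p where p: "square_integrable p" "v = abs_l2 p" by (rule l2_cases)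
    obtain q where q: "square_integrable q" "g = abs_l2 q" by (rule l2_cases)
    have gv': "v \<in> L2 \<Omega>" "has_weak_gradient \<Omega> v g" using gv by (auto simp: mem_grad_graph[OF o])
    have "weakly_bounded \<Omega> p q N"
      unfolding weakly_bounded_def
    proof (intro conjI p q ballI allI)
      show "(LINT x|lborel. p x * (gradient \<phi> x \<bullet> z)) = - (LINT x|lborel. (q x \<bullet> z) * \<phi> x)"
        if "\<phi> \<in> test_functions \<Omega>" for \<phi> z
        using gv'(2) p q that by (intro has_weak_gradient_direction) auto
      fix \<phi> assume \<phi>: "\<phi> \<in> test_functions \<Omega>"
      then have "(\<tau>, d) \<bullet> (abs_l2 (gradient \<phi>), abs_l2 \<phi>) = 0"
        using td by (auto simp: div_graph_alt[OF o] test_graph_def)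
      \<comment> \<open>Write \<open>v = d - (d - v)\<close> and move the divergence onto
        \<phi>.\<close>
      then have "v \<bullet> abs_l2 \<phi> = - (\<tau> \<bullet> abs_l2 (gradient \<phi>)) - (d - v) \<bullet> abs_l2 \<phi>"
        by (simp add: inner_diff_left)
      then have "\<bar>v \<bullet> abs_l2 \<phi>\<bar> \<le> norm \<tau> * norm (abs_l2 (gradient \<phi>)) + norm (d - v) * norm (abs_l2 \<phi>)"
        using Cauchy_Schwarz_ineq2[of \<tau> "abs_l2 (gradient \<phi>)"] Cauchy_Schwarz_ineq2[of "d - v" "abs_l2 \<phi>"] by linarith
      also have "\<dots> \<le> N * (norm (abs_l2 \<phi>) + norm (abs_l2 (gradient \<phi>)))"
      proof -
        have "0 \<le> norm \<tau> * norm (abs_l2 \<phi>)" "0 \<le> norm (d - v) * norm (abs_l2 (gradient \<phi>))" by simp_all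
        then show ?thesis by (simp add: N_def algebra_simps)
      qed
      also have "v \<bullet> abs_l2 \<phi> = (LINT x|lborel. p x * \<phi> x)"
        by (simp add: p(2) abs_l2_inner[OF p(1) square_integrable_test(1)[OF \<phi>]])
      finally show "\<bar>LINT x|lborel. p x * \<phi> x\<bar> \<le> N * (norm (abs_l2 \<phi>) + norm (abs_l2 (gradient \<phi>)))" .
    qed
    moreover have "0 \<le> N" by (simp add: N_def)
    moreover have "restrict_l2 \<Omega> v = v" using o gv'(1) by (simp add: restrict_l2_eq_iff)
    ultimately show ?thesis using C(2)[of N p q] by (simp add: p q N_def add.assoc)
  qed
  then show ?thesis using C(1) by blast
qed

text \<open>Stability of the conforming first-order system: the \<open>P\<^sub>i\<close> are pairs of a field and its divergence, or of
  a gradient and its potential, that represent the trace variables.\<close>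

definition stability_constant :: "'a::euclidean_space set \<Rightarrow> real \<Rightarrow> bool" where
  "stability_constant \<Omega> C \<longleftrightarrow> 0 < C \<and>
    (\<forall>P1\<in>div_graph0 \<Omega>. \<forall>P2\<in>grad_graph0 \<Omega>. \<forall>P3\<in>div_graph \<Omega>. \<forall>P4\<in>grad_graph \<Omega>. \<forall>u1 u2 u3 u4 F.
      norm (P4 + (u1, - u4)) \<le> F \<longrightarrow> norm (P3 - (u3, u4)) \<le> F \<longrightarrow> norm (P2 - (u3, u2)) \<le> F \<longrightarrow> norm (P1 - (u1, u2)) \<le> F \<longrightarrow>
      norm u1 \<le> C * F \<and> norm u2 \<le> C * F \<and> norm u3 \<le> C * F \<and> norm u4 \<le> C * F \<and>
      norm P1 \<le> C * F \<and> norm P2 \<le> C * F \<and> norm P3 \<le> C * F \<and> norm P4 \<le> C * F)"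

text \<open>Eliminating the \<open>u\<close> components leaves four residuals for the
  representatives alone. Everything is then bounded through the norms \<open>a\<close> of
  \<open>t1\<close> and \<open>b\<close> of \<open>g2\<close>, and the energy identity becomes a
  quadratic inequality for \<open>a + b\<close>.\<close>

lemma stability_constant_exists:
  fixes \<Omega> :: "'a::euclidean_space set"
  assumes \<Omega>: "lipschitz_domain \<Omega>" "bounded \<Omega>"
  shows "\<exists>C. stability_constant \<Omega> C"
proof -
  have o: "open \<Omega>" using \<Omega>(1) unfolding lipschitz_domain_def by blast
  obtain c where c: "0 \<le> c" "\<And>x. x \<in> grad_graph0 \<Omega> \<Longrightarrow> norm (snd x) \<le> c * norm (fst x)"
    using poincare_grad_graph0[OF o \<Omega>(2)] by blast
  obtain l where l: "0 \<le> l" "\<And>g v \<tau> d. (g, v) \<in> grad_graph \<Omega> \<Longrightarrow> (\<tau>, d) \<in> div_graph \<Omega> \<Longrightarrow>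
    norm v \<le> l * (norm g + norm \<tau> + norm (d - v))"
    using grad_graph_norm_bound[OF \<Omega>] by blast
  \<comment> \<open>Read off from the quadratic inequality for \<open>a + b\<close> in the case
    distinction below.\<close>
  define S where "S = 4 * (1 + c + l) + 24 * l + 1"
  define C where "C = S + c * S + l * (S + 6) + 6"
  have S: "1 \<le> S" using c l by (simp add: S_def)
  have C: "S + 3 \<le> C" "c * S + 3 \<le> C" "l * (S + 6) + 3 \<le> C"
  proof -
    have "0 \<le> c * S" "0 \<le> l * (S + 6)" using c l S by auto
    then show "S + 3 \<le> C" "c * S + 3 \<le> C" "l * (S + 6) + 3 \<le> C" using S by (auto simp: C_def)
  qed
  \<comment> \<open>\<open>C\<close> bounds the components of the representatives; the factor 2 pays
    for recombining them into pairs and for passing on to the \<open>u\<close> components.\<close>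
  have "norm u1 \<le> 2 * C * F \<and> norm u2 \<le> 2 * C * F \<and> norm u3 \<le> 2 * C * F \<and> norm u4 \<le> 2 * C * F \<and>
    norm P1 \<le> 2 * C * F \<and> norm P2 \<le> 2 * C * F \<and> norm P3 \<le> 2 * C * F \<and> norm P4 \<le> 2 * C * F"
    if P: "P1 \<in> div_graph0 \<Omega>" "P2 \<in> grad_graph0 \<Omega>" "P3 \<in> div_graph \<Omega>" "P4 \<in> grad_graph \<Omega>"
      and R: "norm (P4 + (u1, - u4)) \<le> F" "norm (P3 - (u3, u4)) \<le> F" "norm (P2 - (u3, u2)) \<le> F" "norm (P1 - (u1, u2)) \<le> F"
    for P1 P2 P3 P4 u1 u2 u3 u4 F
  proof -
    obtain t1 d1 where P1: "P1 = (t1, d1)" by (cases P1)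
    obtain g2 w2 where P2: "P2 = (g2, w2)" by (cases P2)
    obtain t3 d3 where P3: "P3 = (t3, d3)" by (cases P3)
    obtain g4 w4 where P4: "P4 = (g4, w4)" by (cases P4)
    have F: "0 \<le> F" using R(1) norm_ge_zero order_trans by blast
    have comp: "norm x \<le> F" "norm y \<le> F" if "norm (x, y) \<le> F" for x :: "('a, 'a) l2" and y :: "('a, real) l2"
      using that norm_fst_le[of x y] norm_snd_le[of y x] by linarith+
    have r: "norm (g4 + u1) \<le> F" "norm (w4 - u4) \<le> F" "norm (t3 - u3) \<le> F" "norm (d3 - u4) \<le> F"
      "norm (g2 - u3) \<le> F" "norm (w2 - u2) \<le> F" "norm (t1 - u1) \<le> F" "norm (d1 - u2) \<le> F"
      using R comp by (auto simp: P1 P2 P3 P4)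
    \<comment> \<open>Each \<open>u\<close> component occurs in exactly two of the eight bounds
      \<open>r\<close>, so it cancels at the price of \<open>2 * F\<close>.\<close>
    define f1 where "f1 = t1 + g4"
    define f2 where "f2 = d3 - w4"
    define f3 where "f3 = g2 - t3"
    define f4 where "f4 = d1 - w2"
    have f1: "norm f1 \<le> 2 * F" using norm_triangle_mono[OF r(1) r(7)] by (simp add: f1_def algebra_simps)
    have f2: "norm f2 \<le> 2 * F"
      using norm_diff_triangle_le[of "d3" u4 F w4 F] r by (simp add: f2_def norm_minus_commute)
    have f3: "norm f3 \<le> 2 * F"
      using norm_diff_triangle_le[of "g2" u3 F t3 F] r by (simp add: f3_def norm_minus_commute)
    have f4: "norm f4 \<le> 2 * F"
      using norm_diff_triangle_le[of "d1" u2 F w2 F] r by (simp add: f4_def norm_minus_commute)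
    \<comment> \<open>Green's formula without boundary terms, twice: the normal trace of
      \<open>P1\<close> vanishes, and so does the trace of \<open>P2\<close>.\<close>
    have o1: "t1 \<bullet> g4 + d1 \<bullet> w4 = 0" using P by (auto simp: div_graph0_eq P1 P4)
    have o2: "t3 \<bullet> g2 + d3 \<bullet> w2 = 0" using div_grad0_orthogonal[OF o P(3) P(2)] by (simp add: P3 P2)
    define a where "a = norm t1"
    define b where "b = norm g2"
    have ab: "0 \<le> a" "0 \<le> b" by (auto simp: a_def b_def)
    have w2: "norm w2 \<le> c * b" using c(2)[OF P(2)] by (simp add: P2 b_def)
    have g4: "norm g4 \<le> a + 2 * F" using norm_triangle_ineq4[of f1 t1] f1 by (simp add: f1_def a_def)
    have t3: "norm t3 \<le> b + 2 * F" using norm_triangle_ineq4[of g2 f3] f3 by (simp add: f3_def b_def)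
    have w4: "norm w4 \<le> l * (a + b + 6 * F)"
    proof -
      have "norm w4 \<le> l * (norm g4 + norm t3 + norm f2)" using l(2) P by (auto simp: P3 P4 f2_def)
      also have "\<dots> \<le> l * (a + b + 6 * F)" using g4 t3 f2 l(1) by (intro mult_left_mono) auto
      finally show ?thesis .
    qed
    have "t1 \<bullet> t1 + g2 \<bullet> g2 = f1 \<bullet> t1 + g2 \<bullet> f3 - w2 \<bullet> f2 + w4 \<bullet> f4"
      using o1 o2 by (simp add: f1_def f2_def f3_def f4_def inner_simps inner_commute)
    then have "a\<^sup>2 + b\<^sup>2 = f1 \<bullet> t1 + g2 \<bullet> f3 - w2 \<bullet> f2 + w4 \<bullet> f4"
      by (simp add: a_def b_def power2_norm_eq_inner)
    also have "\<dots> \<le> norm f1 * a + b * norm f3 + norm w2 * norm f2 + norm w4 * norm f4"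
      using norm_cauchy_schwarz[of f1 t1] norm_cauchy_schwarz[of g2 f3] Cauchy_Schwarz_ineq2[of w2 f2] norm_cauchy_schwarz[of w4 f4]
      by (simp add: a_def b_def)
    also have "\<dots> \<le> 2 * F * a + b * (2 * F) + c * b * (2 * F) + l * (a + b + 6 * F) * (2 * F)"
      using f1 f2 f3 f4 w2 w4 ab c(1) l(1) F by (intro add_mono mult_mono) auto
    finally have en: "a\<^sup>2 + b\<^sup>2 \<le> 2 * F * a + b * (2 * F) + c * b * (2 * F) + l * (a + b + 6 * F) * (2 * F)" .
    \<comment> \<open>If \<open>a + b\<close> exceeds \<open>F\<close>, the term with
      \<open>F * F\<close> is at most the same multiple of \<open>F * (a + b)\<close>, and one
      factor \<open>a + b\<close> can be divided out.\<close>
    have sum: "a + b \<le> S * F"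
    proof (cases "a + b \<le> F")
      case True
      also have "F \<le> S * F" using S F by (simp add: mult_le_cancel_right1)
      finally show ?thesis .
    next
      case False
      have "(a + b)\<^sup>2 \<le> 2 * (a\<^sup>2 + b\<^sup>2)" using sum_squares_bound[of a b] by (simp add: power2_sum)
      also have "\<dots> \<le> 4 * (1 + c + l) * F * (a + b) + 24 * l * F * F"
      proof -
        have "0 \<le> c * a * F" using ab c F by simp
        then show ?thesis using en by (simp add: algebra_simps)
      qed
      also have "\<dots> \<le> 4 * (1 + c + l) * F * (a + b) + 24 * l * F * (a + b)"
        using False l F by (intro add_left_mono mult_left_mono) auto
      also have "\<dots> \<le> S * F * (a + b)" using F ab by (simp add: S_def algebra_simps)
      finally have "(a + b) * (a + b) \<le> S * F * (a + b)" by (simp add: power2_eq_square)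
      then show ?thesis using False F by (simp add: mult_le_cancel_right)
    qed
    have le_C: "x \<le> C * F" if "x \<le> k * F + m * F" "m \<le> 3" "k + 3 \<le> C" for x k m
    proof -
      have "k * F + m * F = (k + m) * F" by (simp add: distrib_right)
      also have "\<dots> \<le> C * F" using that F by (intro mult_right_mono) auto
      finally show ?thesis using that by simp
    qed
    have "b \<le> S * F" "a \<le> S * F" using sum ab by auto
    have "c * b \<le> c * (S * F)" using \<open>b \<le> S * F\<close> c(1) by (rule mult_left_mono)
    then have w2': "norm w2 \<le> c * S * F" using w2 by simp
    have "l * (a + b + 6 * F) \<le> l * (S * F + 6 * F)" using sum l(1) by (intro mult_left_mono) auto
    then have w4': "norm w4 \<le> l * (S + 6) * F" using w4 by (simp add: algebra_simps)
    have d3: "norm d3 \<le> l * (S + 6) * F + 2 * F"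
      using norm_triangle_ineq[of w4 f2] w4' f2 by (simp add: f2_def)
    have d1: "norm d1 \<le> c * S * F + 2 * F"
      using norm_triangle_ineq[of w2 f4] w2' f4 by (simp add: f4_def)
    have nt1: "norm t1 \<le> C * F" using le_C[of _ S 0] \<open>a \<le> S * F\<close> C by (simp add: a_def)
    have ng2: "norm g2 \<le> C * F" using le_C[of _ S 0] \<open>b \<le> S * F\<close> C by (simp add: b_def)
    have nt3: "norm t3 \<le> C * F" using le_C[of _ S 2] \<open>b \<le> S * F\<close> t3 C by simp
    have ng4: "norm g4 \<le> C * F" using le_C[of _ S 2] \<open>a \<le> S * F\<close> g4 C by simp
    have nw2: "norm w2 \<le> C * F" using le_C[of _ "c * S" 0] w2' C by simp
    have nw4: "norm w4 \<le> C * F" using le_C[of _ "l * (S + 6)" 0] w4' C by simp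
    have nd1: "norm d1 \<le> C * F" using le_C[OF d1] C by simp
    have nd3: "norm d3 \<le> C * F" using le_C[OF d3] C by simp
    have "F \<le> C * F" using C S F by (simp add: mult_le_cancel_right1)
    have u: "norm u1 \<le> 2 * C * F" "norm u2 \<le> 2 * C * F" "norm u3 \<le> 2 * C * F" "norm u4 \<le> 2 * C * F"
      using norm_triangle_ineq4[of t1 "t1 - u1"] norm_triangle_ineq4[of d1 "d1 - u2"]
        norm_triangle_ineq4[of t3 "t3 - u3"] norm_triangle_ineq4[of d3 "d3 - u4"] r nt1 nd1 nt3 nd3 \<open>F \<le> C * F\<close>
      by auto
    have pair: "norm (x, y) \<le> 2 * C * F" if "norm x \<le> C * F" "norm y \<le> C * F" for x :: "('a, 'a) l2" and y :: "('a, real) l2"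
      using norm_Pair_le[of x y] that by simp
    show ?thesis
      using u pair nt1 nd1 ng2 nw2 nt3 nd3 ng4 nw4 by (simp add: P1 P2 P3 P4)
  qed
  moreover have "0 < 2 * C" using C S by simp
  ultimately show ?thesis unfolding stability_constant_def by blast
qed

section \<open>Broken spaces and traces\<close>

definition restrict_pair ::
  "'a::euclidean_space set \<Rightarrow> ('a, 'a) l2 \<times> ('a, real) l2 \<Rightarrow> ('a, 'a) l2 \<times> ('a, real) l2" where
  "restrict_pair S x = (restrict_l2 S (fst x), restrict_l2 S (snd x))"

definition glue_div ::
  "'a::euclidean_space set set \<Rightarrow> ('a set \<Rightarrow> ('a, 'a) l2) \<Rightarrow> ('a, 'a) l2 \<times> ('a, real) l2" where
  "glue_div M \<tau> = (\<Sum>T\<in>M. \<tau> T, \<Sum>T\<in>M. wdiv T (\<tau> T))"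

definition glue_grad ::
  "'a::euclidean_space set set \<Rightarrow> ('a set \<Rightarrow> ('a, real) l2) \<Rightarrow> ('a, 'a) l2 \<times> ('a, real) l2" where
  "glue_grad M v = (\<Sum>T\<in>M. wgrad T (v T), \<Sum>T\<in>M. v T)"

lemma L2_disjoint_orthogonal:
  assumes "u \<in> L2 S" "v \<in> L2 T" "disjnt S T"
  shows "u \<bullet> v = 0"
proof -
  obtain f where f: "square_integrable f" "u = abs_l2 f" by (rule l2_cases)
  obtain g where g: "square_integrable g" "v = abs_l2 g" by (rule l2_cases)
  have "AE x in lborel. x \<notin> S \<longrightarrow> f x = 0" "AE x in lborel. x \<notin> T \<longrightarrow> g x = 0"
    using assms f g by (auto simp: L2_def abs_l2_vanishes_off)
  then have "AE x in lborel. f x \<bullet> g x = 0"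
    by eventually_elim (use assms(3) in \<open>force simp: disjnt_def\<close>)
  then have "(LINT x|lborel. f x \<bullet> g x) = 0" by (rule integral_eq_zero_AE)
  then show ?thesis by (simp add: f(2) g(2) abs_l2_inner[OF f(1) g(1)])
qed

lemma restrict_pair_inner:
  "S \<in> sets borel \<Longrightarrow> restrict_pair S x \<bullet> y = x \<bullet> restrict_pair S y"
  by (cases x; cases y) (simp add: restrict_pair_def restrict_l2_inner)

lemma restrict_pair_linear:
  assumes "S \<in> sets borel"
  shows "linear (restrict_pair S)"
  by (rule linearI)
    (auto simp: restrict_pair_def restrict_l2_add[OF assms] restrict_l2_scaleR[OF assms] plus_prod_def scaleR_prod_def)

lemma restrict_pair_continuous:
  assumes "S \<in> sets borel"
  shows "continuous_on UNIV (restrict_pair S)"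
proof -
  have "bounded_linear (restrict_pair S)"
  proof (rule bounded_linear_intro)
    show "restrict_pair S (x + y) = restrict_pair S x + restrict_pair S y" for x y :: "('a, 'a) l2 \<times> ('a, real) l2"
      using restrict_pair_linear[OF assms] by (rule linear_add)
    show "restrict_pair S (r *\<^sub>R x) = r *\<^sub>R restrict_pair S x" for r and x :: "('a, 'a) l2 \<times> ('a, real) l2"
      using restrict_pair_linear[OF assms] by (rule linear_scale)
    show "norm (restrict_pair S x) \<le> norm x * 1" for x :: "('a, 'a) l2 \<times> ('a, real) l2"
      unfolding restrict_pair_def norm_prod_def
      using norm_restrict_l2_le[OF assms, of "fst x"] norm_restrict_l2_le[OF assms, of "snd x"]
      by (simp add: add_mono power_mono)
  qed
  then show ?thesis by (rule linear_continuous_on)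
qed

lemma restrict_pair_eq:
  "S \<in> sets borel \<Longrightarrow> x \<in> L2 S \<times> L2 S \<Longrightarrow> restrict_pair S x = x"
  by (auto simp: restrict_pair_def restrict_l2_eq_iff)

lemma restrict_pair_in: "S \<in> sets borel \<Longrightarrow> restrict_pair S x \<in> L2 S \<times> L2 S"
  by (simp add: restrict_pair_def restrict_l2_in_L2)

text \<open>Restriction is self-adjoint and fixes the test functions on \<open>T\<close>, which are
  also test functions on \<open>S\<close>.\<close>

lemma div_graph_restrict:
  assumes "open S" "open T" "T \<subseteq> S" "x \<in> div_graph S"
  shows "restrict_pair T x \<in> div_graph T"
  unfolding div_graph_alt[OF assms(2)]
proof (intro IntI CollectI ballI restrict_pair_in)
  fix y assume y: "y \<in> test_graph T"
  then have "y \<in> L2 T \<times> L2 T" using test_in_L2 by (auto simp: test_graph_def)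
  then have "restrict_pair T y = y" using assms(2) by (intro restrict_pair_eq) auto
  moreover have "y \<in> test_graph S" using y test_functions_mono[OF assms(3)] by (auto simp: test_graph_def)
  then have "x \<bullet> y = 0" using assms(4) unfolding div_graph_alt[OF assms(1)] by blast
  ultimately show "restrict_pair T x \<bullet> y = 0" using assms(2) by (simp add: restrict_pair_inner)
qed (use assms(2) in simp)

lemma grad_graph_restrict:
  assumes "open S" "open T" "T \<subseteq> S" "x \<in> grad_graph S"
  shows "restrict_pair T x \<in> grad_graph T"
  unfolding grad_graph_alt[OF assms(2)]
proof (intro IntI CollectI ballI restrict_pair_in)
  fix y assume "y \<in> vector_test_graph T"
  then obtain \<phi> and b :: 'a where \<phi>: "\<phi> \<in> test_functions T" and b: "b \<in> Basis"
    and y: "y = (abs_l2 (\<lambda>x. \<phi> x *\<^sub>R b), abs_l2 (\<lambda>x. gradient \<phi> x \<bullet> b))"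
    by (auto simp: vector_test_graph_def)
  have si: "square_integrable (\<lambda>x. \<phi> x *\<^sub>R b)" "square_integrable (\<lambda>x. gradient \<phi> x \<bullet> b)"
    using square_integrable_test[OF \<phi>] by (auto intro: square_integrable_scaleR_vector square_integrable_inner_vector)
  have 0: "\<phi> x = 0" "gradient \<phi> x = 0" if "x \<notin> T" for x
    using gradient_eq_0_off_support[OF \<phi>, of x] test_function_eq_0[OF \<phi> that] \<phi> that
    by (auto simp: test_functions_def)
  have "y \<in> L2 T \<times> L2 T"
    by (auto simp: y L2_def abs_l2_vanishes_off[OF si(1)] abs_l2_vanishes_off[OF si(2)] 0)
  then have "restrict_pair T y = y" using assms(2) by (intro restrict_pair_eq) auto
  moreover have "x \<bullet> y = 0"
  proof -
    have "y \<in> vector_test_graph S"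
      using \<phi> b test_functions_mono[OF assms(3)] by (auto simp: y vector_test_graph_def intro!: image_eqI[of _ _ "(\<phi>, b)"])
    then show ?thesis using assms(4) unfolding grad_graph_alt[OF assms(1)] by blast
  qed
  ultimately show "restrict_pair T x \<bullet> y = 0" using assms(2) by (simp add: restrict_pair_inner)
qed (use assms(2) in simp)

text \<open>The trace norms are quotient norms, and these facts serve both of them. The third
  carries a factor \<open>c\<close> through the infimum; it may be 0, hence the case
  distinction.\<close>

lemma
  fixes x :: "'a::real_normed_vector"
  assumes x: "x \<in> G"
  shows quotient_norm_le: "Inf (norm ` {y \<in> G. f y = f x}) \<le> norm x"
    and quotient_norm_nonneg: "0 \<le> Inf (norm ` {y \<in> G. f y = f x})"
    and quotient_norm_bound: "\<lbrakk>\<And>y. f y = f x \<Longrightarrow> a \<le> norm y * c; 0 \<le> c\<rbrakk> \<Longrightarrow> a \<le> Inf (norm ` {y \<in> G. f y = f x}) * c"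
proof -
  have ne: "norm ` {y \<in> G. f y = f x} \<noteq> {}" using x by blast
  show "Inf (norm ` {y \<in> G. f y = f x}) \<le> norm x"
    using x by (intro cInf_lower bdd_belowI[of _ 0]) auto
  show "0 \<le> Inf (norm ` {y \<in> G. f y = f x})"
    using ne by (rule cInf_greatest) auto
  assume a: "\<And>y. f y = f x \<Longrightarrow> a \<le> norm y * c" and c: "0 \<le> c"
  show "a \<le> Inf (norm ` {y \<in> G. f y = f x}) * c"
  proof (cases "c = 0")
    case True
    then show ?thesis using a[OF refl] by simp
  next
    case False
    with c have "0 < c" by simp
    have "a / c \<le> Inf (norm ` {y \<in> G. f y = f x})"
      using ne by (rule cInf_greatest) (use a \<open>0 < c\<close> in \<open>auto simp: pos_divide_le_eq\<close>)
    then show ?thesis using \<open>0 < c\<close> by (simp add: pos_divide_le_eq)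
  qed
qed

section \<open>Gluing over a mesh\<close>

locale meshed_domain =
  fixes \<Omega> :: "'a::euclidean_space set" and M :: "'a set set"
  assumes open_domain: "open \<Omega>" and mesh: "is_mesh \<Omega> M"
begin

lemma finite_mesh: "finite M"
  using mesh by (simp add: is_mesh_def)

lemma element:
  assumes "T \<in> M"
  shows "open T" "T \<subseteq> \<Omega>" "T \<in> sets borel"
proof -
  have "lipschitz_domain T" "T \<subseteq> \<Omega>" using mesh assms unfolding is_mesh_def by blast+
  then show "open T" "T \<subseteq> \<Omega>" unfolding lipschitz_domain_def by blast+
  then show "T \<in> sets borel" by simp
qed

lemma elements_disjoint: "S \<in> M \<Longrightarrow> T \<in> M \<Longrightarrow> S \<noteq> T \<Longrightarrow> disjnt S T"
  using mesh by (auto simp: is_mesh_def pairwise_def)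

lemma sum_inner_element:
  assumes f: "\<And>T. T \<in> M \<Longrightarrow> f T \<in> L2 T" and g: "g \<in> L2 S" and S: "S \<in> M"
  shows "(\<Sum>T\<in>M. f T) \<bullet> g = f S \<bullet> g"
proof -
  have "(\<Sum>T\<in>M. f T) \<bullet> g = (\<Sum>T\<in>M. if T = S then f S \<bullet> g else 0)"
    unfolding inner_sum_left
    using L2_disjoint_orthogonal[OF f g elements_disjoint] S by (intro sum.cong) auto
  then show ?thesis using S finite_mesh by simp
qed

lemma sum_inner_sum:
  assumes f: "\<And>T. T \<in> M \<Longrightarrow> f T \<in> L2 T" and g: "\<And>T. T \<in> M \<Longrightarrow> g T \<in> L2 T"
  shows "(\<Sum>T\<in>M. f T) \<bullet> (\<Sum>T\<in>M. g T) = (\<Sum>T\<in>M. f T \<bullet> g T)"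
proof -
  have "(\<Sum>T\<in>M. f T) \<bullet> (\<Sum>T\<in>M. g T) = (\<Sum>S\<in>M. (\<Sum>T\<in>M. f T) \<bullet> g S)" by (rule inner_sum_right)
  also have "\<dots> = (\<Sum>S\<in>M. f S \<bullet> g S)" using sum_inner_element[OF f g] by (intro sum.cong) auto
  finally show ?thesis .
qed

lemma restrict_sum:
  assumes f: "\<And>T. T \<in> M \<Longrightarrow> f T \<in> L2 T" and S: "S \<in> M"
  shows "restrict_l2 S (\<Sum>T\<in>M. f T) = f S"
proof (rule vector_eq_rdot[THEN iffD1], rule allI)
  fix z
  note Sb = element(3)[OF S]
  have "restrict_l2 S (\<Sum>T\<in>M. f T) \<bullet> z = (\<Sum>T\<in>M. f T) \<bullet> restrict_l2 S z"
    by (rule restrict_l2_inner[OF Sb])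
  also have "\<dots> = f S \<bullet> restrict_l2 S z"
    by (rule sum_inner_element[OF f restrict_l2_in_L2[OF Sb] S])
  also have "\<dots> = f S \<bullet> z" by (rule L2_inner_restrict[OF Sb f[OF S]])
  finally show "restrict_l2 S (\<Sum>T\<in>M. f T) \<bullet> z = f S \<bullet> z" .
qed

lemma domain_borel: "\<Omega> \<in> sets borel"
  using open_domain by simp

lemma sum_in_L2:
  assumes "\<And>T. T \<in> M \<Longrightarrow> f T \<in> L2 T"
  shows "(\<Sum>T\<in>M. f T) \<in> L2 \<Omega>"
proof (rule subspace_sum[OF L2_subspace[OF domain_borel]])
  show "f T \<in> L2 \<Omega>" if "T \<in> M" for T using assms[OF that] L2_mono[OF element(2)[OF that]] by blast
qed

text \<open>The difference vanishes on every element and off \<Omega>, hence almost everywhere,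
  because the elements cover \<Omega> up to a null set.\<close>

lemma sum_restrict:
  assumes u: "u \<in> L2 \<Omega>"
  shows "(\<Sum>T\<in>M. restrict_l2 T u) = u"
proof -
  define w where "w = u - (\<Sum>T\<in>M. restrict_l2 T u)"
  have w: "restrict_l2 S w = 0" if "S \<in> M" for S
    using restrict_sum[where f = "\<lambda>T. restrict_l2 T u", OF restrict_l2_in_L2[OF element(3)] that]
    by (simp add: w_def restrict_l2_diff[OF element(3)[OF that]])
  have "w \<in> L2 \<Omega>"
    unfolding w_def
    by (rule subspace_diff[OF L2_subspace[OF domain_borel] u sum_in_L2[OF restrict_l2_in_L2[OF element(3)]]])
  obtain f where f: "square_integrable f" "w = abs_l2 f" by (rule l2_cases)
  have "AE x in lborel. \<forall>T\<in>M. x \<in> T \<longrightarrow> f x = 0"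
  proof (rule AE_finite_allI[OF finite_mesh])
    fix T assume T: "T \<in> M"
    have "abs_l2 (\<lambda>x. indicat_real T x *\<^sub>R f x) = abs_l2 (\<lambda>x. 0)"
      using w[OF T] unfolding f(2) abs_l2_restrict[OF f(1) element(3)[OF T]] by (simp only: abs_l2_zero)
    then have "AE x in lborel. indicat_real T x *\<^sub>R f x = 0"
      unfolding abs_l2_eq_iff[OF square_integrable_indicator[OF f(1) element(3)[OF T]] square_integrable_zero] .
    then show "AE x in lborel. x \<in> T \<longrightarrow> f x = 0" by eventually_elim auto
  qed
  moreover have "AE x in lborel. x \<notin> \<Omega> \<longrightarrow> f x = 0"
    using \<open>w \<in> L2 \<Omega>\<close> f by (simp add: L2_def abs_l2_vanishes_off)
  moreover note mesh_covers_AE[OF mesh]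
  ultimately have "AE x in lborel. f x = 0" by eventually_elim blast
  then have "w = 0" unfolding f(2) abs_l2_zero abs_l2_eq_iff[OF f(1) square_integrable_zero] .
  then show ?thesis by (simp add: w_def)
qed

text \<open>The glued form of a broken space. \<open>G\<close> is a parameter so that closedness and
  linearity are proved once for both graphs.\<close>

definition broken_graph ::
  "('a set \<Rightarrow> (('a, 'a) l2 \<times> ('a, real) l2) set) \<Rightarrow> (('a, 'a) l2 \<times> ('a, real) l2) set" where
  "broken_graph G = {x \<in> L2 \<Omega> \<times> L2 \<Omega>. \<forall>T\<in>M. restrict_pair T x \<in> G T}"

lemma broken_graph_alt: "broken_graph G = (L2 \<Omega> \<times> L2 \<Omega>) \<inter> (\<Inter>T\<in>M. restrict_pair T -` G T)"
  by (auto simp: broken_graph_def)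

lemma broken_graph_closed:
  assumes "\<And>T. T \<in> M \<Longrightarrow> closed (G T)"
  shows "closed (broken_graph G)"
proof -
  have "closed (restrict_pair T -` G T)" if "T \<in> M" for T
    using assms that restrict_pair_continuous[OF element(3)[OF that]]
    by (intro closed_vimage) auto
  then have "closed (\<Inter>T\<in>M. restrict_pair T -` G T)" by (intro closed_INT) auto
  then show ?thesis
    unfolding broken_graph_alt
    by (rule closed_Int[OF closed_Times[OF L2_closed[OF domain_borel] L2_closed[OF domain_borel]]])
qed

lemma broken_graph_subspace:
  assumes "\<And>T. T \<in> M \<Longrightarrow> subspace (G T)"
  shows "subspace (broken_graph G)"
proof -
  have "subspace (restrict_pair T -` G T)" if "T \<in> M" for T
    using restrict_pair_linear[OF element(3)[OF that]] assms[OF that] by (rule linear_subspace_vimage)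
  then have "subspace (\<Inter>T\<in>M. restrict_pair T -` G T)" by (intro subspace_Int) auto
  then show ?thesis
    unfolding broken_graph_alt
    by (rule subspace_inter[OF subspace_Times[OF L2_subspace[OF domain_borel] L2_subspace[OF domain_borel]]])
qed

lemma Hdiv_broken_D:
  assumes "\<tau> \<in> Hdiv_broken M" "T \<in> M"
  shows "(\<tau> T, wdiv T (\<tau> T)) \<in> div_graph T" "\<tau> T \<in> L2 T" "wdiv T (\<tau> T) \<in> L2 T"
proof -
  show *: "(\<tau> T, wdiv T (\<tau> T)) \<in> div_graph T" using assms by (auto simp: Hdiv_broken_def div_graph_def)
  then show "\<tau> T \<in> L2 T" "wdiv T (\<tau> T) \<in> L2 T" unfolding mem_div_graph[OF element(1)[OF assms(2)]] by blast+
qed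

lemma H1_broken_D:
  assumes "v \<in> H1_broken M" "T \<in> M"
  shows "(wgrad T (v T), v T) \<in> grad_graph T" "v T \<in> L2 T" "wgrad T (v T) \<in> L2 T"
proof -
  show *: "(wgrad T (v T), v T) \<in> grad_graph T" using assms by (auto simp: H1_broken_def grad_graph_def)
  then show "v T \<in> L2 T" "wgrad T (v T) \<in> L2 T" unfolding mem_grad_graph[OF element(1)[OF assms(2)]] by blast+
qed

lemma restrict_glue_div:
  assumes "\<tau> \<in> Hdiv_broken M" "T \<in> M"
  shows "restrict_pair T (glue_div M \<tau>) = (\<tau> T, wdiv T (\<tau> T))"
  using Hdiv_broken_D[OF assms(1)] assms(2) by (simp add: restrict_pair_def glue_div_def restrict_sum)

lemma restrict_glue_grad:
  assumes "v \<in> H1_broken M" "T \<in> M"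
  shows "restrict_pair T (glue_grad M v) = (wgrad T (v T), v T)"
  using H1_broken_D[OF assms(1)] assms(2) by (simp add: restrict_pair_def glue_grad_def restrict_sum)

text \<open>Gluing places the broken space in one Hilbert space as the subspace to project onto. It
  is inverted by restricting the first component to the elements.\<close>

lemma glue_div_image: "glue_div M ` Hdiv_broken M = broken_graph div_graph"
proof (intro set_eqI iffI)
  fix x assume "x \<in> glue_div M ` Hdiv_broken M"
  then obtain \<tau> where \<tau>: "\<tau> \<in> Hdiv_broken M" "x = glue_div M \<tau>" by blast
  then show "x \<in> broken_graph div_graph"
    using Hdiv_broken_D[OF \<tau>(1)] restrict_glue_div[OF \<tau>(1)]
    by (auto simp: broken_graph_def) (auto simp: glue_div_def intro!: sum_in_L2)
next
  fix x assume x: "x \<in> broken_graph div_graph"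
  define \<tau> where "\<tau> T = (if T \<in> M then restrict_l2 T (fst x) else 0)" for T
  have g: "(\<tau> T, restrict_l2 T (snd x)) \<in> div_graph T" if "T \<in> M" for T
    using x that by (auto simp: broken_graph_def restrict_pair_def \<tau>_def)
  have "wdiv T (\<tau> T) = restrict_l2 T (snd x)" if "T \<in> M" for T
    using g[OF that] by (auto simp: div_graph_def)
  then have "glue_div M \<tau> = x"
    using x by (auto simp: glue_div_def \<tau>_def broken_graph_def sum_restrict cong: sum.cong)
  moreover have "\<tau> \<in> Hdiv_broken M"
    unfolding Hdiv_broken_def using g by (auto simp: div_graph_def) (auto simp: \<tau>_def)
  ultimately show "x \<in> glue_div M ` Hdiv_broken M" by blast
qed

lemma glue_grad_image: "glue_grad M ` H1_broken M = broken_graph grad_graph"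
proof (intro set_eqI iffI)
  fix x assume "x \<in> glue_grad M ` H1_broken M"
  then obtain v where v: "v \<in> H1_broken M" "x = glue_grad M v" by blast
  then show "x \<in> broken_graph grad_graph"
    using H1_broken_D[OF v(1)] restrict_glue_grad[OF v(1)]
    by (auto simp: broken_graph_def) (auto simp: glue_grad_def intro!: sum_in_L2)
next
  fix x assume x: "x \<in> broken_graph grad_graph"
  define v where "v T = (if T \<in> M then restrict_l2 T (snd x) else 0)" for T
  have g: "(restrict_l2 T (fst x), v T) \<in> grad_graph T" if "T \<in> M" for T
    using x that by (auto simp: broken_graph_def restrict_pair_def v_def)
  have "wgrad T (v T) = restrict_l2 T (fst x)" if "T \<in> M" for T
    using g[OF that] by (auto simp: grad_graph_def)
  then have "glue_grad M v = x"
    using x by (auto simp: glue_grad_def v_def broken_graph_def sum_restrict cong: sum.cong)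
  moreover have "v \<in> H1_broken M"
    unfolding H1_broken_def using g by (auto simp: grad_graph_def) (auto simp: v_def)
  ultimately show "x \<in> glue_grad M ` H1_broken M" by blast
qed

lemma glue_div_inject:
  assumes "\<sigma> \<in> Hdiv_broken M" "\<tau> \<in> Hdiv_broken M" "glue_div M \<sigma> = glue_div M \<tau>"
  shows "\<sigma> = \<tau>"
proof
  fix T
  show "\<sigma> T = \<tau> T"
  proof (cases "T \<in> M")
    case True
    then show ?thesis using restrict_glue_div[OF assms(1) True] restrict_glue_div[OF assms(2) True] assms(3) by simp
  next
    case False
    then show ?thesis using assms by (simp add: Hdiv_broken_def)
  qed
qed

lemma glue_grad_inject:
  assumes "v \<in> H1_broken M" "w \<in> H1_broken M" "glue_grad M v = glue_grad M w"
  shows "v = w"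
proof
  fix T
  show "v T = w T"
  proof (cases "T \<in> M")
    case True
    then show ?thesis using restrict_glue_grad[OF assms(1) True] restrict_glue_grad[OF assms(2) True] assms(3) by simp
  next
    case False
    then show ?thesis using assms by (simp add: H1_broken_def)
  qed
qed

text \<open>This inclusion passes orthogonality from broken pairs to conforming ones.\<close>

lemma div_graph_broken: "div_graph \<Omega> \<subseteq> broken_graph div_graph"
  using div_graph_restrict[OF open_domain element(1) element(2)]
  by (auto simp: broken_graph_def mem_div_graph[OF open_domain])

lemma grad_graph_broken: "grad_graph \<Omega> \<subseteq> broken_graph grad_graph"
  using grad_graph_restrict[OF open_domain element(1) element(2)]
  by (auto simp: broken_graph_def mem_grad_graph[OF open_domain])

section \<open>Traces and their quotient norms\<close>

definition grad_trace :: "('a, 'a) l2 \<times> ('a, real) l2 \<Rightarrow> 'a grad_trace" where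
  "grad_trace x = (\<lambda>\<tau>. if \<tau> \<in> Hdiv_broken M then x \<bullet> glue_div M \<tau> else 0)"

definition div_trace :: "('a, 'a) l2 \<times> ('a, real) l2 \<Rightarrow> 'a div_trace" where
  "div_trace x = (\<lambda>v. if v \<in> H1_broken M then x \<bullet> glue_grad M v else 0)"

text \<open>Against a function supported in an element, the restriction pairs like the global
  function. So the skeleton pairing is one inner product of a conforming pair with a glued
  pair.\<close>

lemma tr_grad_eq:
  assumes v: "v \<in> H1 \<Omega>"
  shows "tr_grad M (broken M v) = grad_trace (wgrad \<Omega> v, v)"
proof
  fix \<tau>
  show "tr_grad M (broken M v) \<tau> = grad_trace (wgrad \<Omega> v, v) \<tau>"
  proof (cases "\<tau> \<in> Hdiv_broken M")
    case True
    have w: "wgrad T (restrict_l2 T v) = restrict_l2 T (wgrad \<Omega> v)" if "T \<in> M" for T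
      using grad_graph_restrict[OF open_domain element(1,2)[OF that] H1_D[OF v]]
      by (auto simp: restrict_pair_def grad_graph_def)
    have r: "restrict_l2 T u \<bullet> y = u \<bullet> y" if "T \<in> M" "y \<in> L2 T" for T y and u :: "('a, 'b::euclidean_space) l2"
      using that L2_inner_restrict[OF element(3)] by (metis inner_commute)
    show ?thesis
      using True Hdiv_broken_D[OF True]
      by (simp add: tr_grad_def grad_trace_def skeleton_pairing_def broken_def glue_div_def inner_sum_right w r add.commute)
  qed (simp add: tr_grad_def grad_trace_def)
qed

lemma tr_div_eq:
  assumes \<tau>: "\<tau> \<in> Hdiv \<Omega>"
  shows "tr_div M (broken M \<tau>) = div_trace (\<tau>, wdiv \<Omega> \<tau>)"
proof
  fix v
  show "tr_div M (broken M \<tau>) v = div_trace (\<tau>, wdiv \<Omega> \<tau>) v"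
  proof (cases "v \<in> H1_broken M")
    case True
    have "(\<tau>, wdiv \<Omega> \<tau>) \<in> div_graph \<Omega>" using \<tau> by (simp add: div_graph_def)
    then have w: "wdiv T (restrict_l2 T \<tau>) = restrict_l2 T (wdiv \<Omega> \<tau>)" if "T \<in> M" for T
      using div_graph_restrict[OF open_domain element(1,2)[OF that]]
      by (fastforce simp: restrict_pair_def div_graph_def)
    have r: "y \<bullet> restrict_l2 T u = u \<bullet> y" if "T \<in> M" "y \<in> L2 T" for T y and u :: "('a, 'b::euclidean_space) l2"
      using that L2_inner_restrict[OF element(3)] by (metis inner_commute)
    show ?thesis
      using True H1_broken_D[OF True]
      by (simp add: tr_div_def div_trace_def skeleton_pairing_def broken_def glue_grad_def inner_sum_right w r add.commute)
  qed (simp add: tr_div_def div_trace_def)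
qed

lemma H10_subset: "H10 \<Omega> \<subseteq> H1 \<Omega>"
  by (auto simp: H10_def)

lemma Hdiv0_subset: "Hdiv0 \<Omega> \<subseteq> Hdiv \<Omega>"
  by (auto simp: Hdiv0_def)

lemma trace_spaces:
  "H_half \<Omega> M = grad_trace ` grad_graph \<Omega>" "H_half0 \<Omega> M = grad_trace ` grad_graph0 \<Omega>"
  "H_mhalf \<Omega> M = div_trace ` div_graph \<Omega>" "H_mhalf0 \<Omega> M = div_trace ` div_graph0 \<Omega>"
  unfolding H_half_def H_half0_def H_mhalf_def H_mhalf0_def grad_graph_def grad_graph0_def div_graph_def div_graph0_def image_image
  using tr_grad_eq tr_div_eq H10_subset Hdiv0_subset by (auto intro!: image_cong)

lemma norm_half_eq: "norm_half \<Omega> M h = Inf (norm ` {x \<in> grad_graph \<Omega>. grad_trace x = h})"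
proof -
  have "{norm_H1 \<Omega> v |v. v \<in> H1 \<Omega> \<and> tr_grad M (broken M v) = h} = norm ` {x \<in> grad_graph \<Omega>. grad_trace x = h}"
    using tr_grad_eq by (auto simp: grad_graph_def norm_H1_def norm_Pair add.commute image_iff)
  then show ?thesis by (simp add: norm_half_def)
qed

lemma norm_mhalf_eq: "norm_mhalf \<Omega> M h = Inf (norm ` {x \<in> div_graph \<Omega>. div_trace x = h})"
proof -
  have "{norm_Hdiv \<Omega> \<tau> |\<tau>. \<tau> \<in> Hdiv \<Omega> \<and> tr_div M (broken M \<tau>) = h} = norm ` {x \<in> div_graph \<Omega>. div_trace x = h}"
    using tr_div_eq by (auto simp: div_graph_def norm_Hdiv_def norm_Pair image_iff)
  then show ?thesis by (simp add: norm_mhalf_def)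
qed

lemma norm_half_le: "x \<in> grad_graph \<Omega> \<Longrightarrow> norm_half \<Omega> M (grad_trace x) \<le> norm x"
  and norm_half_nonneg: "x \<in> grad_graph \<Omega> \<Longrightarrow> 0 \<le> norm_half \<Omega> M (grad_trace x)"
  unfolding norm_half_eq by (fact quotient_norm_le quotient_norm_nonneg)+

lemma norm_mhalf_le: "x \<in> div_graph \<Omega> \<Longrightarrow> norm_mhalf \<Omega> M (div_trace x) \<le> norm x"
  and norm_mhalf_nonneg: "x \<in> div_graph \<Omega> \<Longrightarrow> 0 \<le> norm_mhalf \<Omega> M (div_trace x)"
  unfolding norm_mhalf_eq by (fact quotient_norm_le quotient_norm_nonneg)+

text \<open>Cauchy-Schwarz holds with every representative of the trace, hence with the infimum of
  their norms.\<close>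

lemma grad_trace_bound:
  assumes "x \<in> grad_graph \<Omega>" "\<tau> \<in> Hdiv_broken M"
  shows "\<bar>grad_trace x \<tau>\<bar> \<le> norm_half \<Omega> M (grad_trace x) * norm (glue_div M \<tau>)"
  unfolding norm_half_eq
proof (rule quotient_norm_bound[OF assms(1)])
  fix y assume "grad_trace y = grad_trace x"
  then have "grad_trace x \<tau> = y \<bullet> glue_div M \<tau>" using assms(2) by (metis grad_trace_def)
  then show "\<bar>grad_trace x \<tau>\<bar> \<le> norm y * norm (glue_div M \<tau>)" using Cauchy_Schwarz_ineq2 by simp
qed simp

lemma div_trace_bound:
  assumes "x \<in> div_graph \<Omega>" "v \<in> H1_broken M"
  shows "\<bar>div_trace x v\<bar> \<le> norm_mhalf \<Omega> M (div_trace x) * norm (glue_grad M v)"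
  unfolding norm_mhalf_eq
proof (rule quotient_norm_bound[OF assms(1)])
  fix y assume "div_trace y = div_trace x"
  then have "div_trace x v = y \<bullet> glue_grad M v" using assms(2) by (metis div_trace_def)
  then show "\<bar>div_trace x v\<bar> \<le> norm y * norm (glue_grad M v)" using Cauchy_Schwarz_ineq2 by simp
qed simp

end

section \<open>The trial-to-test operator and quasi-optimality\<close>

context meshed_domain
begin

definition glue_test :: "'a test \<Rightarrow> (('a, 'a) l2 \<times> ('a, real) l2) \<times> (('a, 'a) l2 \<times> ('a, real) l2) \<times>
    (('a, 'a) l2 \<times> ('a, real) l2) \<times> (('a, 'a) l2 \<times> ('a, real) l2)" where
  "glue_test = (\<lambda>(v1, v2, v3, v4). (glue_div M v1, glue_grad M v2, glue_div M v3, glue_grad M v4))"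

lemma glue_test_image:
  "glue_test ` test_space M =
    broken_graph div_graph \<times> broken_graph grad_graph \<times> broken_graph div_graph \<times> broken_graph grad_graph"
  unfolding test_space_def glue_test_def glue_div_image[symmetric] glue_grad_image[symmetric]
  by (auto simp: image_iff)

lemma glue_test_inject:
  assumes "v \<in> test_space M" "w \<in> test_space M" "glue_test v = glue_test w"
  shows "v = w"
proof -
  obtain v1 v2 v3 v4 where v: "v = (v1, v2, v3, v4)" by (cases v)
  obtain w1 w2 w3 w4 where w: "w = (w1, w2, w3, w4)" by (cases w)
  show ?thesis
    using assms glue_div_inject[of v1 w1] glue_grad_inject[of v2 w2] glue_div_inject[of v3 w3] glue_grad_inject[of v4 w4]
    unfolding v w test_space_def glue_test_def by simp
qed

lemma glue_test_image_subspace: "subspace (glue_test ` test_space M)"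
  and glue_test_image_closed: "closed (glue_test ` test_space M)"
proof -
  have d: "subspace (broken_graph div_graph)" "closed (broken_graph div_graph)"
    using broken_graph_subspace[OF div_graph_subspace[OF element(1)]]
      broken_graph_closed[OF div_graph_closed[OF element(1)]] by auto
  have g: "subspace (broken_graph grad_graph)" "closed (broken_graph grad_graph)"
    using broken_graph_subspace[OF grad_graph_subspace[OF element(1)]]
      broken_graph_closed[OF grad_graph_closed[OF element(1)]] by auto
  show "subspace (glue_test ` test_space M)"
    unfolding glue_test_image by (intro subspace_Times d g)
  show "closed (glue_test ` test_space M)"
    unfolding glue_test_image by (intro closed_Times d g)
qed

lemma inner_test_eq:
  assumes "w \<in> test_space M" "v \<in> test_space M"
  shows "inner_test M w v = glue_test w \<bullet> glue_test v"
proof -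
  have d: "inner_Hdiv_broken M \<sigma> \<tau> = glue_div M \<sigma> \<bullet> glue_div M \<tau>"
    if "\<sigma> \<in> Hdiv_broken M" "\<tau> \<in> Hdiv_broken M" for \<sigma> \<tau>
    using Hdiv_broken_D[OF that(1)] Hdiv_broken_D[OF that(2)]
    by (simp add: inner_Hdiv_broken_def glue_div_def sum_inner_sum sum.distrib)
  have g: "inner_H1_broken M \<sigma> \<tau> = glue_grad M \<sigma> \<bullet> glue_grad M \<tau>"
    if "\<sigma> \<in> H1_broken M" "\<tau> \<in> H1_broken M" for \<sigma> \<tau>
    using H1_broken_D[OF that(1)] H1_broken_D[OF that(2)]
    by (simp add: inner_H1_broken_def glue_grad_def sum_inner_sum sum.distrib)
  show ?thesis using assms by (auto simp: inner_test_def test_space_def glue_test_def d g)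
qed

text \<open>The components follow the test slots: \<open>P4\<close> stands first because its trace
  is paired with \<open>v1\<close>, and \<open>P3\<close>, \<open>P2\<close>, \<open>P1\<close>
  belong to the other slots likewise. This makes \<open>b_form\<close> one inner product.\<close>

definition residual where
  "residual u1 u2 u3 u4 P1 P2 P3 P4 = (P4 + (u1, - u4), P3 - (u3, u4), P2 - (u3, u2), P1 - (u1, u2))"

lemma b_form_eq:
  assumes v: "v \<in> test_space M"
  shows "b_form M (u1, u2, u3, u4, div_trace P1, grad_trace P2, div_trace P3, grad_trace P4) v
    = residual u1 u2 u3 u4 P1 P2 P3 P4 \<bullet> glue_test v"
proof -
  obtain v1 v2 v3 v4 where v': "v = (v1, v2, v3, v4)" by (cases v)
  have m: "v1 \<in> Hdiv_broken M" "v2 \<in> H1_broken M" "v3 \<in> Hdiv_broken M" "v4 \<in> H1_broken M"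
    using v by (auto simp: v' test_space_def)
  show ?thesis
    unfolding v'
    using m
    by (simp add: b_form_def residual_def glue_test_def div_trace_def grad_trace_def inner_add_left inner_diff_left)
      (simp add: glue_div_def glue_grad_def inner_sum_right inner_diff_right inner_add_right sum.distrib sum_subtractf sum_negf)
qed

lemma trial_exhaust:
  fixes u :: "'a trial"
  obtains u1 u2 u3 u4 h1 h2 h3 h4 where "u = (u1, u2, u3, u4, h1, h2, h3, h4)"
proof -
  obtain u1 u2 u3 u4 h1 h2 h where "u = (u1, u2, u3, u4, h1, h2, h)" by (cases u)
  moreover obtain h3 h4 where "h = (h3, h4)" by (cases h)
  ultimately show ?thesis using that by simp
qed

lemma trial_cases:
  assumes "u \<in> trial_space \<Omega> M"
  obtains u1 u2 u3 u4 P1 P2 P3 P4 where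
    "u = (u1, u2, u3, u4, div_trace P1, grad_trace P2, div_trace P3, grad_trace P4)"
    "u1 \<in> L2 \<Omega>" "u2 \<in> L2 \<Omega>" "u3 \<in> L2 \<Omega>" "u4 \<in> L2 \<Omega>"
    "P1 \<in> div_graph0 \<Omega>" "P2 \<in> grad_graph0 \<Omega>" "P3 \<in> div_graph \<Omega>" "P4 \<in> grad_graph \<Omega>"
proof -
  obtain u1 u2 u3 u4 h1 h2 h3 h4 where u: "u = (u1, u2, u3, u4, h1, h2, h3, h4)"
    by (rule trial_exhaust)
  have "h1 \<in> div_trace ` div_graph0 \<Omega>" "h2 \<in> grad_trace ` grad_graph0 \<Omega>"
    "h3 \<in> div_trace ` div_graph \<Omega>" "h4 \<in> grad_trace ` grad_graph \<Omega>"
    and L: "u1 \<in> L2 \<Omega>" "u2 \<in> L2 \<Omega>" "u3 \<in> L2 \<Omega>" "u4 \<in> L2 \<Omega>"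
    using assms unfolding u trial_space_def trace_spaces by auto
  then obtain P1 P2 P3 P4 where
    "h1 = div_trace P1" "P1 \<in> div_graph0 \<Omega>" "h2 = grad_trace P2" "P2 \<in> grad_graph0 \<Omega>"
    "h3 = div_trace P3" "P3 \<in> div_graph \<Omega>" "h4 = grad_trace P4" "P4 \<in> grad_graph \<Omega>" by auto
  then show ?thesis using that u L by blast
qed

lemma trial_to_test_exists:
  assumes u: "u \<in> trial_space \<Omega> M"
  shows "\<exists>w\<in>test_space M. \<forall>v\<in>test_space M. glue_test w \<bullet> glue_test v = b_form M u v"
proof -
  obtain u1 u2 u3 u4 P1 P2 P3 P4 where
    u': "u = (u1, u2, u3, u4, div_trace P1, grad_trace P2, div_trace P3, grad_trace P4)"
    by (rule trial_cases[OF u])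
  define R where "R = residual u1 u2 u3 u4 P1 P2 P3 P4"
  obtain w where w: "w \<in> test_space M" "\<forall>v\<in>test_space M. (R - glue_test w) \<bullet> glue_test v = 0"
    using projection_exists[OF glue_test_image_subspace glue_test_image_closed, of R] by auto
  show ?thesis
  proof (intro bexI[OF _ w(1)] ballI)
    fix v assume v: "v \<in> test_space M"
    then have "(R - glue_test w) \<bullet> glue_test v = 0" using w(2) by blast
    then show "glue_test w \<bullet> glue_test v = b_form M u v"
      by (simp add: u' b_form_eq[OF v] R_def inner_diff_left)
  qed
qed

text \<open>Its norm is the energy norm of the trial function. As a vector of a fixed Hilbert space
  it turns the discrete problem into an orthogonality relation.\<close>

definition energy where
  "energy u = glue_test (trial_to_test M u)"

text \<open>The difference lies in the same subspace and can itself be used as the test.\<close>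

lemma glue_test_unique:
  assumes "x \<in> glue_test ` test_space M" "y \<in> glue_test ` test_space M"
    and "\<And>v. v \<in> test_space M \<Longrightarrow> x \<bullet> glue_test v = y \<bullet> glue_test v"
  shows "x = y"
proof -
  have "x - y \<in> glue_test ` test_space M" by (rule subspace_diff[OF glue_test_image_subspace assms(1,2)])
  then obtain v where v: "v \<in> test_space M" "x - y = glue_test v" by blast
  have "(x - y) \<bullet> glue_test v = 0" using assms(3)[OF v(1)] by (simp add: inner_diff_left)
  then have "(x - y) \<bullet> (x - y) = 0" by (simp only: v(2))
  then show ?thesis by simp
qed

lemma trial_to_test:
  assumes u: "u \<in> trial_space \<Omega> M"
  shows trial_to_test_in: "trial_to_test M u \<in> test_space M"
    and energy_inner: "v \<in> test_space M \<Longrightarrow> energy u \<bullet> glue_test v = b_form M u v"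
proof -
  obtain w where w: "w \<in> test_space M" "\<forall>v\<in>test_space M. glue_test w \<bullet> glue_test v = b_form M u v"
    using trial_to_test_exists[OF u] by blast
  have "trial_to_test M u = w"
    unfolding trial_to_test_def
  proof (rule the_equality)
    show "w \<in> test_space M \<and> (\<forall>v\<in>test_space M. inner_test M w v = b_form M u v)"
      using w by (simp add: inner_test_eq)
    fix w' assume w': "w' \<in> test_space M \<and> (\<forall>v\<in>test_space M. inner_test M w' v = b_form M u v)"
    have "glue_test w' = glue_test w"
      using w w' by (intro glue_test_unique) (auto simp: inner_test_eq[symmetric])
    then show "w' = w" using w w' by (intro glue_test_inject) auto
  qed
  then show "trial_to_test M u \<in> test_space M" "v \<in> test_space M \<Longrightarrow> energy u \<bullet> glue_test v = b_form M u v"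
    using w by (auto simp: energy_def)
qed

lemma energy_in: "u \<in> trial_space \<Omega> M \<Longrightarrow> energy u \<in> glue_test ` test_space M"
  by (simp add: energy_def trial_to_test_in)

section \<open>Linearity of the energy map on the trial space\<close>

lemma grad_trace_lincomb: "grad_trace (c *\<^sub>R x + y) = c *\<^sub>R grad_trace x + grad_trace y"
  by (rule ext) (simp add: grad_trace_def inner_add_left)

lemma div_trace_lincomb: "div_trace (c *\<^sub>R x + y) = c *\<^sub>R div_trace x + div_trace y"
  by (rule ext) (simp add: div_trace_def inner_add_left)

lemma div_graph0_subspace: "subspace (div_graph0 \<Omega>)"
proof -
  have eq: "div_graph0 \<Omega> = div_graph \<Omega> \<inter> {x. \<forall>y\<in>grad_graph \<Omega>. x \<bullet> y = 0}"
    unfolding div_graph0_eq by blast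
  show ?thesis
    unfolding eq by (rule subspace_inter[OF div_graph_subspace[OF open_domain] subspace_orthogonal_comp])
qed

lemma grad_graph0_subspace: "subspace (grad_graph0 \<Omega>)"
  unfolding grad_graph0_eq[OF open_domain] by (rule subspace_closure[OF subspace_test_graph])

lemma grad_graph0_subset: "grad_graph0 \<Omega> \<subseteq> grad_graph \<Omega>"
  unfolding grad_graph0_def grad_graph_def using H10_subset by blast

lemma div_graph0_subset: "div_graph0 \<Omega> \<subseteq> div_graph \<Omega>"
  unfolding div_graph0_def div_graph_def using Hdiv0_subset by blast

text \<open>The single form \<open>c *\<^sub>R u + w\<close> covers scaling, sums and, with
  \<open>c = -1\<close>, differences, while membership in the trial space is tracked.\<close>

lemma trial_space_lincomb:
  assumes "u \<in> trial_space \<Omega> M" "w \<in> trial_space \<Omega> M"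
  shows "c *\<^sub>R u + w \<in> trial_space \<Omega> M"
proof -
  obtain u1 u2 u3 u4 P1 P2 P3 P4 where
    u: "u = (u1, u2, u3, u4, div_trace P1, grad_trace P2, div_trace P3, grad_trace P4)"
    "u1 \<in> L2 \<Omega>" "u2 \<in> L2 \<Omega>" "u3 \<in> L2 \<Omega>" "u4 \<in> L2 \<Omega>"
    "P1 \<in> div_graph0 \<Omega>" "P2 \<in> grad_graph0 \<Omega>" "P3 \<in> div_graph \<Omega>" "P4 \<in> grad_graph \<Omega>"
    by (rule trial_cases[OF assms(1)])
  obtain w1 w2 w3 w4 Q1 Q2 Q3 Q4 where
    w: "w = (w1, w2, w3, w4, div_trace Q1, grad_trace Q2, div_trace Q3, grad_trace Q4)"
    "w1 \<in> L2 \<Omega>" "w2 \<in> L2 \<Omega>" "w3 \<in> L2 \<Omega>" "w4 \<in> L2 \<Omega>"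
    "Q1 \<in> div_graph0 \<Omega>" "Q2 \<in> grad_graph0 \<Omega>" "Q3 \<in> div_graph \<Omega>" "Q4 \<in> grad_graph \<Omega>"
    by (rule trial_cases[OF assms(2)])
  have lin: "c *\<^sub>R x + y \<in> S" if "subspace S" "x \<in> S" "y \<in> S" for S :: "'b::real_vector set" and x y
    using that by (simp add: subspace_add subspace_scale)
  have L: "subspace (L2 \<Omega> :: ('a, 'b::euclidean_space) l2 set)" by (rule L2_subspace[OF domain_borel])
  show ?thesis
    unfolding u(1) w(1) trial_space_def trace_spaces scaleR_Pair add_Pair div_trace_lincomb[symmetric] grad_trace_lincomb[symmetric]
    by (intro SigmaI imageI lin[OF L] lin[OF div_graph0_subspace] lin[OF grad_graph0_subspace]
        lin[OF div_graph_subspace[OF open_domain]] lin[OF grad_graph_subspace[OF open_domain]] u w)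
qed

lemma b_form_lincomb: "b_form M (c *\<^sub>R u + w) v = c * b_form M u v + b_form M w v"
proof -
  obtain u1 u2 u3 u4 h1 h2 h3 h4 where u: "u = (u1, u2, u3, u4, h1, h2, h3, h4)" by (rule trial_exhaust)
  obtain w1 w2 w3 w4 k1 k2 k3 k4 where w: "w = (w1, w2, w3, w4, k1, k2, k3, k4)" by (rule trial_exhaust)
  obtain v1 v2 v3 v4 where v: "v = (v1, v2, v3, v4)" by (cases v)
  have lin: "(\<Sum>T\<in>M. (c *\<^sub>R x + y) \<bullet> f T) = c * (\<Sum>T\<in>M. x \<bullet> f T) + (\<Sum>T\<in>M. y \<bullet> f T)"
    for x y :: "'b::real_inner" and f
    by (simp add: inner_add_left sum.distrib sum_distrib_left)
  show ?thesis
    unfolding u w v by (simp add: b_form_def lin) (simp add: algebra_simps)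
qed

lemma energy_lincomb:
  assumes "u \<in> trial_space \<Omega> M" "w \<in> trial_space \<Omega> M"
  shows "energy (c *\<^sub>R u + w) = c *\<^sub>R energy u + energy w"
proof (rule glue_test_unique)
  show "energy (c *\<^sub>R u + w) \<in> glue_test ` test_space M"
    by (intro energy_in trial_space_lincomb assms)
  show "c *\<^sub>R energy u + energy w \<in> glue_test ` test_space M"
    by (intro subspace_add subspace_scale glue_test_image_subspace energy_in assms)
  show "energy (c *\<^sub>R u + w) \<bullet> glue_test v = (c *\<^sub>R energy u + energy w) \<bullet> glue_test v" if "v \<in> test_space M" for v
    using that assms trial_space_lincomb[OF assms, of c]
    by (simp add: energy_inner b_form_lincomb inner_add_left)
qed

lemma energy_diff:
  assumes "u \<in> trial_space \<Omega> M" "w \<in> trial_space \<Omega> M"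
  shows "u - w \<in> trial_space \<Omega> M" "energy (u - w) = energy u - energy w"
proof -
  have eq: "(-1) *\<^sub>R w + u = u - w" by simp
  show "u - w \<in> trial_space \<Omega> M" using trial_space_lincomb[OF assms(2,1), of "-1"] unfolding eq .
  show "energy (u - w) = energy u - energy w" using energy_lincomb[OF assms(2,1), of "-1"] unfolding eq by simp
qed

text \<open>Since only the traces of the representatives \<open>P\<^sub>i\<close> enter, they may be shifted by the components of
  \<open>residual - energy u\<close>, which are orthogonal to the broken test space: such elements are conforming
  and have zero trace. The shifted residual equals \<open>energy u\<close>, so stability on \<open>\<Omega>\<close> alone applies.\<close>

lemma trial_cases_energy:
  assumes u: "u \<in> trial_space \<Omega> M"
  obtains u1 u2 u3 u4 P1 P2 P3 P4 where
    "u = (u1, u2, u3, u4, div_trace P1, grad_trace P2, div_trace P3, grad_trace P4)"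
    "P1 \<in> div_graph0 \<Omega>" "P2 \<in> grad_graph0 \<Omega>" "P3 \<in> div_graph \<Omega>" "P4 \<in> grad_graph \<Omega>"
    "residual u1 u2 u3 u4 P1 P2 P3 P4 = energy u"
proof -
  obtain u1 u2 u3 u4 P1 P2 P3 P4 where
    u': "u = (u1, u2, u3, u4, div_trace P1, grad_trace P2, div_trace P3, grad_trace P4)"
    and L: "u1 \<in> L2 \<Omega>" "u2 \<in> L2 \<Omega>" "u3 \<in> L2 \<Omega>" "u4 \<in> L2 \<Omega>"
    and P: "P1 \<in> div_graph0 \<Omega>" "P2 \<in> grad_graph0 \<Omega>" "P3 \<in> div_graph \<Omega>" "P4 \<in> grad_graph \<Omega>"
    by (rule trial_cases[OF u])
  define D where "D = residual u1 u2 u3 u4 P1 P2 P3 P4 - energy u"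
  obtain D1 D2 D3 D4 where D': "D = (D1, D2, D3, D4)" by (cases D)
  have orth: "D \<bullet> x = 0" if "x \<in> glue_test ` test_space M" for x
    using that energy_inner[OF u] by (auto simp: D_def inner_diff_left u' b_form_eq)
  have z: "0 \<in> broken_graph div_graph" "0 \<in> broken_graph grad_graph"
    using broken_graph_subspace[OF div_graph_subspace[OF element(1)]]
      broken_graph_subspace[OF grad_graph_subspace[OF element(1)]] by (auto intro: subspace_0)
  \<comment> \<open>Test pairs with a single nonzero slot separate the components of
    \<open>D\<close>.\<close>
  have o1: "D1 \<bullet> x = 0" "D3 \<bullet> x = 0" if "x \<in> broken_graph div_graph" for x
    using orth[of "(x, 0, 0, 0)"] orth[of "(0, 0, x, 0)"] that z by (auto simp: glue_test_image D')
  have o2: "D2 \<bullet> x = 0" "D4 \<bullet> x = 0" if "x \<in> broken_graph grad_graph" for x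
    using orth[of "(0, x, 0, 0)"] orth[of "(0, 0, 0, x)"] that z by (auto simp: glue_test_image D')
  have DL: "D1 \<in> L2 \<Omega> \<times> L2 \<Omega>" "D2 \<in> L2 \<Omega> \<times> L2 \<Omega>" "D3 \<in> L2 \<Omega> \<times> L2 \<Omega>" "D4 \<in> L2 \<Omega> \<times> L2 \<Omega>"
  proof -
    have LL: "subspace (L2 \<Omega> \<times> L2 \<Omega> :: (('a, 'a) l2 \<times> ('a, real) l2) set)"
      by (rule subspace_Times[OF L2_subspace[OF domain_borel] L2_subspace[OF domain_borel]])
    have PL: "P1 \<in> L2 \<Omega> \<times> L2 \<Omega>" "P2 \<in> L2 \<Omega> \<times> L2 \<Omega>" "P3 \<in> L2 \<Omega> \<times> L2 \<Omega>" "P4 \<in> L2 \<Omega> \<times> L2 \<Omega>"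
      using P div_graph0_subset grad_graph0_subset by (auto simp: div_graph_alt[OF open_domain] grad_graph_alt[OF open_domain])
    have uL: "(u1, - u4) \<in> L2 \<Omega> \<times> L2 \<Omega>" "(u3, u4) \<in> L2 \<Omega> \<times> L2 \<Omega>" "(u3, u2) \<in> L2 \<Omega> \<times> L2 \<Omega>" "(u1, u2) \<in> L2 \<Omega> \<times> L2 \<Omega>"
      using L subspace_neg[OF L2_subspace[OF domain_borel] L(4)] by auto
    obtain E1 E2 E3 E4 where E: "energy u = (E1, E2, E3, E4)" by (cases "energy u")
    have EL: "E1 \<in> L2 \<Omega> \<times> L2 \<Omega>" "E2 \<in> L2 \<Omega> \<times> L2 \<Omega>" "E3 \<in> L2 \<Omega> \<times> L2 \<Omega>" "E4 \<in> L2 \<Omega> \<times> L2 \<Omega>"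
      using energy_in[OF u] unfolding glue_test_image E by (auto simp: broken_graph_def)
    have "D1 = P4 + (u1, - u4) - E1" "D2 = P3 - (u3, u4) - E2" "D3 = P2 - (u3, u2) - E3" "D4 = P1 - (u1, u2) - E4"
      using D' unfolding D_def residual_def E by auto
    then show "D1 \<in> L2 \<Omega> \<times> L2 \<Omega>" "D2 \<in> L2 \<Omega> \<times> L2 \<Omega>" "D3 \<in> L2 \<Omega> \<times> L2 \<Omega>" "D4 \<in> L2 \<Omega> \<times> L2 \<Omega>"
      using PL uL EL by (simp_all only: subspace_diff[OF LL] subspace_add[OF LL])
  qed
  \<comment> \<open>The boundary conditions fit the slots: \<open>D3\<close> and \<open>D4\<close>
    shift \<open>P2\<close> and \<open>P1\<close>, which must stay in \<open>grad_graph0\<close> and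
    \<open>div_graph0\<close>.\<close>
  have D13: "D1 \<in> grad_graph0 \<Omega>" "D3 \<in> grad_graph0 \<Omega>"
    using o1 div_graph_broken DL by (auto intro!: grad_graph0_if_orthogonal[OF open_domain])
  have D24: "D2 \<in> div_graph0 \<Omega>" "D4 \<in> div_graph0 \<Omega>"
    using o2 grad_graph_broken DL by (auto intro!: div_graph0_if_orthogonal[OF open_domain])
  have tg: "grad_trace (P - E) = grad_trace P" if "E = D1 \<or> E = D3" for P E
  proof -
    have "E \<bullet> glue_div M \<tau> = 0" if "\<tau> \<in> Hdiv_broken M" for \<tau>
      using o1 glue_div_image that \<open>E = D1 \<or> E = D3\<close> by blast
    then show ?thesis by (auto simp: grad_trace_def fun_eq_iff inner_diff_left)
  qed
  have td: "div_trace (P - E) = div_trace P" if "E = D2 \<or> E = D4" for P E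
  proof -
    have "E \<bullet> glue_grad M v = 0" if "v \<in> H1_broken M" for v
      using o2 glue_grad_image that \<open>E = D2 \<or> E = D4\<close> by blast
    then show ?thesis by (auto simp: div_trace_def fun_eq_iff inner_diff_left)
  qed
  show ?thesis
  proof (rule that[of u1 u2 u3 u4 "P1 - D4" "P2 - D3" "P3 - D2" "P4 - D1"])
    show "u = (u1, u2, u3, u4, div_trace (P1 - D4), grad_trace (P2 - D3), div_trace (P3 - D2), grad_trace (P4 - D1))"
      by (simp add: u' tg td)
    show "P1 - D4 \<in> div_graph0 \<Omega>" using P D24 by (intro subspace_diff div_graph0_subspace)
    show "P2 - D3 \<in> grad_graph0 \<Omega>" using P D13 by (intro subspace_diff grad_graph0_subspace)
    show "P3 - D2 \<in> div_graph \<Omega>"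
      using P D24 div_graph0_subset by (intro subspace_diff div_graph_subspace[OF open_domain]) auto
    show "P4 - D1 \<in> grad_graph \<Omega>"
      using P D13 grad_graph0_subset by (intro subspace_diff grad_graph_subspace[OF open_domain]) auto
    have "residual u1 u2 u3 u4 (P1 - D4) (P2 - D3) (P3 - D2) (P4 - D1) = residual u1 u2 u3 u4 P1 P2 P3 P4 - D"
      by (simp add: residual_def D' algebra_simps)
    then show "residual u1 u2 u3 u4 (P1 - D4) (P2 - D3) (P3 - D2) (P4 - D1) = energy u" by (simp add: D_def)
  qed
qed

text \<open>The trace norms are infima, hence at most the norms of the representatives from
  \<open>trial_cases_energy\<close>. Eight squares of size \<open>C * F\<close> give the square root
  of 8, rounded up to 3.\<close>

lemma energy_stability:
  assumes C: "stability_constant \<Omega> C" and u: "u \<in> trial_space \<Omega> M"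
  shows "norm_trial \<Omega> M u \<le> 3 * C * norm (energy u)" and "energy u = 0 \<Longrightarrow> u = 0"
proof -
  obtain u1 u2 u3 u4 P1 P2 P3 P4 where
    u': "u = (u1, u2, u3, u4, div_trace P1, grad_trace P2, div_trace P3, grad_trace P4)"
    and P: "P1 \<in> div_graph0 \<Omega>" "P2 \<in> grad_graph0 \<Omega>" "P3 \<in> div_graph \<Omega>" "P4 \<in> grad_graph \<Omega>"
    and R: "residual u1 u2 u3 u4 P1 P2 P3 P4 = energy u"
    by (rule trial_cases_energy[OF u])
  define F where "F = norm (energy u)"
  have F1: "norm (P4 + (u1, - u4)) \<le> F" and F234: "norm (P3 - (u3, u4), P2 - (u3, u2), P1 - (u1, u2)) \<le> F"
    unfolding F_def R[symmetric] residual_def by (rule norm_fst_le, rule norm_snd_le)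
  have F2: "norm (P3 - (u3, u4)) \<le> F" by (rule order_trans[OF norm_fst_le F234])
  have F34: "norm (P2 - (u3, u2), P1 - (u1, u2)) \<le> F" by (rule order_trans[OF norm_snd_le F234])
  have F3: "norm (P2 - (u3, u2)) \<le> F" by (rule order_trans[OF norm_fst_le F34])
  have F4: "norm (P1 - (u1, u2)) \<le> F" by (rule order_trans[OF norm_snd_le F34])
  have "norm u1 \<le> C * F \<and> norm u2 \<le> C * F \<and> norm u3 \<le> C * F \<and> norm u4 \<le> C * F \<and>
      norm P1 \<le> C * F \<and> norm P2 \<le> C * F \<and> norm P3 \<le> C * F \<and> norm P4 \<le> C * F"
    using C P F1 F2 F3 F4 unfolding stability_constant_def by blast
  then have b: "norm u1 \<le> C * F" "norm u2 \<le> C * F" "norm u3 \<le> C * F" "norm u4 \<le> C * F"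
    "norm P1 \<le> C * F" "norm P2 \<le> C * F" "norm P3 \<le> C * F" "norm P4 \<le> C * F" by auto
  have P': "P1 \<in> div_graph \<Omega>" "P2 \<in> grad_graph \<Omega>" using P div_graph0_subset grad_graph0_subset by auto
  have h: "norm_mhalf \<Omega> M (div_trace P1) \<le> C * F" "norm_half \<Omega> M (grad_trace P2) \<le> C * F"
    "norm_mhalf \<Omega> M (div_trace P3) \<le> C * F" "norm_half \<Omega> M (grad_trace P4) \<le> C * F"
    using norm_mhalf_le[OF P'(1)] norm_half_le[OF P'(2)] norm_mhalf_le[OF P(3)] norm_half_le[OF P(4)] b by auto
  note n = norm_mhalf_nonneg[OF P'(1)] norm_half_nonneg[OF P'(2)] norm_mhalf_nonneg[OF P(3)] norm_half_nonneg[OF P(4)]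
  have CF: "0 \<le> C * F" using C by (simp add: stability_constant_def F_def)
  have "norm_trial \<Omega> M u \<le> sqrt ((C * F)\<^sup>2 + (C * F)\<^sup>2 + (C * F)\<^sup>2 + (C * F)\<^sup>2 + (C * F)\<^sup>2 + (C * F)\<^sup>2 + (C * F)\<^sup>2 + (C * F)\<^sup>2)"
    unfolding u' norm_trial_def prod.case
    by (intro real_sqrt_le_mono add_mono power_mono b h n norm_ge_zero)
  also have "\<dots> \<le> sqrt ((3 * (C * F))\<^sup>2)" by (intro real_sqrt_le_mono) (simp add: power_mult_distrib)
  also have "\<dots> = 3 * C * F" unfolding real_sqrt_abs using CF by (simp add: mult.assoc)
  finally show "norm_trial \<Omega> M u \<le> 3 * C * norm (energy u)" by (simp add: F_def)
  show "u = 0" if "energy u = 0"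
  proof -
    have "F = 0" using that by (simp add: F_def)
    then have "u1 = 0" "u2 = 0" "u3 = 0" "u4 = 0" "P1 = 0" "P2 = 0" "P3 = 0" "P4 = 0" using b by auto
    moreover have "div_trace 0 = 0" "grad_trace 0 = 0" by (auto simp: div_trace_def grad_trace_def fun_eq_iff)
    ultimately show ?thesis by (simp add: u' zero_prod_def)
  qed
qed

text \<open>12 = 4 * 2 + 4: each of the four volume pairings involves a pair of two
  \<open>L2\<close> components, and each of the four trace pairings counts once. The traces enter
  through their quotient norms, since a given representative may be much larger.\<close>

lemma b_form_bound:
  assumes u: "u \<in> trial_space \<Omega> M" and v: "v \<in> test_space M"
  shows "\<bar>b_form M u v\<bar> \<le> 12 * norm_trial \<Omega> M u * norm (glue_test v)"
proof -
  obtain u1 u2 u3 u4 P1 P2 P3 P4 where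
    u': "u = (u1, u2, u3, u4, div_trace P1, grad_trace P2, div_trace P3, grad_trace P4)"
    and P: "P1 \<in> div_graph0 \<Omega>" "P2 \<in> grad_graph0 \<Omega>" "P3 \<in> div_graph \<Omega>" "P4 \<in> grad_graph \<Omega>"
    by (rule trial_cases[OF u])
  have P': "P1 \<in> div_graph \<Omega>" "P2 \<in> grad_graph \<Omega>" using P div_graph0_subset grad_graph0_subset by auto
  obtain v1 v2 v3 v4 where v': "v = (v1, v2, v3, v4)" by (cases v)
  have m: "v1 \<in> Hdiv_broken M" "v2 \<in> H1_broken M" "v3 \<in> Hdiv_broken M" "v4 \<in> H1_broken M"
    using v by (auto simp: v' test_space_def)
  define U where "U = norm_trial \<Omega> M u"
  define V where "V = norm (glue_test v)"
  have U: "norm u1 \<le> U" "norm u2 \<le> U" "norm u3 \<le> U" "norm u4 \<le> U"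
    "norm_mhalf \<Omega> M (div_trace P1) \<le> U" "norm_half \<Omega> M (grad_trace P2) \<le> U"
    "norm_mhalf \<Omega> M (div_trace P3) \<le> U" "norm_half \<Omega> M (grad_trace P4) \<le> U"
    unfolding U_def u' norm_trial_def prod.case by (rule real_le_rsqrt, simp)+
  have U0: "0 \<le> U" using U(1) norm_ge_zero order_trans by blast
  have V1: "norm (glue_div M v1) \<le> V" and V234: "norm (glue_grad M v2, glue_div M v3, glue_grad M v4) \<le> V"
    unfolding V_def v' glue_test_def prod.case by (rule norm_fst_le, rule norm_snd_le)
  have V2: "norm (glue_grad M v2) \<le> V" by (rule order_trans[OF norm_fst_le V234])
  have V34: "norm (glue_div M v3, glue_grad M v4) \<le> V" by (rule order_trans[OF norm_snd_le V234])
  have V3: "norm (glue_div M v3) \<le> V" by (rule order_trans[OF norm_fst_le V34])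
  have V4: "norm (glue_grad M v4) \<le> V" by (rule order_trans[OF norm_snd_le V34])
  have t: "\<bar>div_trace P1 v4\<bar> \<le> U * V" "\<bar>grad_trace P2 v3\<bar> \<le> U * V" "\<bar>div_trace P3 v2\<bar> \<le> U * V" "\<bar>grad_trace P4 v1\<bar> \<le> U * V"
    using order_trans[OF div_trace_bound[OF P'(1) m(4)] mult_mono[OF U(5) V4 U0 norm_ge_zero]]
      order_trans[OF grad_trace_bound[OF P'(2) m(3)] mult_mono[OF U(6) V3 U0 norm_ge_zero]]
      order_trans[OF div_trace_bound[OF P(3) m(2)] mult_mono[OF U(7) V2 U0 norm_ge_zero]]
      order_trans[OF grad_trace_bound[OF P(4) m(1)] mult_mono[OF U(8) V1 U0 norm_ge_zero]] by blast+
  have pair: "\<bar>(x, y) \<bullet> z\<bar> \<le> 2 * (U * V)" if "norm x \<le> U" "norm y \<le> U" "norm z \<le> V"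
    for x :: "('a, 'a) l2" and y :: "('a, real) l2" and z
  proof -
    have "\<bar>(x, y) \<bullet> z\<bar> \<le> norm (x, y) * norm z" by (rule Cauchy_Schwarz_ineq2)
    also have "\<dots> \<le> (U + U) * V" using norm_Pair_le[of x y] that U0 by (intro mult_mono) auto
    finally show ?thesis by simp
  qed
  have "b_form M u v = (u1, - u4) \<bullet> glue_div M v1 - (u3, u4) \<bullet> glue_grad M v2 - (u3, u2) \<bullet> glue_div M v3
      - (u1, u2) \<bullet> glue_grad M v4 + div_trace P1 v4 + grad_trace P2 v3 + div_trace P3 v2 + grad_trace P4 v1"
    using m unfolding u' b_form_eq[OF v] unfolding v'
    by (simp add: residual_def glue_test_def div_trace_def grad_trace_def inner_add_left inner_diff_left)
  moreover have "\<bar>(u1, - u4) \<bullet> glue_div M v1\<bar> \<le> 2 * (U * V)" "\<bar>(u3, u4) \<bullet> glue_grad M v2\<bar> \<le> 2 * (U * V)"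
    "\<bar>(u3, u2) \<bullet> glue_div M v3\<bar> \<le> 2 * (U * V)" "\<bar>(u1, u2) \<bullet> glue_grad M v4\<bar> \<le> 2 * (U * V)"
    using U V1 V2 V3 V4 by (auto intro!: pair simp del: inner_Pair)
  ultimately have "\<bar>b_form M u v\<bar> \<le> 12 * (U * V)" using t by linarith
  then show ?thesis by (simp add: U_def V_def)
qed

text \<open>Testing with the trial-to-test image of \<open>u\<close> gives the square of the energy
  norm; one factor cancels unless it is 0.\<close>

lemma energy_bound:
  assumes u: "u \<in> trial_space \<Omega> M"
  shows "norm (energy u) \<le> 12 * norm_trial \<Omega> M u"
proof -
  have "norm (energy u) * norm (energy u) = b_form M u (trial_to_test M u)"
    using energy_inner[OF u trial_to_test_in[OF u]]
    by (simp add: energy_def power2_norm_eq_inner[symmetric] power2_eq_square)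
  also have "\<dots> \<le> 12 * norm_trial \<Omega> M u * norm (energy u)"
    using b_form_bound[OF u trial_to_test_in[OF u]] by (simp add: energy_def)
  finally have "energy u \<noteq> 0 \<Longrightarrow> ?thesis" by (simp add: mult_le_cancel_right)
  moreover have "0 \<le> norm_trial \<Omega> M u"
    by (rule trial_exhaust[of u]) (simp add: norm_trial_def)
  ultimately show ?thesis by (cases "energy u = 0") auto
qed

section \<open>Galerkin projection in the energy norm\<close>

lemma energy_projection:
  assumes U: "finite_dim_subspace U (trial_space \<Omega> M)"
  shows "\<exists>x\<in>U. \<forall>y\<in>U. (a - energy x) \<bullet> energy y = 0"
proof -
  obtain B where B: "finite B" "U = span B" and sU: "subspace U" "U \<subseteq> trial_space \<Omega> M"
    using U by (auto simp: finite_dim_subspace_def)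
  \<comment> \<open>The projection is found in the span of the images of the finite set
    \<open>B\<close>. The inclusions \<open>sub\<close> and \<open>sup\<close> identify this span
    with the image of \<open>U\<close>.\<close>
  have sub: "span (energy ` B) \<subseteq> energy ` U"
  proof (rule span_minimal)
    show "energy ` B \<subseteq> energy ` U" unfolding B(2) by (intro image_mono span_superset)
    show "subspace (energy ` U)"
    proof (rule subspaceI)
      have "0 \<in> U" using sU(1) by (rule subspace_0)
      then have "energy 0 = 0" using energy_diff(2)[of 0 0] sU(2) by auto
      then show "0 \<in> energy ` U" using \<open>0 \<in> U\<close> by force
      fix x y and c :: real assume "x \<in> energy ` U"
      then obtain p where p: "p \<in> U" "x = energy p" by blast
      have "energy (c *\<^sub>R p + 0) = c *\<^sub>R energy p + energy 0"
        using p \<open>0 \<in> U\<close> sU(2) by (intro energy_lincomb) auto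
      then show "c *\<^sub>R x \<in> energy ` U"
        using p \<open>energy 0 = 0\<close> subspace_scale[OF sU(1) p(1), of c] by force
      assume "y \<in> energy ` U"
      then obtain q where q: "q \<in> U" "y = energy q" by blast
      have "energy (1 *\<^sub>R p + q) = 1 *\<^sub>R energy p + energy q"
        using p q sU(2) by (intro energy_lincomb) auto
      then show "x + y \<in> energy ` U"
        using p q subspace_add[OF sU(1) p(1) q(1)] by force
    qed
  qed
  have sup: "energy y \<in> span (energy ` B)" if "y \<in> U" for y
  proof -
    have "y \<in> U \<and> energy y \<in> span (energy ` B)"
      using that[unfolded B(2)]
    proof (induction y rule: span_induct_alt)
      case base
      have "0 \<in> U" using sU(1) by (rule subspace_0)
      then have "energy 0 = 0" using energy_diff(2)[of 0 0] sU(2) by auto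
      with \<open>0 \<in> U\<close> show ?case by (simp add: span_zero)
    next
      case (step c x y)
      have x: "x \<in> U" using step by (simp add: B(2) span_base)
      have "energy (c *\<^sub>R x + y) = c *\<^sub>R energy x + energy y"
        using x step sU(2) by (intro energy_lincomb) auto
      moreover have "energy x \<in> span (energy ` B)" using step by (intro span_base) auto
      ultimately show ?case
        using step x sU(1) by (auto intro: span_add span_scale subspace_add subspace_scale)
    qed
    then show ?thesis by blast
  qed
  obtain w where w: "w \<in> span (energy ` B)" "\<forall>v\<in>span (energy ` B). (a - w) \<bullet> v = 0"
    using projection_exists_span[of "energy ` B" a] B(1) by auto
  then obtain x where "x \<in> U" "w = energy x" using sub by blast
  then show ?thesis using w(2) sup by blast
qed

text \<open>These are the normal equations: the discrete problem asks for the best approximation of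
  \<open>energy u\<close> from the image of \<open>U\<close>, the load being replaced by means of
  the exact solution.\<close>

lemma discrete_solution_iff:
  assumes U: "U \<subseteq> trial_space \<Omega> M" and sol: "is_solution \<Omega> M f u"
  shows "is_discrete_solution M f U x \<longleftrightarrow> x \<in> U \<and> (\<forall>y\<in>U. (energy u - energy x) \<bullet> energy y = 0)"
proof -
  have u: "u \<in> trial_space \<Omega> M" and bu: "\<And>v. v \<in> test_space M \<Longrightarrow> b_form M u v = load M f v"
    using sol by (auto simp: is_solution_def)
  have "b_form M x (trial_to_test M y) = load M f (trial_to_test M y) \<longleftrightarrow> (energy u - energy x) \<bullet> energy y = 0"
    if x: "x \<in> U" and y: "y \<in> U" for y
  proof -
    have xt: "x \<in> trial_space \<Omega> M" and yt: "y \<in> trial_space \<Omega> M" using x y U by auto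
    note ty = trial_to_test_in[OF yt]
    have "b_form M x (trial_to_test M y) = energy x \<bullet> energy y"
      using energy_inner[OF xt ty] by (simp add: energy_def)
    moreover have "load M f (trial_to_test M y) = energy u \<bullet> energy y"
      using energy_inner[OF u ty] bu[OF ty] by (simp add: energy_def)
    ultimately show ?thesis by (auto simp: inner_diff_left)
  qed
  then show ?thesis unfolding is_discrete_solution_def by blast
qed

text \<open>36 = 3 * 12: stability and continuity each contribute a factor, while best approximation
  in the energy norm costs nothing.\<close>

lemma quasi_optimality:
  assumes C: "stability_constant \<Omega> C" and sol: "is_solution \<Omega> M f u"
    and U: "finite_dim_subspace U (trial_space \<Omega> M)"
  shows "\<exists>!x. is_discrete_solution M f U x"
    and "is_discrete_solution M f U x \<Longrightarrow> w \<in> U \<Longrightarrow>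
      norm_trial \<Omega> M (u - x) \<le> 36 * C * norm_trial \<Omega> M (u - w)"
proof -
  have sU: "subspace U" "U \<subseteq> trial_space \<Omega> M" using U by (auto simp: finite_dim_subspace_def)
  have u: "u \<in> trial_space \<Omega> M" using sol by (simp add: is_solution_def)
  note iff = discrete_solution_iff[OF sU(2) sol]
  obtain x0 where x0: "is_discrete_solution M f U x0"
    using energy_projection[OF U, of "energy u"] iff by blast
  show "\<exists>!x. is_discrete_solution M f U x"
  proof (rule ex1I[of _ x0])
    show "is_discrete_solution M f U x0" by (rule x0)
    fix y assume y: "is_discrete_solution M f U y"
    have U': "y \<in> U" "x0 \<in> U" using x0 y iff by auto
    then have t: "y \<in> trial_space \<Omega> M" "x0 \<in> trial_space \<Omega> M" using sU by auto
    have "y - x0 \<in> U" using sU(1) U' by (rule subspace_diff)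
    then have "(energy u - energy y) \<bullet> energy (y - x0) = 0" "(energy u - energy x0) \<bullet> energy (y - x0) = 0"
      using x0 y iff by blast+
    then have "energy (y - x0) \<bullet> energy (y - x0) = 0"
      by (simp add: energy_diff(2)[OF t] inner_diff_left)
    then have "energy (y - x0) = 0" by simp
    \<comment> \<open>Orthogonality determines only the energy; the trial function itself is
      recovered from the trivial kernel of \<open>energy\<close>.\<close>
    then have "y - x0 = 0" by (rule energy_stability(2)[OF C energy_diff(1)[OF t]])
    then show "y = x0" by simp
  qed
  assume x: "is_discrete_solution M f U x" and w: "w \<in> U"
  have xU: "x \<in> U" using x iff by blast
  have t: "x \<in> trial_space \<Omega> M" "w \<in> trial_space \<Omega> M" using xU w sU by auto
  have "x - w \<in> U" using sU(1) xU w by (rule subspace_diff)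
  \<comment> \<open>Galerkin orthogonality, tested with \<open>x - w\<close>, which lies in
    \<open>U\<close>.\<close>
  then have orth: "(energy u - energy x) \<bullet> (energy x - energy w) = 0"
    using x iff energy_diff(2)[OF t] by metis
  have "norm (energy u - energy x) \<le> norm (energy u - energy w)"
  proof -
    have "energy u - energy w = (energy u - energy x) + (energy x - energy w)" by simp
    then have "(norm (energy u - energy w))\<^sup>2 = (norm (energy u - energy x))\<^sup>2 + (norm (energy x - energy w))\<^sup>2"
      using norm_add_Pythagorean[of "energy u - energy x" "energy x - energy w"] orth by (simp add: orthogonal_def)
    then show ?thesis by (intro power2_le_imp_le[OF _ norm_ge_zero]) simp
  qed
  then have "norm (energy (u - x)) \<le> norm (energy (u - w))"
    by (simp add: energy_diff(2)[OF u t(1)] energy_diff(2)[OF u t(2)])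
  also have "\<dots> \<le> 12 * norm_trial \<Omega> M (u - w)" by (rule energy_bound[OF energy_diff(1)[OF u t(2)]])
  finally have e: "norm (energy (u - x)) \<le> 12 * norm_trial \<Omega> M (u - w)" .
  have "0 \<le> 3 * C" using C by (simp add: stability_constant_def)
  have "norm_trial \<Omega> M (u - x) \<le> 3 * C * norm (energy (u - x))"
    by (rule energy_stability(1)[OF C energy_diff(1)[OF u t(1)]])
  also have "\<dots> \<le> 3 * C * (12 * norm_trial \<Omega> M (u - w))" by (rule mult_left_mono[OF e \<open>0 \<le> 3 * C\<close>])
  finally show "norm_trial \<Omega> M (u - x) \<le> 36 * C * norm_trial \<Omega> M (u - w)" by simp
qed

end

theorem theorem8:
  fixes \<Omega> :: "'a::euclidean_space set"
  assumes "DIM('a) \<ge> 2"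
    and "bounded \<Omega>"
    and "lipschitz_domain \<Omega>"
    and "simply_connected \<Omega>"
  shows "\<exists>C>0. \<forall>M f u. is_mesh \<Omega> M \<longrightarrow> f \<in> L2 \<Omega> \<longrightarrow> is_solution \<Omega> M f u \<longrightarrow>
    (\<forall>U\<^sub>h. finite_dim_subspace U\<^sub>h (trial_space \<Omega> M) \<longrightarrow>
      (\<exists>!u\<^sub>h. is_discrete_solution M f U\<^sub>h u\<^sub>h) \<and>
      (\<forall>u\<^sub>h. is_discrete_solution M f U\<^sub>h u\<^sub>h \<longrightarrow>
        (\<forall>w\<in>U\<^sub>h. norm_trial \<Omega> M (u - u\<^sub>h) \<le> C * norm_trial \<Omega> M (u - w))))"
proof -
  \<comment> \<open>Chosen before any mesh is fixed: \<open>stability_constant\<close> speaks of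
    \<Omega> alone, and this is the mesh independence.\<close>
  obtain C where C: "stability_constant \<Omega> C"
    using stability_constant_exists[OF assms(3) assms(2)] by (rule exE)
  show ?thesis
  proof (intro exI[of _ "36 * C"] conjI allI impI ballI)
    show "0 < 36 * C" using C by (simp add: stability_constant_def)
    fix M f u U\<^sub>h
    assume mesh: "is_mesh \<Omega> M" and sol: "is_solution \<Omega> M f u"
      and U: "finite_dim_subspace U\<^sub>h (trial_space \<Omega> M)"
    have "open \<Omega>" using assms(3) unfolding lipschitz_domain_def by blast
    then interpret meshed_domain \<Omega> M using mesh by unfold_locales
    show "\<exists>!u\<^sub>h. is_discrete_solution M f U\<^sub>h u\<^sub>h"
      by (rule quasi_optimality(1)[OF C sol U])
    fix u\<^sub>h w assume "is_discrete_solution M f U\<^sub>h u\<^sub>h" "w \<in> U\<^sub>h"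
    then show "norm_trial \<Omega> M (u - u\<^sub>h) \<le> 36 * C * norm_trial \<Omega> M (u - w)"
      by (rule quasi_optimality(2)[OF C sol U])
  qed
qed

end
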